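(* Let $\Phi_{\mathrm{Spin}(9)} = c\int_{\mathbb{O}P^1} p_l^*\nu_l\,dl$ be the canonical $8$-form in $\mathbb{R}^{16}\cong\mathbb{O}^2$, and choose the constant $c$ in such a way that all its $702$ terms (its nonzero coefficients with respect to the standard monomial basis of $\Lambda^8\mathbb{R}^{16}$) are integers, with no common factors. Then $$c=\frac{110880}{\pi^4}\qquad\text{and}\qquad \Phi_{\mathrm{Spin}(9)}=\frac{1}{360}\,\tau_4(\psi),$$ where $\tau_4(\psi)$ is the fourth coefficient of the characteristic polynomial of the matrix $\psi$ of Kähler $2$-forms, i.e. the coefficient of $t^5$ in $\det(tI-\psi)$.
   Context: Octonions: $\mathbb{O}=\mathbb{H}\oplus\mathbb{H}e$ with product $(h_1+h_2e)(h_1'+h_2'e)=(h_1h_1'-\overline{h_2'}h_2)+(h_2\overline{h_1'}+h_2'h_1)e$, and real basis $1,i,j,k,e,f=ie,g=je,h=ke$. $\mathbb{R}^{16}=\mathbb{O}^2$ has coordinates $(x_1,\dots,x_8,x_1',\dots,x_8')$ and the Euclidean metric. $R_u:\mathbb{O}\to\mathbb{O}$ is right multiplication $x\mapsto xu$. Integral form: the octonionic lines of $\mathbb{O}^2$ are $l=l_m=\{(x,mx): x\in\mathbb{O}\}$ for $m\in\mathbb{O}$, and $l=\{(0,y): y\in\mathbb{O}\}$; they are parametrized by the octonionic projective line $\mathbb{O}P^1=S^8$. $\nu_l$ is the volume form on $l$, $p_l:\mathbb{O}^2\to l$ is the projection on $l$, and $dl$ is the invariant measure on $\mathbb{O}P^1$,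 equal to $(1+|m|^2)^{-8}\,dm_1\cdots dm_8$ in the chart $m\in\mathbb{O}\cong\mathbb{R}^8$. Kähler forms: the standard $\mathrm{Spin}(9)$-structure on $\mathbb{O}^2$ (column vectors $(x,x')$) is spanned by the nine symmetric, pairwise anticommuting involutions $\mathcal I_1=\begin{pmatrix}0&\mathrm{Id}\\ \mathrm{Id}&0\end{pmatrix}$, $\mathcal I_{2},\dots,\mathcal I_8=\begin{pmatrix}0&-R_u\\ R_u&0\end{pmatrix}$ for $u=i,j,k,e,f,g,h$ respectively, $\mathcal I_9=\begin{pmatrix}\mathrm{Id}&0\\0&-\mathrm{Id}\end{pmatrix}$. For $\alpha\ne\beta$, $J_{\alpha\beta}=\mathcal I_\alpha\mathcal I_\beta$ is a complex structure, with Kähler form $\psi_{\alpha\beta}(X,Y)=\langle X,J_{\alpha\beta}Y\rangle$; put $\psi_{\alpha\alpha}=0$. Then $\psi=(\psi_{\alpha\beta})_{1\le\alpha,\beta\le9}$ is a skew-symmetric $9\times9$ matrix of $2$-forms, and $\det(tI-\psi)=t^9+\tau_1(\psi)t^8+\dots+\tau_9(\psi)$ is computed in the commutative algebra of even-degree forms with wedge product.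
   Formalization: Lines {(x,mx)} and involutions with R_u are inconsistent: the equation with τ_4(ψ) then fails. It is proved for lines {(x,mx)} with left multiplications L_u, and for lines {(x,xm)} with R_u, the lines oriented so that signs agree; c is unique among c>0. *)

theory Defs
  imports "HOL-Analysis.Analysis" "Jordan_Normal_Form.Char_Poly"
begin

section \<open>Forms of even degree on a 16-dimensional space\<close>

text \<open>
  A form on \<open>\<real>\<^sup>1\<^sup>6\<close> is represented by its coefficients in the standard monomial basis:
  \<open>f S\<close> is the coefficient of \<open>dx\<^bsub>s\<^esub> \<and> dx\<^bsub>t\<^esub> \<and> \<dots>\<close>, where \<open>s < t < \<dots>\<close> are the elements of
  \<open>S \<subseteq> {0,\<dots>,15}\<close>.  The forms of even degree are a commutative ring under the wedge product,
  so that the library's \<^const>\<open>char_poly\<close> applies to matrices over them.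
\<close>

definition wedge_sign :: "nat set \<Rightarrow> nat set \<Rightarrow> real" where
  "wedge_sign A B = (-1) ^ card {(a, b). a \<in> A \<and> b \<in> B \<and> b < a}"

typedef even_form =
  "{f :: nat set \<Rightarrow> real. \<forall>S. f S \<noteq> 0 \<longrightarrow> S \<subseteq> {..<16} \<and> even (card S)}"
  morphisms form_coeff Even_Form
  by (rule exI[of _ "\<lambda>_. 0"]) simp

setup_lifting type_definition_even_form

lemma wedge_sign_empty [simp]: "wedge_sign {} B = 1" "wedge_sign A {} = 1"
  by (simp_all add: wedge_sign_def)

lemma finite_inversions:
  "finite A \<Longrightarrow> finite B \<Longrightarrow> finite {(a, b). a \<in> A \<and> b \<in> B \<and> (b::nat) < a}"
  by (rule finite_subset[of _ "A \<times> B"]) auto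

lemma wedge_sign_union_left:
  assumes "finite A" "finite B" "finite C" "A \<inter> B = {}"
  shows "wedge_sign (A \<union> B) C = wedge_sign A C * wedge_sign B C"
proof -
  have "{(a, b). a \<in> A \<union> B \<and> b \<in> C \<and> b < a} =
      {(a, b). a \<in> A \<and> b \<in> C \<and> b < a} \<union> {(a, b). a \<in> B \<and> b \<in> C \<and> b < a}" by auto
  moreover have "{(a, b). a \<in> A \<and> b \<in> C \<and> b < a} \<inter> {(a, b). a \<in> B \<and> b \<in> C \<and> b < a} = {}"
    using assms(4) by auto
  ultimately show ?thesis
    using assms by (simp add: wedge_sign_def card_Un_disjoint finite_inversions power_add)
qed

lemma wedge_sign_union_right:
  assumes "finite A" "finite B" "finite C" "B \<inter> C = {}"
  shows "wedge_sign A (B \<union> C) = wedge_sign A B * wedge_sign A C"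
proof -
  have "{(a, b). a \<in> A \<and> b \<in> B \<union> C \<and> b < a} =
      {(a, b). a \<in> A \<and> b \<in> B \<and> b < a} \<union> {(a, b). a \<in> A \<and> b \<in> C \<and> b < a}" by auto
  moreover have "{(a, b). a \<in> A \<and> b \<in> B \<and> b < a} \<inter> {(a, b). a \<in> A \<and> b \<in> C \<and> b < a} = {}"
    using assms(4) by auto
  ultimately show ?thesis
    using assms by (simp add: wedge_sign_def card_Un_disjoint finite_inversions power_add)
qed

lemma wedge_sign_commute:
  assumes "finite A" "finite B" "A \<inter> B = {}" "even (card A)"
  shows "wedge_sign A B = wedge_sign B A"
proof -
  let ?X = "{(a, b). a \<in> A \<and> b \<in> B \<and> b < a}" and ?Y = "{(b, a). b \<in> B \<and> a \<in> A \<and> a < b}"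
  have "A \<times> B = ?X \<union> prod.swap ` ?Y"
  proof (intro Set.set_eqI iffI)
    fix p assume "p \<in> A \<times> B"
    then obtain a b where p: "p = (a, b)" "a \<in> A" "b \<in> B" by auto
    then have "a \<noteq> b" using assms(3) by blast
    then consider "b < a" | "a < b" by linarith
    then show "p \<in> ?X \<union> prod.swap ` ?Y"
    proof cases
      case 1
      then show ?thesis using p by simp
    next
      case 2
      then have "(b, a) \<in> ?Y" using p by simp
      then have "prod.swap (b, a) \<in> prod.swap ` ?Y" by (rule imageI)
      then show ?thesis using p by simp
    qed
  qed auto
  moreover have "?X \<inter> prod.swap ` ?Y = {}" by auto
  moreover have "finite ?X" "finite ?Y" using assms(1,2) by (simp_all add: finite_inversions)
  ultimately have "card (A \<times> B) = card ?X + card (prod.swap ` ?Y)"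
    by (simp only: card_Un_disjoint finite_imageI)
  also have "card (prod.swap ` ?Y) = card ?Y" by (rule card_image) (auto simp: inj_on_def)
  finally have "card ?X + card ?Y = card A * card B" by (simp only: card_cartesian_product)
  then have "even (card ?X + card ?Y)" using assms(4) by (simp only: even_mult_iff simp_thms)
  then show ?thesis unfolding wedge_sign_def by (cases "even (card ?X)") auto
qed

lemma even_support_times:
  fixes f g :: "nat set \<Rightarrow> real"
  assumes f: "\<And>S. f S \<noteq> 0 \<Longrightarrow> S \<subseteq> {..<16} \<and> even (card S)"
    and g: "\<And>S. g S \<noteq> 0 \<Longrightarrow> S \<subseteq> {..<16} \<and> even (card S)"
    and ne: "(\<Sum>A\<in>Pow S. wedge_sign A (S - A) * f A * g (S - A)) \<noteq> 0"
  shows "S \<subseteq> {..<16} \<and> even (card S)"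
proof -
  from ne obtain A where A: "A \<subseteq> S" and "wedge_sign A (S - A) * f A * g (S - A) \<noteq> 0"
    using sum.neutral[of "Pow S" "\<lambda>A. wedge_sign A (S - A) * f A * g (S - A)"] by auto
  then have *: "A \<subseteq> {..<16}" "even (card A)" "S - A \<subseteq> {..<16}" "even (card (S - A))"
    using f g by auto
  then have "finite A" "finite (S - A)" by (auto intro: finite_subset[OF _ finite_lessThan])
  then have "card (A \<union> (S - A)) = card A + card (S - A)" by (intro card_Un_disjoint) auto
  moreover have "A \<union> (S - A) = S" using A by blast
  ultimately have "even (card S)" using * by simp
  then show ?thesis using * by blast
qed

instantiation even_form :: comm_ring_1
begin

lift_definition zero_even_form :: even_form is "\<lambda>_. 0" by simp
lift_definition one_even_form :: even_form is "\<lambda>S. if S = {} then 1 else 0" by (simp split: if_splits)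
lift_definition plus_even_form :: "even_form \<Rightarrow> even_form \<Rightarrow> even_form" is "\<lambda>f g S. f S + g S"
  by (metis add.right_neutral)
lift_definition minus_even_form :: "even_form \<Rightarrow> even_form \<Rightarrow> even_form" is "\<lambda>f g S. f S - g S"
  by (metis diff_zero)
lift_definition uminus_even_form :: "even_form \<Rightarrow> even_form" is "\<lambda>f S. - f S" by simp
lift_definition times_even_form :: "even_form \<Rightarrow> even_form \<Rightarrow> even_form" is
  "\<lambda>f g S. \<Sum>A\<in>Pow S. wedge_sign A (S - A) * f A * g (S - A)"
  by (rule even_support_times)

instance
proof
  fix a b c :: even_form
  show "a + b + c = a + (b + c)" by transfer (simp add: algebra_simps)
  show "a + b = b + a" by transfer (simp add: algebra_simps)
  show "0 + a = a" by transfer simp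
  show "- a + a = 0" by transfer simp
  show "a - b = a + - b" by transfer simp
  show "(0::even_form) \<noteq> 1" by transfer (auto simp: fun_eq_iff)
  show "(a + b) * c = a * c + b * c"
    by transfer (simp add: algebra_simps sum.distrib)
  show "1 * a = a"
  proof (transfer, rule ext)
    fix f :: "nat set \<Rightarrow> real" and S
    assume f: "\<forall>S. f S \<noteq> 0 \<longrightarrow> S \<subseteq> {..<16} \<and> even (card S)"
    show "(\<Sum>A\<in>Pow S. wedge_sign A (S - A) * (if A = {} then 1 else 0) * f (S - A)) = f S"
    proof (cases "finite S")
      case True
      have "(\<Sum>A\<in>Pow S. wedge_sign A (S - A) * (if A = {} then 1 else 0) * f (S - A)) =
          (\<Sum>A\<in>Pow S. if A = {} then f S else 0)"
        by (rule sum.cong) auto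
      also have "\<dots> = f S" using True by simp
      finally show ?thesis .
    next
      case False
      then show ?thesis using f by (auto dest: finite_subset)
    qed
  qed
  show "a * b = b * a"
  proof (transfer, rule ext)
    fix f g :: "nat set \<Rightarrow> real" and S
    assume f: "\<forall>S. f S \<noteq> 0 \<longrightarrow> S \<subseteq> {..<16} \<and> even (card S)"
      and g: "\<forall>S. g S \<noteq> 0 \<longrightarrow> S \<subseteq> {..<16} \<and> even (card S)"
    show "(\<Sum>A\<in>Pow S. wedge_sign A (S - A) * f A * g (S - A)) =
        (\<Sum>A\<in>Pow S. wedge_sign A (S - A) * g A * f (S - A))"
    proof (cases "finite S")
      case True
      show ?thesis
      proof (rule sum.reindex_bij_witness[of _ "\<lambda>A. S - A" "\<lambda>A. S - A"])
        fix A assume "A \<in> Pow S"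
        then have A: "A \<subseteq> S" by simp
        then have *: "S - (S - A) = A" by auto
        show "wedge_sign (S - A) (S - (S - A)) * g (S - A) * f (S - (S - A)) =
            wedge_sign A (S - A) * f A * g (S - A)"
        proof (cases "f A = 0")
          case False
          then have "even (card A)" using f by blast
          then have "wedge_sign A (S - A) = wedge_sign (S - A) A"
            using A True by (intro wedge_sign_commute) (auto dest: finite_subset)
          then show ?thesis using * by simp
        qed (use * in simp)
      qed auto
    next
      case False
      then show ?thesis by simp
    qed
  qed
  show "a * b * c = a * (b * c)"
  proof (transfer, rule ext)
    fix f g h :: "nat set \<Rightarrow> real" and S :: "nat set"
    show "(\<Sum>A\<in>Pow S. wedge_sign A (S - A) *
            (\<Sum>B\<in>Pow A. wedge_sign B (A - B) * f B * g (A - B)) * h (S - A)) =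
        (\<Sum>A\<in>Pow S. wedge_sign A (S - A) * f A *
            (\<Sum>B\<in>Pow (S - A). wedge_sign B (S - A - B) * g B * h (S - A - B)))"
      (is "?L = ?R")
    proof (cases "finite S")
      case fin: True
      let ?l = "\<lambda>A B. wedge_sign A (S - A) * (wedge_sign B (A - B) * f B * g (A - B)) * h (S - A)"
      let ?r = "\<lambda>A B. wedge_sign A (S - A) * f A *
            (wedge_sign B (S - A - B) * g B * h (S - A - B))"
      have "?L = (\<Sum>A\<in>Pow S. \<Sum>B\<in>Pow A. ?l A B)"
        by (simp add: sum_distrib_left sum_distrib_right)
      also have "\<dots> = (\<Sum>(A, B)\<in>(SIGMA A:Pow S. Pow A). ?l A B)"
        using fin by (subst sum.Sigma) (auto intro: finite_subset)
      also have "\<dots> = (\<Sum>(A, B)\<in>(SIGMA A:Pow S. Pow (S - A)). ?r A B)"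
      proof (rule sum.reindex_bij_witness[of _ "\<lambda>(A, B). (A \<union> B, A)" "\<lambda>(A, B). (B, A - B)"])
        fix p assume "p \<in> (SIGMA A:Pow S. Pow A)"
        then obtain A B where p: "p = (A, B)" and A: "A \<subseteq> S" and B: "B \<subseteq> A" by auto
        define D E where "D = A - B" and "E = S - A"
        have eqs: "A = B \<union> D" "S - B = D \<union> E" "D \<union> E - D = E" "B \<union> D - B = D" "S - (B \<union> D) = E"
          using A B by (auto simp: D_def E_def)
        have fins: "finite B" "finite D" "finite E"
          using fin A B by (auto simp: D_def E_def dest: finite_subset)
        have disj: "B \<inter> D = {}" "D \<inter> E = {}" "B \<inter> E = {}"
          using A B by (auto simp: D_def E_def)
        show "(case case p of (A, B) \<Rightarrow> (B, A - B) of (A, B) \<Rightarrow> ?r A B) = (case p of (A, B) \<Rightarrow> ?l A B)"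
          by (simp add: p eqs wedge_sign_union_left wedge_sign_union_right fins disj)
      qed auto
      also have "\<dots> = (\<Sum>A\<in>Pow S. \<Sum>B\<in>Pow (S - A). ?r A B)"
        using fin by (subst sum.Sigma) (auto intro: finite_subset)
      also have "\<dots> = ?R" by (simp add: sum_distrib_left)
      finally show ?thesis .
    next
      case False
      then show ?thesis by simp
    qed
  qed
qed

end

instantiation even_form :: real_vector
begin

lift_definition scaleR_even_form :: "real \<Rightarrow> even_form \<Rightarrow> even_form" is "\<lambda>c f S. c * f S" by simp

instance
  by standard (transfer; simp add: algebra_simps)+

end


section \<open>Octonions\<close>

type_synonym quat = "real \<times> real \<times> real \<times> real"
type_synonym oct = "quat \<times> quat"
type_synonym oct2 = "oct \<times> oct"

fun quat_mult :: "quat \<Rightarrow> quat \<Rightarrow> quat" where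
  "quat_mult (a, b, c, d) (a', b', c', d') =
    (a * a' - b * b' - c * c' - d * d',
     a * b' + b * a' + c * d' - d * c',
     a * c' - b * d' + c * a' + d * b',
     a * d' + b * c' - c * b' + d * a')"

fun quat_cnj :: "quat \<Rightarrow> quat" where
  "quat_cnj (a, b, c, d) = (a, - b, - c, - d)"

text \<open>The pair \<open>(h\<^sub>1, h\<^sub>2)\<close> stands for \<open>h\<^sub>1 + h\<^sub>2 e\<close>.\<close>

fun oct_mult :: "oct \<Rightarrow> oct \<Rightarrow> oct" where
  "oct_mult (h1, h2) (h1', h2') =
    (quat_mult h1 h1' - quat_mult (quat_cnj h2') h2,
     quat_mult h2 (quat_cnj h1') + quat_mult h2' h1)"

definition quat_basis :: "nat \<Rightarrow> quat" where
  "quat_basis n = (of_bool (n = 0), of_bool (n = 1), of_bool (n = 2), of_bool (n = 3))"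

text \<open>The basis \<open>1, i, j, k, e, f, g, h\<close>, numbered from 0.\<close>

definition oct_basis :: "nat \<Rightarrow> oct" where
  "oct_basis n = (if n < 4 then (quat_basis n, 0) else (0, quat_basis (n - 4)))"

lemma oct_basis_f_g_h:
  "oct_mult (oct_basis 1) (oct_basis 4) = oct_basis 5"
  "oct_mult (oct_basis 2) (oct_basis 4) = oct_basis 6"
  "oct_mult (oct_basis 3) (oct_basis 4) = oct_basis 7"
  by (simp_all add: oct_basis_def quat_basis_def zero_prod_def)

text \<open>The basis dual to the coordinates \<open>x\<^sub>1, \<dots>, x\<^sub>8, x\<^sub>1', \<dots>, x\<^sub>8'\<close>, numbered from 0.\<close>

definition oct2_basis :: "nat \<Rightarrow> oct2" where
  "oct2_basis n = (if n < 8 then (oct_basis n, 0) else (0, oct_basis (n - 8)))"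

text \<open>
  The form of even degree \<open>k\<close> given by an alternating \<open>k\<close>-linear function \<open>\<phi>\<close> of a list of
  \<open>k\<close> vectors; normalised so that \<open>dx\<^sub>1 \<and> \<dots> \<and> dx\<^sub>k\<close> takes the value 1 on the first \<open>k\<close> basis
  vectors.
\<close>

lift_definition form_of :: "nat \<Rightarrow> (oct2 list \<Rightarrow> real) \<Rightarrow> even_form" is
  "\<lambda>k \<phi> S. if S \<subseteq> {..<16} \<and> card S = k \<and> even k
     then \<phi> (map oct2_basis (sorted_list_of_set S)) else 0"
  by (auto split: if_splits)


section \<open>The side of multiplication\<close>

text \<open>
  The lines \<open>{(x, m x)}\<close> are the eigenspaces of the unit linear combinations of the symmetric
  involutions with blocks built from left multiplications \<open>L\<^sub>u\<close>; those with right multiplications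
  \<open>R\<^sub>u\<close> belong to the lines \<open>{(x, x m)}\<close>.  The two conventions are interchanged by the isometry \<open>(x, x') \<mapsto> (cnj x, cnj x')\<close>
  but they give different 8-forms on \<open>\<real>\<^sup>1\<^sup>6\<close>, so that the same side has to be used for the lines
  and for the involutions.  The integral over the lines \<open>{(x, m x)}\<close> is not a multiple of the
  \<open>\<tau>\<^sub>4\<close> that is computed from the \<open>R\<^sub>u\<close>: the ratio of the coefficients of
  \<open>dx\<^sub>1 \<and> \<dots> \<and> dx\<^sub>6 \<and> dx\<^sub>7 \<and> dx\<^sub>8\<close> and \<open>dx\<^sub>1 \<and> \<dots> \<and> dx\<^sub>6 \<and> dx\<^sub>1' \<and> dx\<^sub>2'\<close> is 7 in the former and
  -7 in the latter.
\<close>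

datatype side = Left_mult | Right_mult

fun side_mult :: "side \<Rightarrow> oct \<Rightarrow> oct \<Rightarrow> oct" where
  "side_mult Left_mult u x = oct_mult u x"
| "side_mult Right_mult u x = oct_mult x u"


section \<open>The integral over the octonionic lines\<close>

text \<open>\<open>Some m\<close> is the line of slope \<open>m\<close>, and \<open>None\<close> is the line \<open>{(0, y)}\<close>.\<close>

type_synonym op1 = "oct option"

fun oct_line :: "side \<Rightarrow> op1 \<Rightarrow> oct2 set" where
  "oct_line s (Some m) = {(x, side_mult s m x) | x. True}"
| "oct_line s None = {(0, y) | y. True}"

fun line_frame :: "side \<Rightarrow> op1 \<Rightarrow> nat \<Rightarrow> oct2" where
  "line_frame s (Some m) i =
    (1 / sqrt (1 + (norm m)\<^sup>2)) *\<^sub>R (oct_basis i, side_mult s m (oct_basis i))"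
| "line_frame s None i = (0, oct_basis i)"

text \<open>
  The lines carry one of the two continuous families of orientations over \<open>OP\<^sup>1 = S\<^sup>8\<close>.
  On \<open>{(x, m x)}\<close> it is the one in which \<open>x \<mapsto> (x, m x)\<close> preserves orientation.  Conjugation of
  octonions has determinant -1, so the corresponding orientation of \<open>{(x, x m)}\<close> is the one
  in which \<open>x \<mapsto> (x, x m)\<close> reverses orientation.
\<close>

fun orientation_sign :: "side \<Rightarrow> real" where
  "orientation_sign Left_mult = 1"
| "orientation_sign Right_mult = -1"

definition line_volume_form :: "side \<Rightarrow> op1 \<Rightarrow> oct2 list \<Rightarrow> real" where
  "line_volume_form s l Y = orientation_sign s *
    Determinant.det (Matrix.mat 8 8 (\<lambda>(i, j). inner (line_frame s l i) (Y ! j)))"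

text \<open>The orthogonal projection onto a line.\<close>

definition line_proj :: "side \<Rightarrow> op1 \<Rightarrow> oct2 \<Rightarrow> oct2" where
  "line_proj s l = closest_point (oct_line s l)"

text \<open>The invariant measure; the point \<open>None\<close> that the chart misses has measure 0.\<close>

definition op1_measure :: "op1 measure" where
  "op1_measure =
    distr (density lborel (\<lambda>m :: oct. ennreal (1 / (1 + (norm m)\<^sup>2) ^ 8)))
      (sigma UNIV {A. Some -` A \<in> sets borel}) Some"

definition line_integral_form :: "side \<Rightarrow> even_form" where
  "line_integral_form s =
    form_of 8 (\<lambda>X. \<integral>l. line_volume_form s l (map (line_proj s l) X) \<partial>op1_measure)"

text \<open>Integer coefficients without a common factor.\<close>

definition primitive_integral :: "even_form \<Rightarrow> bool" where
  "primitive_integral \<omega> \<longleftrightarrow>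
    (\<exists>a :: nat set \<Rightarrow> int. (\<forall>S. form_coeff \<omega> S = of_int (a S)) \<and> Gcd (range a) = 1)"


section \<open>The Kaehler forms of the Spin(9)-structure\<close>

text \<open>The involutions are numbered from 1 to 9.\<close>

fun involution :: "side \<Rightarrow> nat \<Rightarrow> oct2 \<Rightarrow> oct2" where
  "involution s n (x, x') =
    (if n = 1 then (x', x)
     else if n = 9 then (x, - x')
     else (- side_mult s (oct_basis (n - 1)) x', side_mult s (oct_basis (n - 1)) x))"

definition kahler_form :: "side \<Rightarrow> nat \<Rightarrow> nat \<Rightarrow> even_form" where
  "kahler_form s a b =
    (if a = b then 0
     else form_of 2 (\<lambda>X. inner (X ! 0) (involution s a (involution s b (X ! 1)))))"

text \<open>Matrix indices start at 0.\<close>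

definition kahler_matrix :: "side \<Rightarrow> even_form Matrix.mat" where
  "kahler_matrix s = Matrix.mat 9 9 (\<lambda>(a, b). kahler_form s (a + 1) (b + 1))"

definition tau :: "nat \<Rightarrow> even_form Matrix.mat \<Rightarrow> even_form" where
  "tau k A = coeff (char_poly A) (dim_row A - k)"

end

(*
Index the standard basis of R^16 by 0, ..., 15, i.e. by the vectors of F_2^4.  The product of two
basis octonions is, up to sign, the one whose index is the bitwise sum, so every involution of the
Spin(9)-structure is a signed translation of F_2^4.  Hence only those 8-subsets of F_2^4 whose
elements sum to zero (870 of them) can carry a nonzero coefficient of either form, and the theorem
is the coincidence of two integers for each of these octads.

For the Kaehler forms, the diagonal of psi vanishes, and so does the trace of psi^2; the Newton
identities therefore give 4 tau_4(psi) = - tr (psi^4), and the coefficients of the entries of psi^2 are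
small integers supported on 4-subsets.

For the integral, the coefficient of an octad is the integral over m in O of a minor of the multiplication
by m, against (1 + |m|^2)^(-12).  Mixing Gaussians reduces the integrals of monomials to Wick's formula;
the minors of size larger than 4 are traded for complementary ones by L L^T = |m|^2 and det L = |m|^8.
*)
theory Submission
  imports Defs "HOL-Library.Sublist" "HOL-Probability.Distributions"
begin

section \<open>Newton identities for the characteristic polynomial\<close>

text \<open>The two constants have one origin. On every octad the coefficients of tau_4 and of the
  integral are in the fixed ratio 11! : pi^4, and those of tau_4 are 360 times 0, +-1, +-2 or +-14.
  Dividing by 360 therefore leaves a primitive integral form, and 11! / 360 = 110880. The constancy
  of the ratio is not deduced from Spin(9)-invariance but checked octad by octad, for both sides of
  multiplication. The size of this check shapes the proof: each octad needs a determinant of order 8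
  and a fourfold product of forms, all evaluated by rewriting. Hence wedge coefficients are
  recursions along ascending lists instead of sums over sets of subsets, sums over involutions
  collapse because a translation determines the missing index, and octonions enter the evaluation
  only through a table of signs.\<close>

definition poly_deriv :: "'a::comm_ring_1 poly \<Rightarrow> 'a poly" where
  "poly_deriv p = (\<Sum>i\<le>degree p. monom (of_nat (Suc i) * coeff p (Suc i)) i)"

lemma coeff_poly_deriv: "coeff (poly_deriv p) n = of_nat (Suc n) * coeff p (Suc n)"
  by (simp add: poly_deriv_def coeff_sum sum.delta coeff_eq_0)

lemma fps_of_poly_deriv: "fps_of_poly (poly_deriv p) = fps_deriv (fps_of_poly p)"
  by (rule fps_ext) (simp add: coeff_poly_deriv)

text \<open>The Leibniz rule is inherited from formal power series, which allow coefficient rings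
  with zero divisors such as the even forms.\<close>

lemma poly_deriv_mult: "poly_deriv (p * q) = p * poly_deriv q + poly_deriv p * q"
  by (subst fps_of_poly_eq_iff[symmetric])
    (simp add: fps_of_poly_deriv fps_of_poly_mult fps_of_poly_add)

lemma poly_deriv_sum: "poly_deriv (sum f A) = (\<Sum>a\<in>A. poly_deriv (f a))"
  by (rule poly_eqI) (simp add: coeff_poly_deriv coeff_sum sum_distrib_left)

lemma poly_deriv_signof: "poly_deriv (signof p * q) = signof p * poly_deriv q"
  by (rule poly_eqI, cases p rule: sign_cases) (simp_all add: coeff_poly_deriv)

lemma poly_deriv_prod:
  "finite A \<Longrightarrow> poly_deriv (prod f A) = (\<Sum>a\<in>A. poly_deriv (f a) * prod f (A - {a}))"
proof (induction A rule: finite_induct)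
  case empty
  show ?case by (rule poly_eqI) (simp add: coeff_poly_deriv)
next
  case (insert x A)
  have "f x * (\<Sum>a\<in>A. poly_deriv (f a) * prod f (A - {a})) =
      (\<Sum>a\<in>A. poly_deriv (f a) * prod f (insert x A - {a}))"
    unfolding sum_distrib_left
  proof (rule sum.cong[OF refl])
    fix a assume "a \<in> A"
    then have "insert x A - {a} = insert x (A - {a})" using insert by auto
    then show "f x * (poly_deriv (f a) * prod f (A - {a})) = poly_deriv (f a) * prod f (insert x A - {a})"
      using insert by (simp add: ac_simps)
  qed
  then show ?case using insert by (simp add: poly_deriv_mult add.commute)
qed

text \<open>Jacobi's formula: the product rule differentiates one row at a time, and each resulting
  determinant is expanded along its differentiated row. For \<open>t - A\<close> it yields the trace
  of the adjugate.\<close>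

lemma poly_deriv_det:
  assumes A: "A \<in> carrier_mat n n"
  shows "poly_deriv (det A) = (\<Sum>i<n. \<Sum>j<n. poly_deriv (A $$ (i, j)) * cofactor A i j)"
proof -
  define B where "B i = Matrix.mat n n (\<lambda>(k, l). if k = i then poly_deriv (A $$ (k, l)) else A $$ (k, l))" for i
  have B: "B i \<in> carrier_mat n n" for i by (simp add: B_def)
  have "poly_deriv (det A) =
      (\<Sum>p | p permutes {0..<n}. \<Sum>i<n. signof p * (poly_deriv (A $$ (i, p i)) * (\<Prod>k\<in>{0..<n} - {i}. A $$ (k, p k))))"
    unfolding det_def'[OF A] poly_deriv_sum poly_deriv_signof
    by (simp add: poly_deriv_prod sum_distrib_left atLeast0LessThan)
  also have "\<dots> = (\<Sum>i<n. \<Sum>p | p permutes {0..<n}. signof p * (\<Prod>k=0..<n. B i $$ (k, p k)))"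
    unfolding sum.swap[of _ "{..<n}"]
  proof (intro sum.cong refl, goal_cases)
    case (1 i p)
    then have p: "k < n \<Longrightarrow> p k < n" for k using permutes_in_image[of p "{0..<n}" k] by auto
    have "(\<Prod>k=0..<n. B i $$ (k, p k)) = B i $$ (i, p i) * (\<Prod>k\<in>{0..<n} - {i}. B i $$ (k, p k))"
      using 1 by (subst prod.remove[of _ i]) auto
    also have "(\<Prod>k\<in>{0..<n} - {i}. B i $$ (k, p k)) = (\<Prod>k\<in>{0..<n} - {i}. A $$ (k, p k))"
      by (rule prod.cong) (auto simp: B_def p)
    finally show ?case using 1 p by (simp add: B_def)
  qed
  also have "\<dots> = (\<Sum>i<n. det (B i))"
    by (simp add: det_def'[OF B])
  also have "\<dots> = (\<Sum>i<n. \<Sum>j<n. poly_deriv (A $$ (i, j)) * cofactor A i j)"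
  proof (rule sum.cong[OF refl])
    fix i assume i: "i \<in> {..<n}"
    \<comment> \<open>Row \<open>i\<close> is the only place where \<open>B i\<close> and
      \<open>A\<close> differ, so the cofactors along it agree.\<close>
    have "mat_delete (B i) i j = mat_delete A i j" if "j < n" for j
      using i that A by (intro eq_matI) (auto simp: mat_delete_def B_def)
    then show "det (B i) = (\<Sum>j<n. poly_deriv (A $$ (i, j)) * cofactor A i j)"
      using i by (subst laplace_expansion_row[OF B, of i]) (auto simp: cofactor_def B_def intro!: sum.cong)
  qed
  finally show ?thesis .
qed

text \<open>
  Newton's identities, from comparing coefficients in \<open>adj (t - A) (t - A) = \<chi>(t)\<close> and
  \<open>tr (adj (t - A)) = \<chi>'(t)\<close> (Faddeev--LeVerrier).
\<close>

lemma coeff_char_poly_4: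
  fixes A :: "'a::comm_ring_1 mat"
  assumes A: "A \<in> carrier_mat n n" and n: "4 < n"
    and t1: "(\<Sum>i<n. A $$ (i, i)) = 0" and t2: "(\<Sum>i<n. (A * A) $$ (i, i)) = 0"
    and torsion_free: "\<And>x::'a. 2 * x = 0 \<Longrightarrow> x = 0"
  shows "4 * coeff (char_poly A) (n - 4) = - (\<Sum>i<n. (A * A * (A * A)) $$ (i, i))"
proof -
  define P where "P = char_poly_matrix A"
  define c where "c j = coeff (char_poly A) j" for j
  define N where "N j = Matrix.mat n n (\<lambda>(i, k). coeff (adj_mat P $$ (i, k)) j)" for j
  define tr where "tr M = (\<Sum>i<n. M $$ (i, i))" for M :: "'a mat"
  have P: "P \<in> carrier_mat n n" using A by (simp add: P_def)
  have adj: "adj_mat P \<in> carrier_mat n n" using adj_mat(1)[OF P] .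
  have N: "N j \<in> carrier_mat n n" for j by (simp add: N_def)
  have detP: "det P = char_poly A" by (simp add: P_def char_poly_def)
  have Pij: "P $$ (i, j) = (if i = j then [:0, 1:] else 0) - [:A $$ (i, j):]" if "i < n" "j < n" for i j
    using A that by (simp add: P_def char_poly_matrix_def)
  have tr_N: "tr (N j) = of_nat (Suc j) * c (Suc j)" for j
  proof -
    have "poly_deriv (P $$ (i, k)) = (if i = k then 1 else 0)" if "i < n" "k < n" for i k
      using that by (intro poly_eqI) (simp add: coeff_poly_deriv Pij coeff_pCons split: nat.split)
    then have "poly_deriv (det P) = (\<Sum>i<n. \<Sum>k<n. if i = k then cofactor P i k else 0)"
      unfolding poly_deriv_det[OF P] by (intro sum.cong refl) auto
    also have "\<dots> = (\<Sum>i<n. adj_mat P $$ (i, i))"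
      using P by (auto simp: adj_mat_def intro!: sum.cong)
    finally have "coeff (poly_deriv (det P)) j = tr (N j)"
      by (simp add: tr_def N_def coeff_sum)
    then show ?thesis by (simp add: coeff_poly_deriv detP c_def)
  qed
  have step: "N j = N (Suc j) * A + c (Suc j) \<cdot>\<^sub>m 1\<^sub>m n" for j
  proof (rule eq_matI)
    fix i k assume "i < dim_row (N (Suc j) * A + c (Suc j) \<cdot>\<^sub>m 1\<^sub>m n)"
      "k < dim_col (N (Suc j) * A + c (Suc j) \<cdot>\<^sub>m 1\<^sub>m n)"
    then have ik: "i < n" "k < n" using A N by auto
    have "(adj_mat P * P) $$ (i, k) = (\<Sum>l<n. adj_mat P $$ (i, l) * P $$ (l, k))"
      using adj P ik by (auto simp: scalar_prod_def atLeast0LessThan)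
    also have "\<dots> = (\<Sum>l<n. (if l = k then pCons 0 (adj_mat P $$ (i, l)) else 0) - Polynomial.smult (A $$ (l, k)) (adj_mat P $$ (i, l)))"
      using ik by (intro sum.cong) (auto simp: Pij algebra_simps)
    finally have "coeff ((adj_mat P * P) $$ (i, k)) (Suc j) =
        coeff (adj_mat P $$ (i, k)) j - (\<Sum>l<n. A $$ (l, k) * coeff (adj_mat P $$ (i, l)) (Suc j))"
      using ik by (simp add: coeff_sum sum_subtractf if_distrib[of "\<lambda>p. coeff p _"] cong: if_cong)
    moreover have "(adj_mat P * P) $$ (i, k) = (if i = k then char_poly A else 0)"
      using ik by (simp add: adj_mat(3)[OF P] detP)
    ultimately show "N j $$ (i, k) = (N (Suc j) * A + c (Suc j) \<cdot>\<^sub>m 1\<^sub>m n) $$ (i, k)"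
      using ik A N[of "Suc j"]
      by (auto simp: N_def c_def scalar_prod_def atLeast0LessThan mult.commute
          coeff_0 algebra_simps split: if_splits)
  qed (use A N[of "Suc j"] N[of j] in auto)
  have deg: "degree (char_poly A) = n" "c n = 1"
    using degree_monic_char_poly[OF A] by (auto simp: c_def)
  \<comment> \<open>Any bound on the degrees of the adjugate serves as a starting point: above n the
    coefficients of the characteristic polynomial vanish, so \<open>step\<close> carries the zero
    matrix down from there to \<open>N n\<close>.\<close>
  define D where "D = Max ((\<lambda>(i, k). degree (adj_mat P $$ (i, k))) ` ({..<n} \<times> {..<n}))"
  have N_large: "N j = 0\<^sub>m n n" if "D < j" for j
  proof (rule eq_matI)
    fix i k assume "i < dim_row (0\<^sub>m n n :: 'a mat)" "k < dim_col (0\<^sub>m n n :: 'a mat)"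
    then have ik: "i < n" "k < n" by auto
    then have "degree (adj_mat P $$ (i, k)) \<le> D"
      unfolding D_def by (intro Max_ge) auto
    then show "N j $$ (i, k) = 0\<^sub>m n n $$ (i, k)"
      using that ik by (simp add: N_def coeff_eq_0)
  qed (simp_all add: N_def)
  have N_n: "N n = 0\<^sub>m n n"
  proof -
    have "N (n + (Suc D - i)) = 0\<^sub>m n n" if "i \<le> Suc D" for i using that
    proof (induction i)
      case 0
      then show ?case by (intro N_large) simp
    next
      case (Suc i)
      have *: "n + (Suc D - i) = Suc (n + (Suc D - Suc i))" using Suc by simp
      have "N (n + (Suc D - Suc i)) = 0\<^sub>m n n * A + c (n + (Suc D - i)) \<cdot>\<^sub>m 1\<^sub>m n"
        using Suc unfolding * by (subst step) auto
      also have "c (n + (Suc D - i)) = 0" using Suc by (simp add: c_def deg(1) coeff_eq_0)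
      finally show ?case using A by (auto intro!: eq_matI)
    qed
    from this[of "Suc D"] show ?thesis by simp
  qed
  have tr_add: "tr (X + Y) = tr X + tr Y" if "X \<in> carrier_mat n n" "Y \<in> carrier_mat n n" for X Y
    using that by (simp add: tr_def sum.distrib)
  have tr_one: "tr (x \<cdot>\<^sub>m 1\<^sub>m n) = of_nat n * x" for x by (simp add: tr_def)
  have tr_smult: "tr (x \<cdot>\<^sub>m X) = x * tr X" if "X \<in> carrier_mat n n" for x X
    using that by (simp add: tr_def sum_distrib_left)
  \<comment> \<open>Moving the last term to the left gives Newton's identity: the coefficient of
    index n - k is multiplied by -k.\<close>
  have tr_step: "of_nat (Suc j) * c (Suc j) = tr (N (Suc j) * A) + of_nat n * c (Suc j)" for j
    using A N[of "Suc j"] by (subst tr_N[symmetric], subst step) (auto simp: tr_add tr_one)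
  define m where "m = n - 5"
  have m: "n = Suc (Suc (Suc (Suc (Suc m))))" using n by (simp add: m_def)
  have tr_A: "tr A = 0" "tr (A * A) = 0" using t1 t2 by (simp_all add: tr_def)
  have N1: "N (Suc (Suc (Suc (Suc m)))) = 1\<^sub>m n"
    unfolding step[of "Suc (Suc (Suc (Suc m)))"] m[symmetric] N_n deg(2) using A by (auto intro!: eq_matI)
  have "c (Suc (Suc (Suc (Suc m)))) = 0"
    using tr_step[of "Suc (Suc (Suc m))"] unfolding N1 left_mult_one_mat[OF A] tr_A
    by (simp add: m algebra_simps)
  then have N2: "N (Suc (Suc (Suc m))) = A"
    unfolding step[of "Suc (Suc (Suc m))"] N1 using A by (auto intro!: eq_matI)
  \<comment> \<open>The factor 2 cannot be cancelled in an arbitrary commutative ring; this is the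
    purpose of \<open>torsion_free\<close>.\<close>
  have "2 * c (Suc (Suc (Suc m))) = 0"
    using tr_step[of "Suc (Suc m)"] unfolding N2 tr_A by (simp add: m algebra_simps)
  then have "c (Suc (Suc (Suc m))) = 0" using torsion_free by blast
  then have N3: "N (Suc (Suc m)) = A * A"
    unfolding step[of "Suc (Suc m)"] N2 using A by (auto intro!: eq_matI)
  have N4: "N (Suc m) = A * A * A + c (Suc (Suc m)) \<cdot>\<^sub>m 1\<^sub>m n"
    unfolding step[of "Suc m"] N3 ..
  have AAA: "A * A * A \<in> carrier_mat n n" "A * A \<in> carrier_mat n n" using A by auto
  \<comment> \<open>The coefficient of index n - 3 need not vanish here, but it enters the next
    trace only as a multiple of tr A = 0.\<close>
  have "(c (Suc (Suc m)) \<cdot>\<^sub>m 1\<^sub>m n) * A = c (Suc (Suc m)) \<cdot>\<^sub>m A"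
    using A by (subst mult_smult_assoc_mat[of _ n n]) auto
  then have "N (Suc m) * A = A * A * A * A + c (Suc (Suc m)) \<cdot>\<^sub>m A"
    unfolding N4 using A AAA(1) by (subst add_mult_distrib_mat[of _ n n]) auto
  also have "A * A * A * A = A * A * (A * A)"
    using A AAA by (intro assoc_mult_mat) auto
  finally have "tr (N (Suc m) * A) = tr (A * A * (A * A) + c (Suc (Suc m)) \<cdot>\<^sub>m A)" by simp
  also have "\<dots> = tr (A * A * (A * A))"
    using A AAA by (subst tr_add) (auto simp: tr_smult tr_A)
  finally have "tr (N (Suc m) * A) = tr (A * A * (A * A))" .
  then have "of_nat (Suc m) * c (Suc m) = tr (A * A * (A * A)) + of_nat n * c (Suc m)"
    using tr_step[of m] by simp
  moreover have "(of_nat n :: 'a) = of_nat (Suc m) + 4" by (simp add: m)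
  ultimately have "4 * c (Suc m) = - tr (A * A * (A * A))"
    by (simp add: algebra_simps eq_neg_iff_add_eq_0 del: of_nat_Suc)
  moreover have "n - 4 = Suc m" using m by simp
  ultimately show ?thesis by (simp only: tr_def c_def)
qed

section \<open>Signs and translations\<close>

abbreviation xr :: "nat \<Rightarrow> nat \<Rightarrow> nat" where "xr \<equiv> Bit_Operations.xor"

primrec xor_list :: "nat list \<Rightarrow> nat" where
  "xor_list [] = 0"
| "xor_list (x # xs) = xr x (xor_list xs)"

text \<open>Rows belong to the left factor and columns to the right one;
  \<open>side_mult_basis\<close> verifies all 64 signs against \<open>oct_mult\<close>.\<close>

definition oct_sign_table :: "int list list" where "oct_sign_table =
   [[1, 1, 1, 1, 1, 1, 1, 1],
    [1, -1, 1, -1, 1, -1, -1, 1],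
    [1, -1, -1, 1, 1, 1, -1, -1],
    [1, 1, -1, -1, 1, -1, 1, -1],
    [1, -1, -1, -1, -1, 1, 1, 1],
    [1, 1, -1, 1, -1, -1, -1, 1],
    [1, 1, 1, -1, -1, 1, -1, -1],
    [1, -1, 1, 1, -1, -1, 1, -1]]"

text \<open>The sign in \<open>e\<^sub>i e\<^sub>j = \<plusminus> e\<^sub>k\<close>, where \<open>k\<close> is the bitwise sum of \<open>i\<close> and \<open>j\<close>.\<close>

fun oct_sign :: "side \<Rightarrow> nat \<Rightarrow> nat \<Rightarrow> int" where
  "oct_sign Left_mult i j = oct_sign_table ! i ! j"
| "oct_sign Right_mult i j = oct_sign_table ! j ! i"

text \<open>
  Every involution of the \<open>Spin(9)\<close>-structure maps the basis vector \<open>e\<^sub>p\<close> to \<open>\<plusminus> e\<^sub>q\<close>, where \<open>q\<close> is the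
  bitwise sum of \<open>p\<close> with a number \<open>a \<in> {0, 8, \<dots>, 15}\<close> that depends only on the involution.  From
  now on the involutions are indexed by \<open>a\<close>, and the value 0 for \<open>a \<in> {1, \<dots>, 7}\<close> allows sums over
  all \<open>a < 16\<close>.
\<close>

definition inv_sign :: "side \<Rightarrow> nat \<Rightarrow> nat \<Rightarrow> int" where
  "inv_sign s a p =
    (if a = 0 then (if p < 8 then 1 else -1)
     else if a = 8 then 1
     else if a < 8 then 0
     else if p < 8 then oct_sign s (a - 8) p
     else - oct_sign s (a - 8) (p - 8))"

text \<open>The wedge product of coefficients on an ascending list, dealt out into two sublists of
  which the first has length k. A head dealt to the second sublist is smaller than all the
  \<open>Suc k\<close> entries still due to the first, hence the sign. The function argument acts as
  a continuation that collects both sublists.\<close>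

fun shuffle_sum :: "nat \<Rightarrow> nat list \<Rightarrow> (nat list \<Rightarrow> nat list \<Rightarrow> 'a::comm_ring_1) \<Rightarrow> 'a" where
  "shuffle_sum 0 xs F = F [] xs"
| "shuffle_sum (Suc k) [] F = 0"
| "shuffle_sum (Suc k) (x # xs) F =
    shuffle_sum k xs (\<lambda>a. F (x # a)) + (-1) ^ Suc k * shuffle_sum (Suc k) xs (\<lambda>a b. F a (x # b))"

text \<open>
  The coefficients of the Kaehler forms, of the entries of the square of their matrix, and of the
  trace of its fourth power.
\<close>

definition psi_coeff :: "side \<Rightarrow> nat \<Rightarrow> nat \<Rightarrow> nat list \<Rightarrow> int" where
  "psi_coeff s a b xs = (if xs ! 0 = xr (xs ! 1) (xr a b)
     then inv_sign s b (xs ! 1) * inv_sign s a (xr (xs ! 1) b) else 0)"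

definition psi2_coeff :: "side \<Rightarrow> nat \<Rightarrow> nat \<Rightarrow> nat list \<Rightarrow> int" where
  "psi2_coeff s a c xs = shuffle_sum 2 xs (\<lambda>ys zs. \<Sum>b<16. psi_coeff s a b ys * psi_coeff s b c zs)"

definition psi4_coeff :: "side \<Rightarrow> nat list \<Rightarrow> int" where
  "psi4_coeff s xs = shuffle_sum 4 xs (\<lambda>ys zs. \<Sum>a<16. \<Sum>c<16. psi2_coeff s a c ys * psi2_coeff s c a zs)"

section \<open>Bitwise sums and the supports of the coefficients\<close>

lemma xor_less_16: "x < 16 \<Longrightarrow> y < 16 \<Longrightarrow> xr x y < (16::nat)"
proof -
  assume "x < 16" "y < 16"
  then have "take_bit 4 x = x" "take_bit 4 y = y" by (simp_all add: take_bit_nat_eq_self_iff)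
  then have "take_bit 4 (xr x y) = xr x y" by simp
  then show ?thesis by (simp only: take_bit_nat_eq_self_iff) simp
qed

lemma xor_list_less_16: "set xs \<subseteq> {..<16} \<Longrightarrow> xor_list xs < 16"
  by (induction xs) (auto simp: xor_less_16)

lemma xor_eq_iff: "xr x y = z \<longleftrightarrow> y = xr x (z::nat)"
  by (metis xor.assoc xor.left_neutral xor_self_eq)

lemma xor_list_shuffles: "xs \<in> shuffles ys zs \<Longrightarrow> xor_list xs = xr (xor_list ys) (xor_list zs)"
  by (induction ys zs arbitrary: xs rule: shuffles.induct) (auto simp: ac_simps)

lemma shuffle_sum_cong:
  assumes "\<And>ys zs. xs \<in> shuffles ys zs \<Longrightarrow> length ys = k \<Longrightarrow> F ys zs = G ys zs"
  shows "shuffle_sum k xs F = shuffle_sum k xs G"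
  using assms
proof (induction k xs F arbitrary: G rule: shuffle_sum.induct)
  case (3 k x xs F)
  have "shuffle_sum k xs (\<lambda>a. F (x # a)) = shuffle_sum k xs (\<lambda>a. G (x # a))"
    by (rule 3(1)) (auto intro!: 3(3) Cons_in_shuffles_leftI)
  moreover have "shuffle_sum (Suc k) xs (\<lambda>a b. F a (x # b)) = shuffle_sum (Suc k) xs (\<lambda>a b. G a (x # b))"
    by (rule 3(2)) (auto intro!: 3(3) Cons_in_shuffles_rightI)
  ultimately show ?case by simp
qed auto

lemma shuffle_sum_zero: "shuffle_sum k xs (\<lambda>_ _. 0) = 0"
proof -
  have "F = (\<lambda>_ _. 0) \<Longrightarrow> shuffle_sum k xs F = 0" for F :: "nat list \<Rightarrow> nat list \<Rightarrow> 'a"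
    by (induction k xs F rule: shuffle_sum.induct) auto
  then show ?thesis by simp
qed

lemma shuffle_sum_2: "shuffle_sum 2 [x, y, z, w] F =
    F [x, y] [z, w] - F [x, z] [y, w] + F [x, w] [y, z] + F [y, z] [x, w] - F [y, w] [x, z] + F [z, w] [x, y]"
  by (simp add: numeral_2_eq_2)

lemma psi_coeff_eq_0: "xr x y \<noteq> xr a b \<Longrightarrow> psi_coeff s a b [x, y] = 0"
  unfolding psi_coeff_def by (metis xor_eq_iff xor.commute nth_Cons_0 nth_Cons_Suc One_nat_def)

text \<open>The first Kaehler form is nonzero only if its translation carries \<open>y\<close> to
  \<open>x\<close>, which determines the middle index \<open>b\<close>.\<close>

lemma psi_psi_coeff:
  assumes "a < 16" "x < 16" "y < 16"
  shows "(\<Sum>b<16. psi_coeff s a b [x, y] * psi_coeff s b c [z, w]) =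
    psi_coeff s a (xr a (xr x y)) [x, y] * psi_coeff s (xr a (xr x y)) c [z, w]"
proof -
  have "psi_coeff s a b [x, y] * psi_coeff s b c [z, w] = 0" if "b \<noteq> xr a (xr x y)" for b
    using psi_coeff_eq_0[of x y a b s] that xor_eq_iff[of a b "xr x y"] by auto
  then have "(\<Sum>b<16. psi_coeff s a b [x, y] * psi_coeff s b c [z, w]) =
      (\<Sum>b<16. if b = xr a (xr x y) then psi_coeff s a b [x, y] * psi_coeff s b c [z, w] else 0)"
    by (intro sum.cong) auto
  then show ?thesis using assms by (simp add: xor_less_16)
qed

text \<open>The translations telescope: the two pairs of indices sum to a + b and b + c, so all four
  sum to a + c.\<close>

lemma psi2_coeff_eq_0:
  assumes "length xs = 4" "xor_list xs \<noteq> xr a c"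
  shows "psi2_coeff s a c xs = 0"
proof -
  have "psi_coeff s a b ys * psi_coeff s b c zs = 0"
    if sh: "xs \<in> shuffles ys zs" and len: "length ys = 2" for b ys zs
  proof (rule ccontr)
    assume *: "\<not> ?thesis"
    have "length zs = 2" using length_shuffles[OF sh] assms len by simp
    then obtain x y z w where yz: "ys = [x, y]" "zs = [z, w]"
      using len by (auto simp: numeral_2_eq_2 length_Suc_conv)
    have "xr x y = xr a b" "xr z w = xr b c"
      using * psi_coeff_eq_0 unfolding yz by fastforce+
    then have "xor_list xs = xr (xr a b) (xr b c)"
      using xor_list_shuffles[OF sh] by (simp add: yz)
    also have "\<dots> = xr a c" by (metis xor.assoc xor.left_neutral xor_self_eq)
    finally show False using assms by simp
  qed
  then have "psi2_coeff s a c xs = shuffle_sum 2 xs (\<lambda>_ _. 0)"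
    unfolding psi2_coeff_def by (intro shuffle_sum_cong sum.neutral ballI) blast
  then show ?thesis by (simp add: shuffle_sum_zero)
qed

text \<open>In a trace the translations a + c and c + a cancel; this is the octad condition for the
  Kaehler forms.\<close>

lemma psi4_coeff_eq_0:
  assumes "length xs = 8" "xor_list xs \<noteq> 0"
  shows "psi4_coeff s xs = 0"
proof -
  have "psi2_coeff s a c ys * psi2_coeff s c a zs = 0"
    if sh: "xs \<in> shuffles ys zs" and len: "length ys = 4" for a c ys zs
  proof (rule ccontr)
    assume *: "\<not> ?thesis"
    have "length zs = 4" using length_shuffles[OF sh] assms len by simp
    then have "xor_list ys = xr a c" "xor_list zs = xr c a"
      using * len psi2_coeff_eq_0 by fastforce+
    then show False using xor_list_shuffles[OF sh] assms(2) by (simp add: xor.commute)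
  qed
  then have "psi4_coeff s xs = shuffle_sum 4 xs (\<lambda>_ _. 0)"
    unfolding psi4_coeff_def by (intro shuffle_sum_cong sum.neutral ballI) blast
  then show ?thesis by (simp add: shuffle_sum_zero)
qed

section \<open>Lists of subsets\<close>

fun sublists_xor :: "nat \<Rightarrow> nat \<Rightarrow> nat list \<Rightarrow> nat list list" where
  "sublists_xor 0 t xs = (if t = 0 then [[]] else [])"
| "sublists_xor (Suc k) t [] = []"
| "sublists_xor (Suc k) t (x # xs) = map ((#) x) (sublists_xor k (xr x t) xs) @ sublists_xor (Suc k) t xs"

lemma subseq_imp_subset: "subseq ys xs \<Longrightarrow> set ys \<subseteq> set xs"
  by (auto elim: list_emb_set)

lemma set_sublists_xor: "set (sublists_xor k t xs) = {ys. subseq ys xs \<and> length ys = k \<and> xor_list ys = t}"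
proof (induction k t xs rule: sublists_xor.induct)
  case (3 k t x xs)
  have "ys \<in> set (sublists_xor (Suc k) t (x # xs)) \<longleftrightarrow> subseq ys (x # xs) \<and> length ys = Suc k \<and> xor_list ys = t" for ys
  proof (cases ys)
    case (Cons y zs)
    have "xr x (xor_list zs) = t \<longleftrightarrow> xor_list zs = xr x t" by (rule xor_eq_iff)
    then show ?thesis using 3 Cons by (auto simp: image_iff dest: subseq_Cons')
  qed (use 3 in auto)
  then show ?case by blast
qed auto

lemma distinct_sublists_xor: "distinct xs \<Longrightarrow> distinct (sublists_xor k t xs)"
proof (induction k t xs rule: sublists_xor.induct)
  case (3 k t x xs)
  have "x # ys \<notin> set (sublists_xor (Suc k) t xs)" for ys
    using 3(3) by (auto simp: set_sublists_xor dest: subseq_imp_subset)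
  then show ?case using 3 by (auto simp: distinct_map)
qed auto

definition idx :: "nat list" where "idx = [0,1,2,3,4,5,6,7,8,9,10,11,12,13,14,15]"

lemma idx_upt: "idx = [0..<16]" by (simp add: idx_def upt_rec)

text \<open>Four distinct vectors of F_2^4 sum to zero exactly when they form an affine plane, so
  \<open>planes 0\<close> lists the affine planes. The other \<open>t\<close> give the possible
  supports of the entries of psi^2 whose indices have bitwise sum \<open>t\<close>.\<close>

definition planes :: "nat \<Rightarrow> nat list list" where "planes t = sublists_xor 4 t idx"
definition octads :: "nat list list" where "octads = sublists_xor 8 0 idx"

section \<open>Expansion of minors\<close>

text \<open>The integer is the alternating sign of a Laplace expansion, the lists are the rows that
  remain.\<close>

primrec picks :: "'a list \<Rightarrow> (int \<times> 'a \<times> 'a list) list" where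
  "picks [] = []"
| "picks (y # ys) = (1, y, ys) # map (\<lambda>(e, z, zs). (- e, z, y # zs)) (picks ys)"

text \<open>The expectation of a monomial in independent standard normal variables.\<close>

function wick :: "nat list \<Rightarrow> int" where
  "wick [] = 1"
| "wick (x # xs) = int (count_list xs x) * wick (remove1 x xs)"
  by pat_completeness auto
termination by (relation "Wellfounded.measure length") (auto simp: length_remove1)

text \<open>
  Laplace expansion along the first column of a determinant whose columns and rows are indexed by two lists
  and whose entries are signed monomials; the last argument accumulates the product of the
  entries that have been chosen.
\<close>

primrec minor_moment ::
    "(nat \<Rightarrow> nat \<Rightarrow> int \<times> nat list) \<Rightarrow> nat list \<Rightarrow> nat list \<Rightarrow> nat list \<Rightarrow> int" where
  "minor_moment entry [] ys ms = wick ms"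
| "minor_moment entry (x # xs) ys ms = sum_list (map (\<lambda>(e, y, zs).
     case entry x y of (c, vs) \<Rightarrow> if c = 0 then 0 else e * c * minor_moment entry xs zs (vs @ ms)) (picks ys))"

text \<open>A pair \<open>(c, vs)\<close> encodes c times the product of the coordinates of m listed
  in \<open>vs\<close>. The entry is the component along basis vector \<open>x\<close> of the frame
  vector with index \<open>y\<close>, without its factor 1 / sqrt (1 + |m|^2), which is moved into
  the weight.\<close>

definition frame_entry :: "side \<Rightarrow> nat \<Rightarrow> nat \<Rightarrow> int \<times> nat list" where
  "frame_entry s x y =
    (if x < 8 then (of_bool (x = y), []) else (oct_sign s (xr (x - 8) y) y, [xr (x - 8) y]))"

text \<open>The entries after multiplication from the left by the matrix of m: the unprimed columns
  become columns of that matrix, the primed ones multiples of unit vectors from which |m|^2 has been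
  divided out.\<close>

definition dual_entry :: "side \<Rightarrow> nat \<Rightarrow> nat \<Rightarrow> int \<times> nat list" where
  "dual_entry s x y =
    (if x < 8 then (oct_sign s (xr x y) x, [xr x y]) else (of_bool (x - 8 = y), []))"

text \<open>The number of primed coordinates, which is the degree in m of the corresponding minor of
  the frame.\<close>

primrec primed :: "nat list \<Rightarrow> nat" where
  "primed [] = 0"
| "primed (x # xs) = (if 8 \<le> x then Suc (primed xs) else primed xs)"

definition coord_moment :: "side \<Rightarrow> nat list \<Rightarrow> nat \<Rightarrow> int" where
  "coord_moment s xs k =
    minor_moment (if k < 5 then frame_entry s else dual_entry s) xs [0,1,2,3,4,5,6,7] []"

text \<open>
  The integral of a monomial of degree \<open>2 j\<close> against \<open>(1 + |m|\<^sup>2)\<^sup>-\<^sup>1\<^sup>2\<close> is \<open>\<pi>\<^sup>4 (7 - j)! / (11! 2\<^sup>j)\<close> times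
  its Wick number, and the dual expansion of the minors of size \<open>k > 4\<close> leads to the same constants
  with \<open>8 - k\<close> in place of \<open>k\<close>.
\<close>

definition moment_factor :: "side \<Rightarrow> nat \<Rightarrow> int" where
  "moment_factor s k =
    (let j = (if k < 5 then k else 8 - k) div 2 in
     (case s of Left_mult \<Rightarrow> 1 | Right_mult \<Rightarrow> -1) * 2 ^ (4 - j) * fact (7 - j))"

section \<open>Moments of a rational weight\<close>

text \<open>The n-th moment of a standard normal variable: the double factorial (n - 1)!! for even
  n, and 0 for odd n.\<close>

fun normal_moment :: "nat \<Rightarrow> nat" where
  "normal_moment 0 = 1"
| "normal_moment (Suc 0) = 0"
| "normal_moment (Suc (Suc n)) = Suc n * normal_moment n"

lemma normal_moment_odd: "odd n \<Longrightarrow> normal_moment n = 0"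
  by (induction n rule: normal_moment.induct) auto

lemma normal_moment_even_fact: "2 ^ a * fact a * normal_moment (2 * a) = fact (2 * a)"
proof (induction a)
  case (Suc a)
  have "2 ^ Suc a * fact (Suc a) * normal_moment (2 * Suc a) =
      2 * Suc a * Suc (2 * a) * (2 ^ a * fact a * normal_moment (2 * a))"
    by (simp add: algebra_simps)
  then show ?case unfolding Suc by (simp add: algebra_simps)
qed simp

lemma nn_integral_power_gaussian:
  assumes t: "0 < t"
  shows "(\<integral>\<^sup>+y. ennreal (y ^ (2 * a) * exp (- (t * y\<^sup>2))) \<partial>lborel) =
    ennreal (sqrt (pi / t) * real (normal_moment (2 * a)) / (2 * t) ^ a)"
proof -
  define c where "c = sqrt (pi / t)"
  have c: "0 < c" using t by (simp add: c_def)
  \<comment> \<open>Up to the factor \<open>c\<close>, exp (- t y^2) is the normal density of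
    variance 1 / (2 t).\<close>
  have dens: "y ^ (2 * a) * exp (- (t * y\<^sup>2)) = c * (normal_density 0 (sqrt (1 / (2 * t))) y * (y - 0) ^ (2 * a))" for y
    using t c by (simp add: normal_density_def c_def real_sqrt_divide field_simps)
  have "has_bochner_integral lborel (\<lambda>y. c * (normal_density 0 (sqrt (1 / (2 * t))) y * (y - 0) ^ (2 * a)))
      (c * (fact (2 * a) / ((2 / (sqrt (1 / (2 * t)))\<^sup>2) ^ a * fact a)))"
    by (intro has_bochner_integral_mult_right normal_moment_even) (use t in simp)
  also have "fact (2 * a) / ((2 / (sqrt (1 / (2 * t)))\<^sup>2) ^ a * fact a) = real (normal_moment (2 * a)) / (2 * t) ^ a"
  proof -
    have "(fact (2 * a) :: real) = 2 ^ a * fact a * real (normal_moment (2 * a))"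
      using arg_cong[OF normal_moment_even_fact[of a], of real] by simp
    moreover have "(4 * t) ^ a = 2 ^ a * (2 * t) ^ a" using power_mult_distrib[of 2 "2 * t" a] by simp
    ultimately show ?thesis using t by (simp add: field_simps)
  qed
  finally have *: "has_bochner_integral lborel (\<lambda>y. y ^ (2 * a) * exp (- (t * y\<^sup>2))) (c * (real (normal_moment (2 * a)) / (2 * t) ^ a))"
    unfolding dens .
  then show ?thesis
    by (subst nn_integral_eq_integral) (auto simp: has_bochner_integral_iff c_def)
qed

lemma norm_sq_euclidean: "(norm x)\<^sup>2 = (\<Sum>b\<in>Basis. (x \<bullet> b)\<^sup>2)" for x :: "'a::euclidean_space"
  by (simp add: norm_eq_sqrt_inner euclidean_inner[of x x] power2_eq_square sum_nonneg)

text \<open>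
  The rational weight is a mixture of Gaussians, by
  \<open>n! / (1 + r\<^sup>2)\<^sup>n\<^sup>+\<^sup>1 = \<integral> t\<^sup>n exp (- (1 + r\<^sup>2) t) dt\<close>, for each of which the integral factorises.
\<close>

lemma nn_integral_even_moment_rational_weight:
  fixes \<alpha> :: "'a::euclidean_space \<Rightarrow> nat"
  assumes dim: "DIM('a) = 2 * h" and n: "h + (\<Sum>b\<in>Basis. \<alpha> b) \<le> n"
  shows "(\<integral>\<^sup>+x. ennreal ((\<Prod>b\<in>Basis. (x \<bullet> b) ^ (2 * \<alpha> b)) / (1 + (norm x)\<^sup>2) ^ Suc n) \<partial>(lborel :: 'a measure)) =
    ennreal (pi ^ h * fact (n - h - (\<Sum>b\<in>Basis. \<alpha> b)) / (fact n * 2 ^ (\<Sum>b\<in>Basis. \<alpha> b)) * (\<Prod>b\<in>Basis. real (normal_moment (2 * \<alpha> b))))"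
proof -
  define j where "j = (\<Sum>b\<in>Basis. \<alpha> b)"
  define p where "p x = (\<Prod>b\<in>Basis. (x \<bullet> b) ^ (2 * \<alpha> b))" for x :: 'a
  define C where "C = (\<Prod>b\<in>(Basis :: 'a set). real (normal_moment (2 * \<alpha> b)))"
  define K where "K x t = (if t < 0 then 0 else p x * (t ^ n * exp (- (1 + (norm x)\<^sup>2) * t) / fact n))" for x t
  have p: "0 \<le> p x" for x unfolding p_def by (intro prod_nonneg) (simp add: zero_le_even_power)
  have C: "0 \<le> C" unfolding C_def by (intro prod_nonneg) simp
  have meas_p[measurable]: "p \<in> borel_measurable borel" unfolding p_def by measurable
  have 1: "(\<integral>\<^sup>+t. ennreal (K x t) \<partial>lborel) = ennreal (p x / (1 + (norm x)\<^sup>2) ^ Suc n)" for x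
  proof -
    define l where "l = 1 + (norm x)\<^sup>2"
    have l: "0 < l" unfolding l_def by (simp add: add_pos_nonneg)
    have "K x t = p x / l ^ Suc n * (erlang_density n l t * t ^ 0)" for t
      using l by (auto simp: K_def erlang_density_def l_def[symmetric] field_simps)
    then have "(\<integral>\<^sup>+t. ennreal (K x t) \<partial>lborel) =
        (\<integral>\<^sup>+t. ennreal (p x / l ^ Suc n) * ennreal (erlang_density n l t * t ^ 0) \<partial>lborel)"
      using p[of x] l by (intro nn_integral_cong) (simp only: ennreal_mult'[symmetric] divide_nonneg_pos zero_less_power)
    also have "\<dots> = ennreal (p x / l ^ Suc n)"
      using nn_integral_erlang_ith_moment[OF l, of n 0] by (subst nn_integral_cmult) auto
    finally show ?thesis unfolding l_def .
  qed
  have 2: "(\<integral>\<^sup>+x. ennreal (K x t) \<partial>lborel) =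
      ennreal (pi ^ h * C / (2 ^ j * fact n)) * (ennreal (t ^ (n - h - j) * exp (- t)) * indicator {0..} t)"
    if "t \<noteq> 0" for t
  proof (cases "t < 0")
    case True
    then show ?thesis by (simp add: K_def)
  next
    case False
    then have t: "0 < t" using that by simp
    have K: "K x t = t ^ n * exp (- t) / fact n * (\<Prod>b\<in>Basis. (x \<bullet> b) ^ (2 * \<alpha> b) * exp (- (t * (x \<bullet> b)\<^sup>2)))" for x
    proof -
      have "exp (- (1 + (norm x)\<^sup>2) * t) = exp (- t) * (\<Prod>b\<in>Basis. exp (- (t * (x \<bullet> b)\<^sup>2)))"
        unfolding norm_sq_euclidean exp_sum[OF finite_Basis, symmetric] exp_add[symmetric]
        by (simp add: sum_negf sum_distrib_left algebra_simps)
      then show ?thesis using t by (simp add: K_def p_def prod.distrib)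
    qed
    have "(\<integral>\<^sup>+x. ennreal (K x t) \<partial>lborel) = ennreal (t ^ n * exp (- t) / fact n) *
        (\<integral>\<^sup>+x. ennreal (\<Prod>b\<in>(Basis :: 'a set). (x \<bullet> b) ^ (2 * \<alpha> b) * exp (- (t * (x \<bullet> b)\<^sup>2))) \<partial>lborel)"
      unfolding K using t by (subst nn_integral_cmult[symmetric])
        (auto intro!: nn_integral_cong simp: ennreal_mult'[symmetric] simp del: times_divide_eq_left)
    also have "(\<integral>\<^sup>+x. ennreal (\<Prod>b\<in>(Basis :: 'a set). (x \<bullet> b) ^ (2 * \<alpha> b) * exp (- (t * (x \<bullet> b)\<^sup>2))) \<partial>lborel) =
        (\<integral>\<^sup>+x. (\<Prod>b\<in>(Basis :: 'a set). ennreal ((x \<bullet> b) ^ (2 * \<alpha> b) * exp (- (t * (x \<bullet> b)\<^sup>2)))) \<partial>lborel)"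
      by (intro nn_integral_cong, subst prod_ennreal) (auto simp: zero_le_even_power)
    also have "\<dots> = (\<Prod>b\<in>(Basis :: 'a set). \<integral>\<^sup>+y. ennreal (y ^ (2 * \<alpha> b) * exp (- (t * y\<^sup>2))) \<partial>lborel)"
      by (subst nn_integral_lborel_prod) auto
    also have "\<dots> = ennreal (\<Prod>b\<in>(Basis :: 'a set). sqrt (pi / t) * real (normal_moment (2 * \<alpha> b)) / (2 * t) ^ \<alpha> b)"
      using t by (subst prod_ennreal[symmetric]) (auto simp: nn_integral_power_gaussian)
    also have "(\<Prod>b\<in>(Basis :: 'a set). sqrt (pi / t) * real (normal_moment (2 * \<alpha> b)) / (2 * t) ^ \<alpha> b) =
        (pi / t) ^ h * C / (2 * t) ^ j"
      using t by (simp add: prod.distrib prod_dividef C_def dim power_mult j_def power_sum)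
    finally have "(\<integral>\<^sup>+x. ennreal (K x t) \<partial>lborel) =
        ennreal (t ^ n * exp (- t) / fact n * ((pi / t) ^ h * C / (2 * t) ^ j))"
      using t by (subst ennreal_mult') simp_all
    \<comment> \<open>The 2h Gaussian factors use up t^h and the moments t^j; the hypothesis on n
      keeps the remaining exponent nonnegative, and its Gamma integral is the factorial of n - h -
      j.\<close>
    also have "t ^ n = t ^ (n - h - j) * t ^ h * t ^ j"
      using n by (simp add: j_def power_add[symmetric])
    also have "t ^ (n - h - j) * t ^ h * t ^ j * exp (- t) / fact n * ((pi / t) ^ h * C / (2 * t) ^ j) =
        pi ^ h * C / (2 ^ j * fact n) * (t ^ (n - h - j) * exp (- t))"
      using t by (simp add: power_divide power_mult_distrib mult.commute mult.left_commute)
    finally show ?thesis using t C by (simp flip: ennreal_mult')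
  qed
  have "(\<integral>\<^sup>+x. ennreal (p x / (1 + (norm x)\<^sup>2) ^ Suc n) \<partial>lborel) = (\<integral>\<^sup>+x. \<integral>\<^sup>+t. ennreal (K x t) \<partial>lborel \<partial>lborel)"
    by (simp add: 1)
  also have "\<dots> = (\<integral>\<^sup>+t. \<integral>\<^sup>+x. ennreal (K x t) \<partial>lborel \<partial>lborel)"
    by (rule lborel_pair.Fubini'[symmetric]) (simp add: K_def)
  also have "\<dots> = (\<integral>\<^sup>+t. ennreal (pi ^ h * C / (2 ^ j * fact n)) * (ennreal (t ^ (n - h - j) * exp (- t)) * indicator {0..} t) \<partial>lborel)"
    \<comment> \<open>The Gaussian degenerates at t = 0, which is a null set.\<close>
    using AE_lborel_singleton[of 0] by (intro nn_integral_cong_AE) (auto simp: 2)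
  also have "\<dots> = ennreal (pi ^ h * C / (2 ^ j * fact n)) * ennreal (fact (n - h - j))"
    by (subst nn_integral_cmult) (simp_all add: nn_intergal_power_times_exp_Ici)
  also have "\<dots> = ennreal (pi ^ h * C / (2 ^ j * fact n) * fact (n - h - j))"
    using C by (subst ennreal_mult') simp_all
  finally show ?thesis by (simp add: p_def j_def C_def algebra_simps)
qed

text \<open>With even exponents the integrand is nonnegative and the previous lemma applies. An odd
  exponent makes the integrand change sign under the reflection of that coordinate, so the integral
  is 0 once integrability is known, in agreement with the odd normal moment.\<close>

lemma has_bochner_integral_moment_rational_weight:
  fixes \<alpha> :: "'a::euclidean_space \<Rightarrow> nat"
  assumes dim: "DIM('a) = 2 * h" and n: "2 * h + (\<Sum>b\<in>Basis. \<alpha> b) < 2 * n"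
  shows "has_bochner_integral (lborel :: 'a measure)
    (\<lambda>x. (\<Prod>b\<in>Basis. (x \<bullet> b) ^ \<alpha> b) / (1 + (norm x)\<^sup>2) ^ Suc n)
    (pi ^ h * fact (n - h - (\<Sum>b\<in>Basis. \<alpha> b) div 2) / (fact n * 2 ^ ((\<Sum>b\<in>Basis. \<alpha> b) div 2)) *
      (\<Prod>b\<in>Basis. real (normal_moment (\<alpha> b))))"
proof (cases "\<forall>b\<in>(Basis :: 'a set). even (\<alpha> b)")
  case True
  define \<beta> where "\<beta> b = \<alpha> b div 2" for b
  have \<beta>: "b \<in> Basis \<Longrightarrow> \<alpha> b = 2 * \<beta> b" for b using True by (auto simp: \<beta>_def)
  have sum: "(\<Sum>b\<in>(Basis :: 'a set). \<alpha> b) = 2 * (\<Sum>b\<in>(Basis :: 'a set). \<beta> b)"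
    by (simp add: \<beta> sum_distrib_left)
  have prods: "(\<Prod>b\<in>Basis. (x \<bullet> b) ^ \<alpha> b) = (\<Prod>b\<in>Basis. (x \<bullet> b) ^ (2 * \<beta> b))"
    "(\<Prod>b\<in>(Basis :: 'a set). real (normal_moment (\<alpha> b))) = (\<Prod>b\<in>Basis. real (normal_moment (2 * \<beta> b)))" for x :: 'a
    by (intro prod.cong; simp add: \<beta>)+
  show ?thesis
  proof (rule has_bochner_integral_nn_integral)
    show "AE x in lborel. 0 \<le> (\<Prod>b\<in>Basis. (x \<bullet> b) ^ \<alpha> b) / (1 + (norm x)\<^sup>2) ^ Suc n"
      by (intro AE_I2 divide_nonneg_nonneg prod_nonneg) (auto simp: \<beta> zero_le_even_power)
    show "0 \<le> pi ^ h * fact (n - h - (\<Sum>b\<in>Basis. \<alpha> b) div 2) / (fact n * 2 ^ ((\<Sum>b\<in>Basis. \<alpha> b) div 2)) *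
      (\<Prod>b\<in>(Basis :: 'a set). real (normal_moment (\<alpha> b)))"
      by (intro mult_nonneg_nonneg divide_nonneg_nonneg prod_nonneg) auto
    show "(\<integral>\<^sup>+x. ennreal ((\<Prod>b\<in>Basis. (x \<bullet> b) ^ \<alpha> b) / (1 + (norm x)\<^sup>2) ^ Suc n) \<partial>(lborel :: 'a measure)) =
      ennreal (pi ^ h * fact (n - h - (\<Sum>b\<in>Basis. \<alpha> b) div 2) / (fact n * 2 ^ ((\<Sum>b\<in>Basis. \<alpha> b) div 2)) *
        (\<Prod>b\<in>Basis. real (normal_moment (\<alpha> b))))"
      using nn_integral_even_moment_rational_weight[OF dim, of \<beta> n] n unfolding prods sum by simp
  qed simp
next
  case False
  then obtain b0 where b0: "b0 \<in> (Basis :: 'a set)" "odd (\<alpha> b0)" by blast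
  define f where "f x = (\<Prod>b\<in>Basis. (x \<bullet> b) ^ \<alpha> b) / (1 + (norm x)\<^sup>2) ^ Suc n" for x :: 'a
  define m where "m = (\<Sum>b\<in>(Basis :: 'a set). \<alpha> b)"
  \<comment> \<open>Half the degree, rounded up: a monomial of degree m is at most (1 + |x|^2)^k,
    and even for odd m the remaining weight is still integrable.\<close>
  define k where "k = Suc m div 2"
  have k: "h + k \<le> n" using n by (simp add: k_def m_def)
  have meas[measurable]: "f \<in> borel_measurable borel" unfolding f_def by measurable
  have bound: "norm (f x) \<le> norm (1 / (1 + (norm x)\<^sup>2) ^ Suc (n - k))" for x
  proof -
    have pos: "1 \<le> 1 + (norm x)\<^sup>2" by simp
    have "\<bar>\<Prod>b\<in>Basis. (x \<bullet> b) ^ \<alpha> b\<bar> \<le> (\<Prod>b\<in>(Basis :: 'a set). sqrt (1 + (norm x)\<^sup>2) ^ \<alpha> b)"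
      unfolding abs_prod power_abs
    proof (intro prod_mono conjI power_mono)
      fix b :: 'a assume "b \<in> Basis"
      then have "\<bar>x \<bullet> b\<bar> \<le> norm x" by (rule Basis_le_norm)
      also have "\<dots> \<le> sqrt (1 + (norm x)\<^sup>2)" by (rule real_le_rsqrt) simp
      finally show "\<bar>x \<bullet> b\<bar> \<le> sqrt (1 + (norm x)\<^sup>2)" .
    qed auto
    also have "\<dots> = sqrt (1 + (norm x)\<^sup>2) ^ m" by (simp add: power_sum m_def)
    also have "\<dots> \<le> sqrt (1 + (norm x)\<^sup>2) ^ (2 * k)"
      by (rule power_increasing) (auto simp: k_def)
    also have "\<dots> = (1 + (norm x)\<^sup>2) ^ k" using pos by (simp add: power_mult)
    finally have "\<bar>f x\<bar> \<le> (1 + (norm x)\<^sup>2) ^ k / (1 + (norm x)\<^sup>2) ^ Suc n"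
      using pos by (simp add: f_def divide_right_mono)
    also have "Suc n = k + Suc (n - k)" using k by simp
    also have "(1 + (norm x)\<^sup>2) ^ k / (1 + (norm x)\<^sup>2) ^ (k + Suc (n - k)) = 1 / (1 + (norm x)\<^sup>2) ^ Suc (n - k)"
      using pos by (simp only: power_add) (simp add: field_simps add_nonneg_eq_0_iff)
    finally show ?thesis using pos by simp
  qed
  have "integrable lborel (\<lambda>x :: 'a. 1 / (1 + (norm x)\<^sup>2) ^ Suc (n - k))"
    using nn_integral_even_moment_rational_weight[OF dim, of "\<lambda>_. 0" "n - k"] k
    by (intro integrableI_bounded) (auto simp del: power_Suc simp: abs_of_nonneg)
  then have int: "integrable lborel f"
    by (rule Bochner_Integration.integrable_bound) (use bound in auto)
  \<comment> \<open>The reflection in \<open>b0\<close>, written as the diagonal affine map of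
    \<open>lborel_affine_euclidean\<close> with translation 0.\<close>
  define T where "T x = 0 + (\<Sum>j\<in>Basis. ((if j = b0 then -1 else 1) * (x \<bullet> j)) *\<^sub>R j)" for x :: 'a
  have T: "T x \<bullet> b = (if b = b0 then - (x \<bullet> b) else x \<bullet> b)" if "b \<in> Basis" for x b
    using that by (auto simp: T_def inner_sum_left inner_Basis if_distrib cong: if_cong)
  have norm_T: "(norm (T x))\<^sup>2 = (norm x)\<^sup>2" for x
    unfolding norm_sq_euclidean by (rule sum.cong) (auto simp: T)
  have f_T: "f (T x) = - f x" for x
  proof -
    have "(\<Prod>b\<in>Basis. (T x \<bullet> b) ^ \<alpha> b) = (\<Prod>b\<in>Basis. (if b = b0 then -1 else 1) * (x \<bullet> b) ^ \<alpha> b)"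
      using b0 by (intro prod.cong) (auto simp: T)
    also have "\<dots> = - (\<Prod>b\<in>Basis. (x \<bullet> b) ^ \<alpha> b)"
      using b0 by (simp add: prod.distrib)
    finally show ?thesis by (simp add: f_def norm_T)
  qed
  have meas_T[measurable]: "T \<in> borel_measurable borel" unfolding T_def by measurable
  have "(lborel :: 'a measure) = distr lborel borel T"
  proof -
    have "(\<Prod>j\<in>(Basis :: 'a set). \<bar>if j = b0 then -1 else 1 :: real\<bar>) = 1"
      by (intro prod.neutral) auto
    then show ?thesis
      using lborel_affine_euclidean[of "\<lambda>j. if j = b0 then -1 else 1" "0 :: 'a"]
      by (simp add: T_def[abs_def] density_1)
  qed
  then have "integral\<^sup>L lborel f = integral\<^sup>L (distr lborel borel T) f" by simp
  also have "\<dots> = integral\<^sup>L lborel (\<lambda>x. f (T x))" by (rule integral_distr) auto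
  finally have "integral\<^sup>L lborel f = 0" by (simp add: f_T)
  moreover have "(\<Prod>b\<in>(Basis :: 'a set). real (normal_moment (\<alpha> b))) = 0"
    using b0 by (force simp: normal_moment_odd)
  ultimately show ?thesis using int by (simp add: has_bochner_integral_iff f_def[abs_def])
qed

section \<open>Coefficients of products of forms\<close>

lemma shuffle_sum_of_int:
  "of_int (shuffle_sum k xs F) = (shuffle_sum k xs (\<lambda>ys zs. of_int (F ys zs)) :: 'a::comm_ring_1)"
  by (induction k xs F rule: shuffle_sum.induct) simp_all

lemma shuffle_sum_add:
  "shuffle_sum k xs (\<lambda>ys zs. F ys zs + G ys zs) = shuffle_sum k xs F + shuffle_sum k xs G"
proof (induction k xs F arbitrary: G rule: shuffle_sum.induct)
  case (3 k x xs F)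
  show ?case
    unfolding shuffle_sum.simps 3(1)[of "\<lambda>ys. G (x # ys)"] 3(2)[of "\<lambda>ys zs. G ys (x # zs)"]
    by (simp add: algebra_simps)
qed simp_all

lemma shuffle_sum_sum:
  "shuffle_sum k xs (\<lambda>ys zs. \<Sum>l\<in>L. F l ys zs) = (\<Sum>l\<in>L. shuffle_sum k xs (F l))"
  by (induction L rule: infinite_finite_induct) (simp_all add: shuffle_sum_zero shuffle_sum_add)

lemma sorted_wrt_shuffles:
  "xs \<in> shuffles ys zs \<Longrightarrow> sorted_wrt P xs \<Longrightarrow> sorted_wrt P ys \<and> sorted_wrt P zs"
proof (induction ys zs arbitrary: xs rule: shuffles.induct)
  case (3 y ys z zs)
  from 3(3) consider us where "xs = y # us" "us \<in> shuffles ys (z # zs)"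
    | us where "xs = z # us" "us \<in> shuffles (y # ys) zs" by auto
  then show ?case
  proof cases
    case 1
    then show ?thesis using 3(1)[of us] 3(4) set_shuffles[OF 1(2)] by auto
  next
    case 2
    then show ?thesis using 3(2)[of us] 3(4) set_shuffles[OF 2(2)] by auto
  qed
qed auto

text \<open>The subsets are split by whether they contain the least element x. Inside A it causes no
  inversion; outside A it is inverted with each of the \<open>Suc k\<close> elements of A.\<close>

lemma sum_wedge_eq_shuffle_sum:
  assumes "sorted_wrt (<) xs"
  shows "(\<Sum>A | A \<subseteq> set xs \<and> card A = k. wedge_sign A (set xs - A) * H A (set xs - A)) =
    shuffle_sum k xs (\<lambda>ys zs. H (set ys) (set zs))"
  using assms
proof (induction k xs "\<lambda>ys zs. H (set ys) (set zs)" arbitrary: H rule: shuffle_sum.induct)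
  case (1 xs)
  have "{A. A \<subseteq> set xs \<and> card A = 0} = {{}}" by (auto dest: finite_subset)
  then show ?case by simp
next
  case (2 k)
  have "{A. A \<subseteq> set [] \<and> card A = Suc k} = ({} :: nat set set)" by auto
  then show ?case by (simp only: sum.empty shuffle_sum.simps)
next
  case (3 k x xs)
  let ?X = "set xs"
  have x: "\<And>b. b \<in> ?X \<Longrightarrow> x < b" "x \<notin> ?X" and sorted: "sorted_wrt (<) xs" using 3(3) by auto
  have split: "{A. A \<subseteq> insert x ?X \<and> card A = Suc k} =
      insert x ` {A. A \<subseteq> ?X \<and> card A = k} \<union> {A. A \<subseteq> ?X \<and> card A = Suc k}" (is "?L = insert x ` ?M \<union> ?N")
  proof (intro Set.equalityI subsetI)
    fix A assume A: "A \<in> ?L"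
    show "A \<in> insert x ` ?M \<union> ?N"
    proof (cases "x \<in> A")
      case True
      then have "A = insert x (A - {x})" "A - {x} \<in> ?M"
        using A by (auto simp: finite_subset)
      then show ?thesis by blast
    qed (use A in auto)
  next
    fix A assume "A \<in> insert x ` ?M \<union> ?N"
    then show "A \<in> ?L"
    proof
      assume "A \<in> insert x ` ?M"
      then obtain B where B: "A = insert x B" "B \<subseteq> ?X" "card B = k" by auto
      then have "x \<notin> B" "finite B" using x(2) by (auto intro: finite_subset)
      then show ?thesis using B by auto
    qed auto
  qed
  have disj: "insert x ` ?M \<inter> ?N = {}" using x(2) by auto
  have inj: "inj_on (insert x) ?M"
    using x(2) by (intro inj_onI) (metis (no_types, lifting) insert_ident mem_Collect_eq subsetD)
  have fin: "finite ?M" "finite ?N" by (auto intro: finite_subset[of _ "Pow ?X"])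
  have "(\<Sum>A\<in>?L. wedge_sign A (insert x ?X - A) * H A (insert x ?X - A)) =
      (\<Sum>A\<in>?M. wedge_sign (insert x A) (insert x ?X - insert x A) * H (insert x A) (insert x ?X - insert x A)) +
      (\<Sum>A\<in>?N. wedge_sign A (insert x ?X - A) * H A (insert x ?X - A))"
    unfolding split using fin inj disj by (subst sum.union_disjoint) (auto simp: sum.reindex)
  also have "(\<Sum>A\<in>?M. wedge_sign (insert x A) (insert x ?X - insert x A) * H (insert x A) (insert x ?X - insert x A)) =
      (\<Sum>A\<in>?M. wedge_sign A (?X - A) * H (insert x A) (?X - A))"
  proof (rule sum.cong[OF refl])
    fix A assume A: "A \<in> ?M"
    then have "finite A" "x \<notin> A" using x(2) by (auto intro: finite_subset)
    then have "wedge_sign (insert x A) (?X - A) = wedge_sign {x} (?X - A) * wedge_sign A (?X - A)"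
      using wedge_sign_union_left[of "{x}" A "?X - A"] by simp
    moreover have "{(a, b). a \<in> {x} \<and> b \<in> ?X - A \<and> b < a} = {}" using x(1) by fastforce
    then have "wedge_sign {x} (?X - A) = 1" by (simp only: wedge_sign_def card.empty power_0)
    moreover have "insert x ?X - insert x A = ?X - A" using x(2) by auto
    ultimately show "wedge_sign (insert x A) (insert x ?X - insert x A) * H (insert x A) (insert x ?X - insert x A) =
        wedge_sign A (?X - A) * H (insert x A) (?X - A)" by simp
  qed
  also have "\<dots> = shuffle_sum k xs (\<lambda>ys. (\<lambda>ys zs. H (set ys) (set zs)) (x # ys))"
    using 3(1)[of "\<lambda>A. H (insert x A)"] sorted by simp
  also have "(\<Sum>A\<in>?N. wedge_sign A (insert x ?X - A) * H A (insert x ?X - A)) =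
      (\<Sum>A\<in>?N. (-1) ^ Suc k * (wedge_sign A (?X - A) * H A (insert x (?X - A))))"
  proof (rule sum.cong[OF refl])
    fix A assume A: "A \<in> ?N"
    then have fA: "finite A" and xA: "x \<notin> A" using x(2) by (auto intro: finite_subset)
    have D: "insert x ?X - A = {x} \<union> (?X - A)" using xA by auto
    have "wedge_sign A (insert x ?X - A) = wedge_sign A {x} * wedge_sign A (?X - A)"
      unfolding D using fA x(2) by (subst wedge_sign_union_right) auto
    moreover have "{(a, b). a \<in> A \<and> b \<in> {x} \<and> b < a} = A \<times> {x}" using A x(1) by auto
    then have "wedge_sign A {x} = (-1) ^ Suc k"
      using A by (simp only: wedge_sign_def card_cartesian_product) simp
    ultimately show "wedge_sign A (insert x ?X - A) * H A (insert x ?X - A) =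
        (-1) ^ Suc k * (wedge_sign A (?X - A) * H A (insert x (?X - A)))" by (simp add: D)
  qed
  also have "\<dots> = (-1) ^ Suc k * shuffle_sum (Suc k) xs (\<lambda>ys zs. (\<lambda>ys zs. H (set ys) (set zs)) ys (x # zs))"
    using 3(2)[of "\<lambda>A B. H A (insert x B)"] sorted
    by (simp add: sum_negf sum_distrib_left[symmetric])
  finally show ?case by simp
qed

definition homogeneous :: "nat \<Rightarrow> even_form \<Rightarrow> bool" where
  "homogeneous k f \<longleftrightarrow> (\<forall>S. form_coeff f S \<noteq> 0 \<longrightarrow> card S = k)"

lemma form_coeff_support: "form_coeff f S \<noteq> 0 \<Longrightarrow> S \<subseteq> {..<16}"
  using form_coeff[of f] by auto

lemma form_coeff_mult:
  assumes "homogeneous k f" "sorted_wrt (<) xs"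
  shows "form_coeff (f * g) (set xs) = shuffle_sum k xs (\<lambda>ys zs. form_coeff f (set ys) * form_coeff g (set zs))"
proof -
  have "form_coeff (f * g) (set xs) =
      (\<Sum>A\<in>Pow (set xs). wedge_sign A (set xs - A) * (form_coeff f A * form_coeff g (set xs - A)))"
    by (simp add: times_even_form.rep_eq mult.assoc)
  also have "\<dots> = (\<Sum>A | A \<subseteq> set xs \<and> card A = k. wedge_sign A (set xs - A) * (form_coeff f A * form_coeff g (set xs - A)))"
    using assms(1) by (intro sum.mono_neutral_right) (auto simp: homogeneous_def)
  also have "\<dots> = shuffle_sum k xs (\<lambda>ys zs. form_coeff f (set ys) * form_coeff g (set zs))"
    by (rule sum_wedge_eq_shuffle_sum[OF assms(2)])
  finally show ?thesis .
qed

lemma form_coeff_sum: "form_coeff (sum f A) S = (\<Sum>a\<in>A. form_coeff (f a) S)"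
  by (induction A rule: infinite_finite_induct) (simp_all add: zero_even_form.rep_eq plus_even_form.rep_eq)

lemma homogeneous_sum: "(\<And>a. a \<in> A \<Longrightarrow> homogeneous k (f a)) \<Longrightarrow> homogeneous k (sum f A)"
  unfolding homogeneous_def form_coeff_sum by (meson sum.not_neutral_contains_not_neutral)

lemma homogeneous_mult:
  assumes "homogeneous k f" "homogeneous l g"
  shows "homogeneous (k + l) (f * g)"
  unfolding homogeneous_def
proof (intro allI impI)
  fix S assume ne: "form_coeff (f * g) S \<noteq> 0"
  then have fin: "finite S" using form_coeff_support finite_subset by blast
  from ne obtain A where A: "A \<subseteq> S" "form_coeff f A \<noteq> 0" "form_coeff g (S - A) \<noteq> 0"
    unfolding times_even_form.rep_eq by (metis (no_types, lifting) PowD mult_not_zero sum.neutral)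
  then have "card A = k" "card (S - A) = l" using assms by (auto simp: homogeneous_def)
  then show "card S = k + l"
    using A(1) fin by (metis card_Diff_subset card_mono finite_subset le_add_diff_inverse)
qed

section \<open>The Kaehler forms\<close>

lemma nat_less_8_cases: "i < 8 \<Longrightarrow> i \<in> set [0,1,2,3,4,5,6,7::nat]" by auto

lemma side_mult_basis:
  assumes "i < 8" "j < 8"
  shows "side_mult s (oct_basis i) (oct_basis j) = real_of_int (oct_sign s i j) *\<^sub>R oct_basis (xr i j)"
proof -
  have "list_all (\<lambda>i. list_all (\<lambda>j. side_mult s (oct_basis i) (oct_basis j) =
      real_of_int (oct_sign s i j) *\<^sub>R oct_basis (xr i j)) [0,1,2,3,4,5,6,7]) [0,1,2,3,4,5,6,7]"
    by (cases s) (simp_all add: oct_basis_def quat_basis_def oct_sign_table_def zero_prod_def)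
  then show ?thesis using assms[THEN nat_less_8_cases] by (simp only: list_all_iff)
qed

lemma oct_basis_inner:
  assumes "i < 8" "j < 8"
  shows "oct_basis i \<bullet> oct_basis j = of_bool (i = j)"
proof -
  have "list_all (\<lambda>i. list_all (\<lambda>j. oct_basis i \<bullet> oct_basis j = of_bool (i = j)) [0,1,2,3,4,5,6,7]) [0,1,2,3,4,5,6,7]"
    by (simp add: oct_basis_def quat_basis_def zero_prod_def)
  then show ?thesis using assms[THEN nat_less_8_cases] by (simp only: list_all_iff)
qed

lemma oct2_basis_inner: "i < 16 \<Longrightarrow> j < 16 \<Longrightarrow> oct2_basis i \<bullet> oct2_basis j = of_bool (i = j)"
  by (auto simp: oct2_basis_def oct_basis_inner)

lemma quat_mult_scaleR:
  "quat_mult (c *\<^sub>R p) q = c *\<^sub>R quat_mult p q" "quat_mult p (c *\<^sub>R q) = c *\<^sub>R quat_mult p q"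
  by (cases p rule: quat_cnj.cases; cases q rule: quat_cnj.cases; simp add: algebra_simps)+

lemma quat_cnj_scaleR: "quat_cnj (c *\<^sub>R p) = c *\<^sub>R quat_cnj p"
  by (cases p rule: quat_cnj.cases) simp

lemma oct_mult_scaleR:
  "oct_mult (c *\<^sub>R x) y = c *\<^sub>R oct_mult x y" "oct_mult x (c *\<^sub>R y) = c *\<^sub>R oct_mult x y"
  by (cases x rule: prod.exhaust; cases y rule: prod.exhaust;
      simp add: quat_mult_scaleR quat_cnj_scaleR scaleR_diff_right scaleR_add_right)+

lemma side_mult_scaleR: "side_mult s u (c *\<^sub>R x) = c *\<^sub>R side_mult s u x"
  by (cases s) (simp_all add: oct_mult_scaleR)

lemma side_mult_0: "side_mult s u 0 = 0"
  using side_mult_scaleR[of s u 0 0] by simp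

lemma involution_scaleR: "involution s n (c *\<^sub>R v) = c *\<^sub>R involution s n v"
  by (cases v rule: prod.exhaust) (simp add: side_mult_scaleR)

text \<open>The ninth involution only changes signs, so it translates by 0. The n-th one exchanges
  the two halves, which adds 8, and multiplies by the unit with index n - 1.\<close>

definition inv_index :: "nat \<Rightarrow> nat" where "inv_index n = (if n = 9 then 0 else n + 7)"

lemma xor_add_8:
  assumes "p < 8" "u < 8"
  shows "xr p (8 + u) = 8 + xr p u" "xr (8 + p) (8 + u) = xr p u" "xr u p < 8"
proof -
  have "list_all (\<lambda>p. list_all (\<lambda>u. xr p (8 + u) = 8 + xr p u \<and> xr (8 + p) (8 + u) = xr p u \<and> xr u p < 8)
      [0,1,2,3,4,5,6,7]) [0,1,2,3,4,5,6,7]" by simp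
  then show "xr p (8 + u) = 8 + xr p u" "xr (8 + p) (8 + u) = xr p u" "xr u p < 8"
    using assms[THEN nat_less_8_cases] by (simp_all only: list_all_iff)
qed

lemma involution_basis:
  assumes "n \<in> {1..9}" "p < 16"
  shows "involution s n (oct2_basis p) =
    real_of_int (inv_sign s (inv_index n) p) *\<^sub>R oct2_basis (xr p (inv_index n))"
proof -
  consider "n = 1" | "n = 9" | u where "n = u + 1" "0 < u" "u < 8"
    using assms(1) by (cases n) force+
  moreover have p8: "\<exists>q<8. p = 8 + q" if "\<not> p < 8"
    using that assms(2) by (intro exI[of _ "p - 8"]) auto
  ultimately show ?thesis
  proof cases
    case 1
    show ?thesis
    proof (cases "p < 8")
      case True
      then show ?thesis using 1 xor_add_8(1)[of p 0]
        by (simp add: inv_index_def inv_sign_def oct2_basis_def)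
    next
      case False
      then obtain q where "p = 8 + q" "q < 8" using p8 by blast
      then show ?thesis using 1 xor_add_8(2)[of q 0]
        by (simp add: inv_index_def inv_sign_def oct2_basis_def)
    qed
  next
    case 2
    then show ?thesis by (simp add: inv_index_def inv_sign_def oct2_basis_def)
  next
    case (3 u)
    show ?thesis
    proof (cases "p < 8")
      case True
      then show ?thesis using 3 xor_add_8[of p u]
        by (simp add: inv_index_def inv_sign_def oct2_basis_def side_mult_basis side_mult_0 xor.commute)
    next
      case False
      then obtain q where q: "p = 8 + q" "q < 8" using p8 by blast
      then show ?thesis using 3 xor_add_8[of q u]
        by (simp add: inv_index_def inv_sign_def oct2_basis_def side_mult_basis side_mult_0 xor.commute)
    qed
  qed
qed

lemma form_coeff_kahler_form:
  assumes ab: "a \<in> {1..9}" "b \<in> {1..9}"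
    and xs: "sorted_wrt (<) xs" "length xs = 2" "set xs \<subseteq> {..<16}"
  shows "form_coeff (kahler_form s a b) (set xs) = of_int (psi_coeff s (inv_index a) (inv_index b) xs)"
proof -
  obtain x y where xy: "xs = [x, y]" "x < y" "x < 16" "y < 16"
    using xs by (auto simp: numeral_2_eq_2 length_Suc_conv)
  have list: "sorted_list_of_set {x, y} = [x, y]"
    using xy sorted_list_of_set_sort_remdups[of "[x, y]"] by simp
  have idx: "inv_index n < 16" if "n \<in> {1..9}" for n using that by (simp add: inv_index_def)
  show ?thesis
  proof (cases "a = b")
    case True
    then show ?thesis using xy by (simp add: kahler_form_def zero_even_form.rep_eq psi_coeff_def)
  next
    case False
    have "form_coeff (kahler_form s a b) (set xs) =
        oct2_basis x \<bullet> involution s a (involution s b (oct2_basis y))"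
      using False xy by (simp add: kahler_form_def form_of.rep_eq list)
    also have "\<dots> = of_int (inv_sign s (inv_index b) y * inv_sign s (inv_index a) (xr y (inv_index b))) *
        of_bool (x = xr (xr y (inv_index b)) (inv_index a))"
      using xy ab by (simp add: involution_basis involution_scaleR xor_less_16 idx oct2_basis_inner)
    finally show ?thesis by (simp add: xy psi_coeff_def ac_simps)
  qed
qed

lemma homogeneous_kahler_form: "homogeneous 2 (kahler_form s a b)"
  by (auto simp: homogeneous_def kahler_form_def form_of.rep_eq zero_even_form.rep_eq split: if_splits)

text \<open>Padding with zeros turns sums over the nine involutions into sums over a range that is
  closed under bitwise addition.\<close>

lemma sum_inv_index:
  fixes f :: "nat \<Rightarrow> 'a::comm_monoid_add"
  assumes "\<And>b. 0 < b \<Longrightarrow> b < 8 \<Longrightarrow> f b = 0"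
  shows "(\<Sum>l<9. f (inv_index (l + 1))) = (\<Sum>b<16. f b)"
  using assms by (simp add: numeral_eq_Suc inv_index_def ac_simps)

lemma sorted_list_of_set_subseq_idx:
  assumes "S \<subseteq> {..<16}"
  shows "subseq (sorted_list_of_set S) idx"
proof -
  have "finite S" using assms finite_subset by blast
  then have "sorted_list_of_set S = filter (\<lambda>i. i \<in> S) [0..<16]"
    using assms by (intro sorted_distinct_set_unique) (auto simp: sorted_wrt_filter)
  then show ?thesis by (simp add: idx_upt)
qed

lemma form_coeff_4: "form_coeff (4 * f) S = 4 * form_coeff f S"
proof -
  have "4 * f = (f + f) + (f + f)"
    by (simp only: numeral_Bit0 numeral_One distrib_right mult_1)
  then show ?thesis by (simp only: plus_even_form.rep_eq)
qed

section \<open>Powers of the Kaehler matrix and its fourth characteristic coefficient\<close>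

context
  fixes s :: side
begin

abbreviation (input) K :: "even_form Matrix.mat" where "K \<equiv> kahler_matrix s"

lemma kahler_matrix_carrier: "K \<in> carrier_mat 9 9" by (simp add: kahler_matrix_def)

lemma kahler_matrix_sq_index:
  assumes "i < 9" "j < 9"
  shows "(K * K) $$ (i, j) = (\<Sum>l<9. kahler_form s (i + 1) (l + 1) * kahler_form s (l + 1) (j + 1))"
  using assms by (simp add: kahler_matrix_def scalar_prod_def atLeast0LessThan)

lemma homogeneous_kahler_sq: "i < 9 \<Longrightarrow> j < 9 \<Longrightarrow> homogeneous 4 ((K * K) $$ (i, j))"
  using homogeneous_mult[OF homogeneous_kahler_form homogeneous_kahler_form]
  unfolding kahler_matrix_sq_index by (intro homogeneous_sum) auto

lemma form_coeff_kahler_sq: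
  assumes ij: "i < 9" "j < 9" and xs: "sorted_wrt (<) xs" "length xs = 4" "set xs \<subseteq> {..<16}"
  shows "form_coeff ((K * K) $$ (i, j)) (set xs) = of_int (psi2_coeff s (inv_index (i + 1)) (inv_index (j + 1)) xs)"
proof -
  let ?a = "inv_index (i + 1)" and ?c = "inv_index (j + 1)"
  have "form_coeff ((K * K) $$ (i, j)) (set xs) = (\<Sum>l<9. shuffle_sum 2 xs (\<lambda>ys zs.
      form_coeff (kahler_form s (i + 1) (l + 1)) (set ys) * form_coeff (kahler_form s (l + 1) (j + 1)) (set zs)))"
    unfolding kahler_matrix_sq_index[OF ij] form_coeff_sum
    by (intro sum.cong refl form_coeff_mult homogeneous_kahler_form xs)
  also have "\<dots> = (\<Sum>l<9. shuffle_sum 2 xs (\<lambda>ys zs.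
      of_int (psi_coeff s ?a (inv_index (l + 1)) ys * psi_coeff s (inv_index (l + 1)) ?c zs)))"
  proof (intro sum.cong refl shuffle_sum_cong)
    fix l ys zs assume l: "l \<in> {..<9::nat}" and sh: "xs \<in> shuffles ys zs" and len: "length ys = 2"
    have "length zs = 2" using length_shuffles[OF sh] len xs by simp
    then show "form_coeff (kahler_form s (i + 1) (l + 1)) (set ys) * form_coeff (kahler_form s (l + 1) (j + 1)) (set zs) =
        of_int (psi_coeff s ?a (inv_index (l + 1)) ys * psi_coeff s (inv_index (l + 1)) ?c zs)"
      using ij l len xs sorted_wrt_shuffles[OF sh xs(1)] set_shuffles[OF sh]
      by (simp add: form_coeff_kahler_form)
  qed
  also have "\<dots> = (\<Sum>b<16. shuffle_sum 2 xs (\<lambda>ys zs. of_int (psi_coeff s ?a b ys * psi_coeff s b ?c zs)))"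
    by (rule sum_inv_index) (simp add: psi_coeff_def inv_sign_def shuffle_sum_zero cong: if_cong)
  finally show ?thesis by (simp add: psi2_coeff_def shuffle_sum_of_int shuffle_sum_sum)
qed

text \<open>Diagonal entries of psi^2 live on 4-subsets with bitwise sum zero, so a check over the
  affine planes suffices. It is a hypothesis at this point and is discharged later from the
  evaluated tables.\<close>

lemma trace_kahler_sq:
  assumes trace: "\<forall>xs\<in>set (planes 0). (\<Sum>a<16. psi2_coeff s a a xs) = 0"
  shows "(\<Sum>i<9. (K * K) $$ (i, i)) = 0"
proof -
  have hom: "homogeneous 4 (\<Sum>i<9. (K * K) $$ (i, i))"
    by (intro homogeneous_sum homogeneous_kahler_sq) auto
  have "form_coeff (\<Sum>i<9. (K * K) $$ (i, i)) S = 0" for S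
  proof (rule ccontr)
    assume ne: "\<not> ?thesis"
    then have S: "S \<subseteq> {..<16}" "card S = 4" using form_coeff_support hom by (auto simp: homogeneous_def)
    then have fin: "finite S" using finite_subset by blast
    define xs where "xs = sorted_list_of_set S"
    have xs: "sorted_wrt (<) xs" "length xs = 4" "set xs = S"
      using S fin by (auto simp: xs_def)
    have "form_coeff (\<Sum>i<9. (K * K) $$ (i, i)) S =
        (\<Sum>l<9. of_int (psi2_coeff s (inv_index (l + 1)) (inv_index (l + 1)) xs))"
      using form_coeff_kahler_sq[of _ _ xs] xs S by (simp add: form_coeff_sum)
    also have "\<dots> = of_int (\<Sum>a<16. psi2_coeff s a a xs)"
      unfolding of_int_sum
      by (rule sum_inv_index) (simp add: psi2_coeff_def psi_coeff_def inv_sign_def shuffle_sum_zero cong: if_cong)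
    also have "(\<Sum>a<16. psi2_coeff s a a xs) = 0"
    proof (cases "xor_list xs = 0")
      case True
      have "subseq xs idx" unfolding xs_def using S by (intro sorted_list_of_set_subseq_idx)
      then show ?thesis using True xs by (intro trace[rule_format]) (simp add: planes_def set_sublists_xor)
    next
      case False
      then show ?thesis using xs by (intro sum.neutral) (simp add: psi2_coeff_eq_0)
    qed
    finally show False using ne by simp
  qed
  then show ?thesis by (intro form_coeff_inject[THEN iffD1]) (auto simp: zero_even_form.rep_eq)
qed

lemma even_form_torsion_free: "2 * f = 0 \<Longrightarrow> f = (0 :: even_form)"
proof -
  assume "2 * f = 0"
  then have "f + f = 0" by (simp only: mult_2)
  then have "form_coeff f S + form_coeff f S = 0" for S
    by (metis plus_even_form.rep_eq zero_even_form.rep_eq)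
  then show ?thesis
    by (intro form_coeff_inject[THEN iffD1]) (simp add: zero_even_form.rep_eq fun_eq_iff)
qed

lemma tau_4:
  assumes trace: "\<forall>xs\<in>set (planes 0). (\<Sum>a<16. psi2_coeff s a a xs) = 0"
  shows "4 * tau 4 K = - (\<Sum>i<9. \<Sum>j<9. (K * K) $$ (i, j) * (K * K) $$ (j, i))"
proof -
  have KK: "K * K \<in> carrier_mat 9 9" using kahler_matrix_carrier by auto
  have sq: "(A * A) $$ (i, i) = (\<Sum>j<9. A $$ (i, j) * A $$ (j, i))"
    if "A \<in> carrier_mat 9 9" "i < 9" for A :: "even_form Matrix.mat" and i
    using that by (auto simp: scalar_prod_def atLeast0LessThan)
  have "4 * tau 4 K = 4 * coeff (char_poly K) (9 - 4)"
    by (simp add: tau_def kahler_matrix_def)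
  also have "\<dots> = - (\<Sum>i<9. (K * K * (K * K)) $$ (i, i))"
  proof (rule coeff_char_poly_4[OF kahler_matrix_carrier])
    show "(\<Sum>i<9. K $$ (i, i)) = 0" by (simp add: kahler_matrix_def kahler_form_def)
  qed (simp_all add: trace_kahler_sq[OF trace] even_form_torsion_free)
  also have "(\<Sum>i<9. (K * K * (K * K)) $$ (i, i)) = (\<Sum>i<9. \<Sum>j<9. (K * K) $$ (i, j) * (K * K) $$ (j, i))"
    using sq[OF KK] by (intro sum.cong refl) auto
  finally show ?thesis .
qed

lemma form_coeff_tau_4:
  assumes trace: "\<forall>xs\<in>set (planes 0). (\<Sum>a<16. psi2_coeff s a a xs) = 0"
    and xs: "sorted_wrt (<) xs" "length xs = 8" "set xs \<subseteq> {..<16}"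
  shows "form_coeff (tau 4 K) (set xs) = - of_int (psi4_coeff s xs) / 4"
proof -
  have "form_coeff (\<Sum>i<9. \<Sum>j<9. (K * K) $$ (i, j) * (K * K) $$ (j, i)) (set xs) =
      (\<Sum>i<9. \<Sum>j<9. shuffle_sum 4 xs (\<lambda>ys zs.
        form_coeff ((K * K) $$ (i, j)) (set ys) * form_coeff ((K * K) $$ (j, i)) (set zs)))"
    unfolding form_coeff_sum by (intro sum.cong refl form_coeff_mult homogeneous_kahler_sq xs) auto
  also have "\<dots> = (\<Sum>i<9. \<Sum>j<9. shuffle_sum 4 xs (\<lambda>ys zs.
      of_int (psi2_coeff s (inv_index (i + 1)) (inv_index (j + 1)) ys * psi2_coeff s (inv_index (j + 1)) (inv_index (i + 1)) zs)))"
  proof (intro sum.cong refl shuffle_sum_cong)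
    fix i j ys zs assume ij: "i \<in> {..<9::nat}" "j \<in> {..<9::nat}" and sh: "xs \<in> shuffles ys zs" and len: "length ys = 4"
    have "length zs = 4" using length_shuffles[OF sh] len xs by simp
    then show "form_coeff ((K * K) $$ (i, j)) (set ys) * form_coeff ((K * K) $$ (j, i)) (set zs) =
        of_int (psi2_coeff s (inv_index (i + 1)) (inv_index (j + 1)) ys * psi2_coeff s (inv_index (j + 1)) (inv_index (i + 1)) zs)"
      using ij len xs sorted_wrt_shuffles[OF sh xs(1)] set_shuffles[OF sh]
      by (simp add: form_coeff_kahler_sq)
  qed
  also have "\<dots> = (\<Sum>i<9. \<Sum>c<16. shuffle_sum 4 xs (\<lambda>ys zs.
      of_int (psi2_coeff s (inv_index (i + 1)) c ys * psi2_coeff s c (inv_index (i + 1)) zs)))"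
    by (intro sum.cong refl sum_inv_index) (simp add: psi2_coeff_def psi_coeff_def inv_sign_def shuffle_sum_zero cong: if_cong)
  also have "\<dots> = (\<Sum>a<16. \<Sum>c<16. shuffle_sum 4 xs (\<lambda>ys zs. of_int (psi2_coeff s a c ys * psi2_coeff s c a zs)))"
    by (rule sum_inv_index) (simp add: psi2_coeff_def psi_coeff_def inv_sign_def shuffle_sum_zero cong: if_cong)
  finally have "form_coeff (\<Sum>i<9. \<Sum>j<9. (K * K) $$ (i, j) * (K * K) $$ (j, i)) (set xs) = of_int (psi4_coeff s xs)"
    by (simp add: psi4_coeff_def shuffle_sum_of_int shuffle_sum_sum)
  then show ?thesis
    using form_coeff_4[of "tau 4 K" "set xs"] unfolding tau_4[OF trace] by (simp add: uminus_even_form.rep_eq)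
qed

lemma homogeneous_tau_4:
  assumes trace: "\<forall>xs\<in>set (planes 0). (\<Sum>a<16. psi2_coeff s a a xs) = 0"
  shows "homogeneous 8 (tau 4 K)"
  unfolding homogeneous_def
proof (intro allI impI)
  fix S assume "form_coeff (tau 4 K) S \<noteq> 0"
  then have "form_coeff (\<Sum>i<9. \<Sum>j<9. (K * K) $$ (i, j) * (K * K) $$ (j, i)) S \<noteq> 0"
    using form_coeff_4[of "tau 4 K" S] unfolding tau_4[OF trace] by (simp add: uminus_even_form.rep_eq)
  moreover have "homogeneous (4 + 4) (\<Sum>i<9. \<Sum>j<9. (K * K) $$ (i, j) * (K * K) $$ (j, i))"
    by (intro homogeneous_sum homogeneous_mult homogeneous_kahler_sq) auto
  ultimately show "card S = 8" by (simp add: homogeneous_def)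
qed

end

section \<open>Moments on the octonions\<close>

lemma Basis_oct: "(Basis :: oct set) = oct_basis ` {..<8}"
proof -
  have "{..<8} = {0,1,2,3,4,5,6,7::nat}" by auto
  then show ?thesis
    by (auto simp: Basis_prod_def oct_basis_def quat_basis_def zero_prod_def)
qed

lemma inj_on_oct_basis: "inj_on oct_basis {..<8}"
proof (rule inj_onI)
  fix i j assume "i \<in> {..<8::nat}" "j \<in> {..<8::nat}" "oct_basis i = oct_basis j"
  then show "i = j" using oct_basis_inner[of i i] oct_basis_inner[of i j] by auto
qed

lemma DIM_oct: "DIM(oct) = 2 * 4" by simp

lemma prod_list_eq_prod_count_list:
  fixes f :: "'a \<Rightarrow> 'b::comm_monoid_mult"
  assumes "finite A" "set xs \<subseteq> A"
  shows "prod_list (map f xs) = (\<Prod>a\<in>A. f a ^ count_list xs a)"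
  using assms(2)
proof (induction xs)
  case (Cons x xs)
  have "(\<Prod>a\<in>A. f a ^ count_list (x # xs) a) = (\<Prod>a\<in>A. (if a = x then f a else 1) * f a ^ count_list xs a)"
    by (intro prod.cong) auto
  then show ?case using Cons assms(1) by (simp add: prod.distrib prod.delta)
qed simp

text \<open>Pairing the first variable with each equal later one is the recursion E x^(n+1) = n E
  x^(n-1) for that variable; the other factors are unaffected.\<close>

lemma wick_eq_prod_normal_moment:
  assumes "finite A" "set xs \<subseteq> A"
  shows "wick xs = int (\<Prod>a\<in>A. normal_moment (count_list xs a))"
  using assms(2)
proof (induction xs rule: wick.induct)
  case (2 x xs)
  have count: "count_list (remove1 x xs) a = (if a = x then count_list xs x - 1 else count_list xs a)" for a
    by (induction xs) auto
  have x: "x \<in> A" and sub: "set (remove1 x xs) \<subseteq> A" using 2(2) set_remove1_subset by fastforce+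
  have rest: "(\<Prod>a\<in>A - {x}. normal_moment (count_list (x # xs) a)) =
      (\<Prod>a\<in>A - {x}. normal_moment (count_list (remove1 x xs) a))"
    by (intro prod.cong) (auto simp: count)
  have "normal_moment (Suc n) = n * normal_moment (n - 1)" for n by (cases n) auto
  then have "normal_moment (count_list (x # xs) x) =
      count_list xs x * normal_moment (count_list (remove1 x xs) x)" by (simp add: count)
  then show ?case
    using 2(1)[OF sub] assms(1) x rest by (simp add: prod.remove[of A x])
qed simp

definition monomial :: "oct \<Rightarrow> nat list \<Rightarrow> real" where
  "monomial m vs = prod_list (map (\<lambda>i. m \<bullet> oct_basis i) vs)"

lemma has_bochner_integral_monomial:
  assumes ms: "set ms \<subseteq> {..<8}" and n: "8 + length ms < 2 * n"
  shows "has_bochner_integral lborel (\<lambda>m. monomial m ms / (1 + (norm m)\<^sup>2) ^ Suc n)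
    (pi ^ 4 * fact (n - 4 - length ms div 2) / (fact n * 2 ^ (length ms div 2)) * of_int (wick ms))"
proof -
  define \<alpha> where "\<alpha> b = count_list ms (the_inv_into {..<8} oct_basis b)" for b
  have \<alpha>: "i < 8 \<Longrightarrow> \<alpha> (oct_basis i) = count_list ms i" for i
    by (simp add: \<alpha>_def the_inv_into_f_f[OF inj_on_oct_basis])
  have 1: "(\<Prod>b\<in>Basis. (m \<bullet> b) ^ \<alpha> b) = monomial m ms" for m
    unfolding monomial_def prod_list_eq_prod_count_list[OF finite_lessThan ms] Basis_oct
    by (subst prod.reindex[OF inj_on_oct_basis]) (simp add: \<alpha>)
  have 2: "(\<Sum>b\<in>Basis. \<alpha> b) = length ms"
    unfolding Basis_oct using sum_count_set[OF ms]
    by (subst sum.reindex[OF inj_on_oct_basis]) (simp add: \<alpha>)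
  have 3: "(\<Prod>b\<in>Basis. real (normal_moment (\<alpha> b))) = of_int (wick ms)"
    unfolding wick_eq_prod_normal_moment[OF finite_lessThan ms] Basis_oct
    by (subst prod.reindex[OF inj_on_oct_basis]) (simp add: \<alpha>)
  show ?thesis
    using has_bochner_integral_moment_rational_weight[OF DIM_oct, of \<alpha> n] n unfolding 1 2 3 by simp
qed

section \<open>Moments of minors\<close>

lemma sum_list_picks:
  "sum_list (map F (picks ys)) = (\<Sum>i<length ys. F ((-1) ^ i, ys ! i, take i ys @ drop (Suc i) ys))"
proof (induction ys arbitrary: F)
  case (Cons y ys)
  show ?case
    using Cons.IH[of "F \<circ> (\<lambda>(e, z, zs). (- e, z, y # zs))"]
    by (simp add: sum.lessThan_Suc_shift o_def del: sum.lessThan_Suc)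
qed simp

text \<open>The recursion of \<open>minor_moment\<close> with real entries, so that integration can
  be carried out term by term.\<close>

primrec laplace :: "(nat \<Rightarrow> nat \<Rightarrow> real) \<Rightarrow> nat list \<Rightarrow> nat list \<Rightarrow> real" where
  "laplace g [] ys = 1"
| "laplace g (x # xs) ys = sum_list (map (\<lambda>(e, y, zs). of_int e * g x y * laplace g xs zs) (picks ys))"

lemma det_eq_laplace:
  "length ys = length xs \<Longrightarrow>
    det (Matrix.mat (length xs) (length xs) (\<lambda>(i, j). g (xs ! j) (ys ! i))) = laplace g xs ys"
proof (induction xs arbitrary: ys)
  case Nil
  then show ?case by (simp add: det_dim_zero)
next
  case (Cons x xs)
  let ?n = "length xs"
  let ?A = "Matrix.mat (Suc ?n) (Suc ?n) (\<lambda>(i, j). g ((x # xs) ! j) (ys ! i))"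
  have "det ?A = (\<Sum>i<Suc ?n. ?A $$ (i, 0) * cofactor ?A i 0)"
    by (rule laplace_expansion_column) auto
  also have "\<dots> = (\<Sum>i<Suc ?n. (-1) ^ i * g x (ys ! i) * laplace g xs (take i ys @ drop (Suc i) ys))"
  proof (rule sum.cong[OF refl])
    fix i assume i: "i \<in> {..<Suc ?n}"
    have "mat_delete ?A i 0 = Matrix.mat ?n ?n (\<lambda>(i', j). g (xs ! j) ((take i ys @ drop (Suc i) ys) ! i'))"
      using i Cons.prems by (intro eq_matI) (auto simp: mat_delete_def nth_append min_def)
    then have "cofactor ?A i 0 = (-1) ^ i * laplace g xs (take i ys @ drop (Suc i) ys)"
      using i Cons.prems Cons.IH[of "take i ys @ drop (Suc i) ys"] by (simp add: cofactor_def)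
    then show "?A $$ (i, 0) * cofactor ?A i 0 = (-1) ^ i * g x (ys ! i) * laplace g xs (take i ys @ drop (Suc i) ys)"
      using i by simp
  qed
  finally show ?case using Cons.prems by (simp add: sum_list_picks)
qed

lemma has_bochner_integral_sum_list:
  "(\<And>x. x \<in> set xs \<Longrightarrow> has_bochner_integral M (f x) (v x)) \<Longrightarrow>
    has_bochner_integral M (\<lambda>m. \<Sum>x\<leftarrow>xs. f x m :: real) (\<Sum>x\<leftarrow>xs. v x)"
  by (induction xs) (auto intro!: has_bochner_integral_add)

lemma of_int_sum_list: "of_int (sum_list (map f xs)) = (\<Sum>x\<leftarrow>xs. of_int (f x) :: 'a::ring_1)"
  by (induction xs) simp_all

definition entry_value :: "oct \<Rightarrow> int \<times> nat list \<Rightarrow> real" where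
  "entry_value m = (\<lambda>(c, vs). of_int c * monomial m vs)"

lemma picks_subset: "(e, y, zs) \<in> set (picks ys) \<Longrightarrow> y \<in> set ys \<and> set zs \<subseteq> set ys"
  by (induction ys arbitrary: e zs) fastforce+

text \<open>All monomials in the expansion have the same degree \<open>L\<close>, because the degree
  of a nonzero entry depends only on its column. A weight whose moments of degree \<open>L\<close>
  are a constant times Wick numbers therefore integrates the whole minor to that constant times
  \<open>minor_moment\<close>.\<close>

lemma has_bochner_integral_laplace:
  assumes entry: "\<And>x y c vs. x \<in> set xs \<Longrightarrow> y \<in> set ys \<Longrightarrow> entry x y = (c, vs) \<Longrightarrow> c \<noteq> 0 \<Longrightarrow>
      set vs \<subseteq> {..<8} \<and> length vs = d x"
    and weight: "\<And>ms. set ms \<subseteq> {..<8} \<Longrightarrow> length ms = L \<Longrightarrow>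
      has_bochner_integral lborel (\<lambda>m. monomial m ms * w m) (C * of_int (wick ms))"
    and ms: "set ms \<subseteq> {..<8}" "length ms + sum_list (map d xs) = L"
  shows "has_bochner_integral lborel
    (\<lambda>m. monomial m ms * laplace (\<lambda>x y. entry_value m (entry x y)) xs ys * w m)
    (C * of_int (minor_moment entry xs ys ms))"
  using entry ms
proof (induction xs arbitrary: ys ms)
  case Nil
  then show ?case using weight by simp
next
  case (Cons x xs)
  let ?l = "\<lambda>m. laplace (\<lambda>x y. entry_value m (entry x y)) xs"
  have "has_bochner_integral lborel
      (\<lambda>m. \<Sum>p\<leftarrow>picks ys. case p of (e, y, zs) \<Rightarrow> of_int e * entry_value m (entry x y) * (monomial m ms * ?l m zs * w m))
      (\<Sum>p\<leftarrow>picks ys. C * of_int (case p of (e, y, zs) \<Rightarrow> case entry x y of (c, vs) \<Rightarrow>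
          if c = 0 then 0 else e * c * minor_moment entry xs zs (vs @ ms)))"
  proof (rule has_bochner_integral_sum_list)
    fix p assume p_in: "p \<in> set (picks ys)"
    obtain e y zs where p: "p = (e, y, zs)" by (cases p)
    obtain c vs where cv: "entry x y = (c, vs)" by fastforce
    have yz: "y \<in> set ys" "set zs \<subseteq> set ys" using picks_subset p_in p by fastforce+
    show "has_bochner_integral lborel
        (\<lambda>m. case p of (e, y, zs) \<Rightarrow> of_int e * entry_value m (entry x y) * (monomial m ms * ?l m zs * w m))
        (C * of_int (case p of (e, y, zs) \<Rightarrow> case entry x y of (c, vs) \<Rightarrow>
            if c = 0 then 0 else e * c * minor_moment entry xs zs (vs @ ms)))"
    proof (cases "c = 0")
      case True
      then show ?thesis by (auto simp: p cv entry_value_def intro: has_bochner_integral_zero)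
    next
      case False
      have vs: "set vs \<subseteq> {..<8}" "length vs = d x"
        using Cons.prems(1)[OF _ yz(1) cv False] by auto
      have "has_bochner_integral lborel (\<lambda>m. monomial m (vs @ ms) * ?l m zs * w m)
          (C * of_int (minor_moment entry xs zs (vs @ ms)))"
      proof (rule Cons.IH)
        fix x' y' c' vs' assume "x' \<in> set xs" "y' \<in> set zs" "entry x' y' = (c', vs')" "c' \<noteq> 0"
        then show "set vs' \<subseteq> {..<8} \<and> length vs' = d x'"
          using Cons.prems(1)[of x' y' c' vs'] yz(2) by auto
      qed (use vs Cons.prems in auto)
      from has_bochner_integral_mult_right[OF this, of "of_int (e * c)"] False
      show ?thesis by (simp add: p cv entry_value_def monomial_def ac_simps)
    qed
  qed
  moreover have "(\<Sum>p\<leftarrow>picks ys. case p of (e, y, zs) \<Rightarrow> of_int e * entry_value m (entry x y) * (monomial m ms * ?l m zs * w m)) =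
      monomial m ms * laplace (\<lambda>x y. entry_value m (entry x y)) (x # xs) ys * w m" for m
    by (simp add: sum_list_const_mult[symmetric] sum_list_mult_const[symmetric] split_def ac_simps)
  moreover have "(\<Sum>p\<leftarrow>picks ys. C * of_int (case p of (e, y, zs) \<Rightarrow> case entry x y of (c, vs) \<Rightarrow>
          if c = 0 then 0 else e * c * minor_moment entry xs zs (vs @ ms))) =
      C * of_int (minor_moment entry (x # xs) ys ms)"
    by (simp add: sum_list_const_mult[symmetric] of_int_sum_list o_def del: of_int_mult cong: if_cong)
  ultimately show ?case by simp
qed

text \<open>Each pairing removes two equal variables, whose labels cancel in the bitwise
  sum.\<close>

lemma wick_nonzero_imp_xor:
  "wick ms \<noteq> 0 \<Longrightarrow> xor_list (map f ms) = 0"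
proof (induction ms rule: wick.induct)
  case (2 x xs)
  then have x: "x \<in> set xs" "wick (remove1 x xs) \<noteq> 0" by (auto simp: count_list_0_iff)
  have "x \<in> set xs \<Longrightarrow> xor_list (map f xs) = xr (f x) (xor_list (map f (remove1 x xs)))"
    by (induction xs) (auto simp: xor.left_commute)
  then show ?case using 2(1) x by simp
qed simp

text \<open>A surviving term uses every row once and each of its entries accounts for the
  translation between row and column, so the total translation is carried by variables that pair
  off. The relabelling \<open>f\<close> is there because coordinate u of m stands for translation by
  8 + u.\<close>

lemma minor_moment_nonzero_imp_xor:
  assumes "\<And>x y c vs. x \<in> set xs \<Longrightarrow> y \<in> set ys \<Longrightarrow> entry x y = (c, vs) \<Longrightarrow> c \<noteq> 0 \<Longrightarrow>
      xor_list (map f vs) = xr x y"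
    and "length ys = length xs" "minor_moment entry xs ys ms \<noteq> 0"
  shows "xr (xor_list xs) (xor_list ys) = xor_list (map f ms)"
  using assms
proof (induction xs arbitrary: ys ms)
  case Nil
  then show ?case using wick_nonzero_imp_xor[of ms f] by simp
next
  case (Cons x xs)
  have "\<exists>p\<in>set (picks ys). (case p of (e, y, zs) \<Rightarrow> case entry x y of (c, vs) \<Rightarrow>
      if c = 0 then 0 else e * c * minor_moment entry xs zs (vs @ ms)) \<noteq> 0" (is "\<exists>p\<in>_. ?t p \<noteq> 0")
  proof (rule ccontr)
    assume "\<not> ?thesis"
    then have "sum_list (map ?t (picks ys)) = 0" by (intro sum_list_neutral) auto
    then show False using Cons.prems(3) by simp
  qed
  then obtain e y zs c vs where p: "(e, y, zs) \<in> set (picks ys)" "entry x y = (c, vs)" "c \<noteq> 0"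
      "minor_moment entry xs zs (vs @ ms) \<noteq> 0"
    by (fastforce split: prod.splits if_splits)
  have "xor_list ys = xr y (xor_list zs) \<and> length ys = Suc (length zs)"
    using p(1)
  proof (induction ys arbitrary: e zs)
    case (Cons y' ys)
    then show ?case by (auto simp: xor.left_commute)
  qed simp
  moreover have "xr (xor_list xs) (xor_list zs) = xor_list (map f (vs @ ms))"
  proof (rule Cons.IH)
    fix x' y' c' vs' assume "x' \<in> set xs" "y' \<in> set zs" "entry x' y' = (c', vs')" "c' \<noteq> 0"
    then show "xor_list (map f vs') = xr x' y'"
      using Cons.prems(1)[of x' y' c' vs'] picks_subset[OF p(1)] by auto
  qed (use calculation Cons.prems p in auto)
  moreover have "xor_list (map f (vs @ ms)) = xr (xor_list (map f vs)) (xor_list (map f ms))"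
    by (induction vs) (auto simp: xor.assoc)
  moreover have "xor_list (map f vs) = xr x y"
    using Cons.prems(1)[of x y c vs] p picks_subset[OF p(1)] by auto
  ultimately have "xr (xor_list xs) (xor_list zs) = xr (xr x y) (xor_list (map f ms))" by simp
  then have "xor_list (map f ms) = xr (xr x y) (xr (xor_list xs) (xor_list zs))"
    by (metis xor_eq_iff)
  then show ?case using \<open>xor_list ys = xr y (xor_list zs) \<and> _\<close> by (simp add: ac_simps)
qed

section \<open>The integral over the lines\<close>

lemma quat_mult_add:
  "quat_mult (p + q) r = quat_mult p r + quat_mult q r" "quat_mult p (q + r) = quat_mult p q + quat_mult p r"
  by (cases p rule: quat_cnj.cases; cases q rule: quat_cnj.cases; cases r rule: quat_cnj.cases;
      simp add: algebra_simps)+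

lemma quat_cnj_add: "quat_cnj (p + q) = quat_cnj p + quat_cnj q"
  by (cases p rule: quat_cnj.cases; cases q rule: quat_cnj.cases) simp

lemma oct_mult_add:
  "oct_mult (x + y) z = oct_mult x z + oct_mult y z" "oct_mult x (y + z) = oct_mult x y + oct_mult x z"
  by (cases x rule: prod.exhaust; cases y rule: prod.exhaust; cases z rule: prod.exhaust;
      simp add: quat_mult_add quat_cnj_add)+

lemma linear_side_mult: "linear (\<lambda>u. side_mult s u x)" "linear (side_mult s u)"
  by (cases s; rule linearI; simp add: oct_mult_add oct_mult_scaleR)+

lemma side_mult_inner:
  assumes "i < 8" "b < 8"
  shows "side_mult s m (oct_basis i) \<bullet> oct_basis b =
    of_int (oct_sign s (xr b i) i) * (m \<bullet> oct_basis (xr b i))"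
proof -
  have "m = (\<Sum>u<8. (m \<bullet> oct_basis u) *\<^sub>R oct_basis u)"
    using euclidean_representation[of m] unfolding Basis_oct by (simp add: sum.reindex inj_on_oct_basis)
  then have "side_mult s m (oct_basis i) = side_mult s (\<Sum>u<8. (m \<bullet> oct_basis u) *\<^sub>R oct_basis u) (oct_basis i)"
    by (rule arg_cong)
  then have "side_mult s m (oct_basis i) \<bullet> oct_basis b =
      (\<Sum>u<8. (m \<bullet> oct_basis u) * (side_mult s (oct_basis u) (oct_basis i) \<bullet> oct_basis b))"
    by (simp add: linear_sum[OF linear_side_mult(1)] linear_cmul[OF linear_side_mult(1)] inner_sum_left)
  also have "\<dots> = (\<Sum>u<8. if u = xr b i then of_int (oct_sign s (xr b i) i) * (m \<bullet> oct_basis (xr b i)) else 0)"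
  proof (rule sum.cong[OF refl])
    fix u assume u: "u \<in> {..<8::nat}"
    have "xr u i = b \<longleftrightarrow> u = xr b i" by (metis xor_eq_iff xor.commute)
    then have "oct_basis (xr u i) \<bullet> oct_basis b = of_bool (u = xr b i)"
      using assms u xor_add_8(3)[of i u] by (simp add: oct_basis_inner)
    then show "(m \<bullet> oct_basis u) * (side_mult s (oct_basis u) (oct_basis i) \<bullet> oct_basis b) =
        (if u = xr b i then of_int (oct_sign s (xr b i) i) * (m \<bullet> oct_basis (xr b i)) else 0)"
      using assms u by (simp add: side_mult_basis)
  qed
  finally show ?thesis using assms xor_add_8(3)[of i b] by simp
qed

lemma subspace_oct_line: "subspace (oct_line s l)"
proof (cases l)
  case None
  then show ?thesis by (auto simp: subspace_def zero_prod_def)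
next
  case (Some m)
  have "oct_line s l = range (\<lambda>x. (x, side_mult s m x))" using Some by auto
  moreover have "linear (\<lambda>x. (x, side_mult s m x))"
    by (rule linearI) (simp_all add: linear_add[OF linear_side_mult(2)] linear_cmul[OF linear_side_mult(2)])
  ultimately show ?thesis by (simp add: linear_subspace_image)
qed

text \<open>The error of the closest point is orthogonal to the subspace. Since the frame lies in
  the line, the projection disappears from the pulled-back volume form.\<close>

lemma inner_line_proj:
  assumes w: "w \<in> oct_line s l"
  shows "w \<bullet> line_proj s l v = w \<bullet> v"
proof -
  let ?V = "oct_line s l" and ?p = "line_proj s l v"
  have V: "convex ?V" "closed ?V" "?V \<noteq> {}"
    using subspace_oct_line[of s l] by (auto intro: subspace_imp_convex closed_subspace dest: subspace_0)
  have p: "?p \<in> ?V" unfolding line_proj_def by (rule closest_point_in_set[OF V(2,3)])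
  have "(v - ?p) \<bullet> (x - ?p) \<le> 0" if "x \<in> ?V" for x
    using closest_point_dot[OF V(1,2) that] unfolding line_proj_def .
  \<comment> \<open>The variational inequality is used at both points, which bounds the inner
    product by 0 from either side.\<close>
  from this[of "?p + w"] this[of "?p - w"] have "(v - ?p) \<bullet> w = 0"
    using subspace_add[OF subspace_oct_line p w] subspace_diff[OF subspace_oct_line p w] by auto
  then show ?thesis by (simp add: inner_diff_left inner_commute[of w])
qed

lemma line_frame_in_line: "line_frame s (Some m) i \<in> oct_line s (Some m)"
  unfolding oct_line.simps mem_Collect_eq
  by (intro exI[of _ "(1 / sqrt (1 + (norm m)\<^sup>2)) *\<^sub>R oct_basis i"]) (simp add: side_mult_scaleR)

lemma line_frame_inner:
  assumes "i < 8" "x < 16"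
  shows "line_frame s (Some m) i \<bullet> oct2_basis x =
    1 / sqrt (1 + (norm m)\<^sup>2) * entry_value m (frame_entry s x i)"
  using assms
  by (auto simp: oct2_basis_def frame_entry_def entry_value_def monomial_def oct_basis_inner side_mult_inner inner_diff_left)

section \<open>The volume form as a minor, and integration in the chart\<close>

definition oct_idx :: "nat list" where "oct_idx = [0,1,2,3,4,5,6,7]"

lemma oct_idx_nth: "i < 8 \<Longrightarrow> oct_idx ! i = i"
  using nat_less_8_cases[of i] by (auto simp: oct_idx_def)

lemma length_oct_idx: "length oct_idx = 8" by (simp add: oct_idx_def)

fun orientation :: "side \<Rightarrow> int" where "orientation Left_mult = 1" | "orientation Right_mult = -1"

lemma line_volume_form_basis:
  assumes xs: "length xs = 8" "set xs \<subseteq> {..<16}"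
  shows "line_volume_form s (Some m) (map (line_proj s (Some m)) (map oct2_basis xs)) =
    of_int (orientation s) * laplace (\<lambda>x y. entry_value m (frame_entry s x y)) xs oct_idx / (1 + (norm m)\<^sup>2) ^ 4"
proof -
  let ?c = "1 / sqrt (1 + (norm m)\<^sup>2)"
  let ?M = "Matrix.mat 8 8 (\<lambda>(i, j). entry_value m (frame_entry s (xs ! j) (oct_idx ! i)))"
  have pos: "0 < 1 + (norm m)\<^sup>2" by (simp add: add_pos_nonneg)
  have "Matrix.mat 8 8 (\<lambda>(i, j). line_frame s (Some m) i \<bullet>
      (map (line_proj s (Some m)) (map oct2_basis xs) ! j)) = ?c \<cdot>\<^sub>m ?M"
  proof (rule eq_matI)
    fix i j assume "i < dim_row (?c \<cdot>\<^sub>m ?M)" "j < dim_col (?c \<cdot>\<^sub>m ?M)"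
    then have ij: "i < 8" "j < 8" by auto
    then have "xs ! j \<in> set xs" using xs by simp
    then have "xs ! j < 16" using xs by auto
    then show "Matrix.mat 8 8 (\<lambda>(i, j). line_frame s (Some m) i \<bullet>
        (map (line_proj s (Some m)) (map oct2_basis xs) ! j)) $$ (i, j) = (?c \<cdot>\<^sub>m ?M) $$ (i, j)"
      using ij xs by (simp add: inner_line_proj[OF line_frame_in_line] line_frame_inner oct_idx_nth del: line_frame.simps)
  qed auto
  \<comment> \<open>Each of the eight frame vectors contributes 1 / sqrt (1 + |m|^2). Together with
    the exponent 8 of the invariant measure this makes the exponent 12.\<close>
  moreover have "?c ^ 8 = 1 / (1 + (norm m)\<^sup>2) ^ 4"
  proof -
    have "sqrt (1 + (norm m)\<^sup>2) ^ (2 * 4) = (1 + (norm m)\<^sup>2) ^ 4"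
      unfolding power_mult using pos by simp
    then show ?thesis by (simp add: power_one_over)
  qed
  moreover have "det ?M = laplace (\<lambda>x y. entry_value m (frame_entry s x y)) xs oct_idx"
    using det_eq_laplace[of oct_idx xs "\<lambda>x y. entry_value m (frame_entry s x y)"] xs by (simp add: length_oct_idx)
  moreover have "orientation_sign s = of_int (orientation s)" by (cases s) auto
  ultimately show ?thesis by (simp add: line_volume_form_def)
qed

text \<open>The sigma-algebra is generated by the sets with Borel preimage under
  \<open>Some\<close>, so measurability in the chart is enough to transfer the integral.\<close>

lemma integral_op1_measure:
  fixes f :: "op1 \<Rightarrow> real"
  assumes f[measurable]: "(\<lambda>m. f (Some m)) \<in> borel_measurable borel"
  shows "integral\<^sup>L op1_measure f = (\<integral>m. f (Some m) / (1 + (norm m)\<^sup>2) ^ 8 \<partial>lborel)"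
proof -
  let ?N = "sigma (UNIV :: op1 set) {A. Some -` A \<in> sets borel}"
  let ?w = "\<lambda>m :: oct. 1 / (1 + (norm m)\<^sup>2) ^ 8"
  have "Some \<in> measurable (density lborel (\<lambda>m. ennreal (?w m))) ?N"
    by (rule measurable_measure_of) auto
  moreover have "f \<in> borel_measurable ?N"
  proof (rule measurableI)
    fix A :: "real set" assume A: "A \<in> sets borel"
    have "Some -` (f -` A) = (\<lambda>m. f (Some m)) -` A \<inter> space borel" by auto
    also have "\<dots> \<in> sets borel" by (rule measurable_sets[OF f A])
    finally show "f -` A \<inter> space ?N \<in> sets ?N" by (auto simp: sets_measure_of)
  qed auto
  ultimately have "integral\<^sup>L op1_measure f = (\<integral>m. f (Some m) \<partial>density lborel (\<lambda>m. ennreal (?w m)))"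
    unfolding op1_measure_def by (rule integral_distr)
  also have "\<dots> = (\<integral>m. ?w m *\<^sub>R f (Some m) \<partial>lborel)"
    by (rule integral_density) auto
  finally show ?thesis by simp
qed

lemma det_mat_eq: "det (Matrix.mat n n (\<lambda>(i, j). g i j)) =
    (\<Sum>p | p permutes {0..<n}. signof p * (\<Prod>i = 0..<n. g i (p i)))"
  by (subst det_def'[of _ n])
    (auto intro!: sum.cong prod.cong simp: permutes_in_image[of _ "{0..<n}", simplified])

lemma borel_measurable_det:
  assumes "\<And>i j. i < n \<Longrightarrow> j < n \<Longrightarrow> (\<lambda>m. g m i j :: real) \<in> borel_measurable M"
  shows "(\<lambda>m. det (Matrix.mat n n (\<lambda>(i, j). g m i j))) \<in> borel_measurable M"
  unfolding det_mat_eq using assms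
  by (auto intro!: borel_measurable_sum borel_measurable_times borel_measurable_prod
        simp: permutes_in_image[of _ "{0..<n}", simplified])

lemma continuous_on_det:
  assumes "\<And>i j. i < n \<Longrightarrow> j < n \<Longrightarrow> continuous_on A (\<lambda>m. g m i j :: real)"
  shows "continuous_on A (\<lambda>m. det (Matrix.mat n n (\<lambda>(i, j). g m i j)))"
  unfolding det_mat_eq using assms
  by (auto intro!: continuous_intros continuous_on_sum continuous_on_prod
        simp: permutes_in_image[of _ "{0..<n}", simplified])

lemma borel_measurable_monomial: "(\<lambda>m. monomial m vs) \<in> borel_measurable borel"
  unfolding monomial_def by (induction vs) simp_all

lemma form_coeff_line_integral_form:
  assumes xs: "sorted_wrt (<) xs" "length xs = 8" "set xs \<subseteq> {..<16}"
    and int: "has_bochner_integral lborel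
      (\<lambda>m. laplace (\<lambda>x y. entry_value m (frame_entry s x y)) xs oct_idx / (1 + (norm m)\<^sup>2) ^ 12) v"
  shows "form_coeff (line_integral_form s) (set xs) = of_int (orientation s) * v"
proof -
  have "card (set xs) = 8" "sorted_list_of_set (set xs) = xs"
    using xs by (auto simp: strict_sorted_iff distinct_card sorted_list_of_set.idem_if_sorted_distinct)
  then have "form_coeff (line_integral_form s) (set xs) =
      (\<integral>l. line_volume_form s l (map (line_proj s l) (map oct2_basis xs)) \<partial>op1_measure)"
    using xs by (simp add: line_integral_form_def form_of.rep_eq)
  also have "\<dots> = (\<integral>m. line_volume_form s (Some m) (map (line_proj s (Some m)) (map oct2_basis xs)) /
      (1 + (norm m)\<^sup>2) ^ 8 \<partial>lborel)"
  proof (rule integral_op1_measure)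
    have "laplace (\<lambda>x y. entry_value m (frame_entry s x y)) xs oct_idx =
        det (Matrix.mat 8 8 (\<lambda>(i, j). entry_value m (frame_entry s (xs ! j) (oct_idx ! i))))" for m
      using det_eq_laplace[of oct_idx xs "\<lambda>x y. entry_value m (frame_entry s x y)"] xs by (simp add: length_oct_idx)
    moreover have "(\<lambda>m. entry_value m cv) \<in> borel_measurable borel" for cv
      by (cases cv) (auto simp: entry_value_def intro!: borel_measurable_times borel_measurable_monomial)
    ultimately have "(\<lambda>m. laplace (\<lambda>x y. entry_value m (frame_entry s x y)) xs oct_idx) \<in> borel_measurable borel"
      by (simp add: borel_measurable_det)
    then show "(\<lambda>m. line_volume_form s (Some m) (map (line_proj s (Some m)) (map oct2_basis xs))) \<in> borel_measurable borel"
      unfolding line_volume_form_basis[OF xs(2,3)] by measurable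
  qed
  also have "\<dots> = (\<integral>m. of_int (orientation s) *
      (laplace (\<lambda>x y. entry_value m (frame_entry s x y)) xs oct_idx / (1 + (norm m)\<^sup>2) ^ 12) \<partial>lborel)"
    unfolding line_volume_form_basis[OF xs(2,3)]
    by (intro Bochner_Integration.integral_cong refl) (simp flip: power_add)
  also have "\<dots> = of_int (orientation s) * v"
    using int by (simp add: has_bochner_integral_iff del: times_divide_eq_right)
  finally show ?thesis .
qed

lemma frame_entry_props:
  assumes "x < 16" "y < 8" "frame_entry s x y = (c, vs)" "c \<noteq> 0"
  shows "set vs \<subseteq> {..<8}" "length vs = (if x < 8 then 0 else 1)" "xor_list (map ((+) 8) vs) = xr x y"
proof -
  consider "x < 8" | u where "x = 8 + u" "u < 8" using assms(1) by (metis add.commute add_diff_inverse_nat nat_add_left_cancel_less numeral_Bit0)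
  then have "set vs \<subseteq> {..<8} \<and> length vs = (if x < 8 then 0 else 1) \<and> xor_list (map ((+) 8) vs) = xr x y"
  proof cases
    case 1
    then show ?thesis using assms by (auto simp: frame_entry_def split: if_splits)
  next
    case 2
    then show ?thesis using assms xor_add_8[of y u] by (auto simp: frame_entry_def xor.commute)
  qed
  then show "set vs \<subseteq> {..<8}" "length vs = (if x < 8 then 0 else 1)" "xor_list (map ((+) 8) vs) = xr x y"
    by auto
qed

lemma primed_eq: "primed xs = sum_list (map (\<lambda>x. if x < 8 then 0 else 1) xs)"
  by (induction xs) auto

lemma primed_le_length: "primed xs \<le> length xs"
  by (induction xs) auto

lemma set_oct_idx: "set oct_idx = {..<8}" by (auto simp: oct_idx_def)

text \<open>The moment formula for weight exponent 12 = \<open>Suc 11\<close> in dimension 2 * 4,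
  whence 7 = 11 - 4. It covers minors of every size and thus supplies integrability even where the
  dual expansion is the one evaluated.\<close>

lemma has_bochner_integral_frame:
  assumes xs: "length xs = 8" "set xs \<subseteq> {..<16}"
  shows "has_bochner_integral lborel
    (\<lambda>m. laplace (\<lambda>x y. entry_value m (frame_entry s x y)) xs oct_idx / (1 + (norm m)\<^sup>2) ^ 12)
    (pi ^ 4 * fact (7 - primed xs div 2) / (fact 11 * 2 ^ (primed xs div 2)) *
      of_int (minor_moment (frame_entry s) xs oct_idx []))"
proof -
  have le: "primed xs \<le> 8" using primed_le_length[of xs] xs(1) by simp
  have "has_bochner_integral lborel
    (\<lambda>m. monomial m [] * laplace (\<lambda>x y. entry_value m (frame_entry s x y)) xs oct_idx * (1 / (1 + (norm m)\<^sup>2) ^ 12))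
    (pi ^ 4 * fact (7 - primed xs div 2) / (fact 11 * 2 ^ (primed xs div 2)) *
      of_int (minor_moment (frame_entry s) xs oct_idx []))"
  proof (rule has_bochner_integral_laplace[where d = "\<lambda>x. if x < 8 then 0 else 1" and L = "primed xs"])
    fix ms :: "nat list" assume ms: "set ms \<subseteq> {..<8}" "length ms = primed xs"
    then show "has_bochner_integral lborel (\<lambda>m. monomial m ms * (1 / (1 + (norm m)\<^sup>2) ^ 12))
        (pi ^ 4 * fact (7 - primed xs div 2) / (fact 11 * 2 ^ (primed xs div 2)) * of_int (wick ms))"
      using has_bochner_integral_monomial[OF ms(1), of 11] le by simp
  next
    fix x y c vs assume "x \<in> set xs" "y \<in> set oct_idx" "frame_entry s x y = (c, vs)" "c \<noteq> 0"
    then show "set vs \<subseteq> {..<8} \<and> length vs = (if x < 8 then 0 else 1)"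
      using frame_entry_props[of x y s c vs] xs(2) by (auto simp: set_oct_idx)
  qed (simp_all add: primed_eq)
  then show ?thesis by (simp add: monomial_def)
qed

lemma minor_moment_frame_eq_0:
  assumes xs: "length xs = 8" "set xs \<subseteq> {..<16}" and "xor_list xs \<noteq> 0"
  shows "minor_moment (frame_entry s) xs oct_idx [] = 0"
proof (rule ccontr)
  assume *: "\<not> ?thesis"
  \<comment> \<open>The row indices 0, ..., 7 have bitwise sum 0 and no variables have been
    accumulated, so this forces \<open>xor_list xs\<close> to be 0.\<close>
  have "xr (xor_list xs) (xor_list oct_idx) = xor_list (map ((+) 8) [])"
  proof (rule minor_moment_nonzero_imp_xor)
    fix x y c vs assume "x \<in> set xs" "y \<in> set oct_idx" "frame_entry s x y = (c, vs)" "c \<noteq> 0"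
    then show "xor_list (map ((+) 8) vs) = xr x y"
      using frame_entry_props[of x y s c vs] xs(2) by (auto simp: set_oct_idx)
  qed (use * xs in \<open>auto simp: length_oct_idx\<close>)
  then show False using assms(3) by (simp add: oct_idx_def)
qed

section \<open>Duality\<close>

text \<open>
  Multiplying the matrix of a minor of size \<open>k\<close> of the multiplication by \<open>m\<close> with the matrix \<open>L\<close> of
  the multiplication itself, which satisfies \<open>L L\<^sup>T = |m|\<^sup>2\<close> and \<open>det L = |m|\<^sup>8\<close>, turns it into
  \<open>|m|\<^sup>2\<^sup>k\<^sup>-\<^sup>8\<close> times a minor of size \<open>8 - k\<close>.  This avoids the expansion of the large minors.
\<close>

definition mult_matrix :: "side \<Rightarrow> oct \<Rightarrow> real Matrix.mat" where
  "mult_matrix s m = Matrix.mat 8 8 (\<lambda>(b, i). side_mult s m (oct_basis i) \<bullet> oct_basis b)"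

lemma mult_matrix_carrier: "mult_matrix s m \<in> carrier_mat 8 8" by (simp add: mult_matrix_def)

lemma sum_lessThan_8: "(\<Sum>i<8. f i) = (\<Sum>i\<leftarrow>oct_idx. f i)" for f :: "nat \<Rightarrow> 'a::comm_monoid_add"
proof -
  have "{..<8} = set oct_idx" "distinct oct_idx" by (auto simp: oct_idx_def)
  then show ?thesis by (simp only: sum_list_distinct_conv_sum_set)
qed

lemma norm_sq_oct: "(norm m)\<^sup>2 = (\<Sum>u<8. (m \<bullet> oct_basis u)\<^sup>2)"
  unfolding norm_sq_euclidean Basis_oct by (simp add: sum.reindex inj_on_oct_basis)

text \<open>The norm of the octonions is multiplicative, so multiplication by m is |m| times an
  orthogonal map. It is verified here as 64 polynomial identities in the coordinates of m.\<close>

lemma mult_matrix_rows_orthogonal: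
  assumes "b < 8" "c < 8"
  shows "(\<Sum>i<8. (side_mult s m (oct_basis i) \<bullet> oct_basis b) * (side_mult s m (oct_basis i) \<bullet> oct_basis c)) =
    of_bool (b = c) * (norm m)\<^sup>2"
proof -
  have "list_all (\<lambda>b. list_all (\<lambda>c. (\<Sum>i\<leftarrow>oct_idx. of_int (oct_sign s (xr b i) i) * g (xr b i) *
      (of_int (oct_sign s (xr c i) i) * g (xr c i))) = of_bool (b = c) * (\<Sum>u\<leftarrow>oct_idx. (g u)\<^sup>2)) oct_idx) oct_idx"
    for g :: "nat \<Rightarrow> real"
    by (cases s) (simp_all add: oct_idx_def oct_sign_table_def power2_eq_square algebra_simps flip: numeral_2_eq_2)
  from this[of "\<lambda>u. m \<bullet> oct_basis u"] have
    "(\<Sum>i\<leftarrow>oct_idx. of_int (oct_sign s (xr b i) i) * (m \<bullet> oct_basis (xr b i)) *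
      (of_int (oct_sign s (xr c i) i) * (m \<bullet> oct_basis (xr c i)))) = of_bool (b = c) * (norm m)\<^sup>2"
    using assms unfolding norm_sq_oct sum_lessThan_8 list_all_iff set_oct_idx by blast
  moreover have "(\<Sum>i<8. (side_mult s m (oct_basis i) \<bullet> oct_basis b) * (side_mult s m (oct_basis i) \<bullet> oct_basis c)) =
      (\<Sum>i<8. of_int (oct_sign s (xr b i) i) * (m \<bullet> oct_basis (xr b i)) *
      (of_int (oct_sign s (xr c i) i) * (m \<bullet> oct_basis (xr c i))))"
    using assms by (intro sum.cong refl) (simp add: side_mult_inner)
  ultimately show ?thesis by (simp only: sum_lessThan_8)
qed

lemma det_mult_matrix_sq: "(det (mult_matrix s m))\<^sup>2 = ((norm m) ^ 8)\<^sup>2"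
proof -
  let ?L = "mult_matrix s m"
  have "?L * transpose_mat ?L = (norm m)\<^sup>2 \<cdot>\<^sub>m 1\<^sub>m 8"
    by (rule eq_matI) (auto simp: mult_matrix_def scalar_prod_def atLeast0LessThan mult_matrix_rows_orthogonal)
  then have "det (?L * transpose_mat ?L) = ((norm m)\<^sup>2) ^ 8" by simp
  moreover have "det (?L * transpose_mat ?L) = (det ?L)\<^sup>2"
    using mult_matrix_carrier[of s m]
    by (subst det_mult[of _ 8]) (auto simp: det_transpose power2_eq_square)
  ultimately show ?thesis by (simp add: power_mult[symmetric] mult.commute)
qed

lemma det_mult_matrix_one: "det (mult_matrix s (oct_basis 0)) = 1"
proof -
  have "list_all (\<lambda>i. oct_sign s 0 i = 1) oct_idx"
    by (cases s) (simp_all add: oct_idx_def oct_sign_table_def)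
  then have "oct_sign s 0 i = 1" if "i < 8" for i using that by (simp add: list_all_iff set_oct_idx)
  then have "mult_matrix s (oct_basis 0) = 1\<^sub>m 8"
    by (intro eq_matI) (auto simp: mult_matrix_def side_mult_basis oct_basis_inner)
  then show ?thesis by simp
qed

lemma continuous_on_det_mult_matrix: "continuous_on A (\<lambda>m. det (mult_matrix s m))"
  unfolding mult_matrix_def
  by (rule continuous_on_det) (auto simp: side_mult_inner intro!: continuous_intros)

text \<open>The square is known, so only the sign is open. The determinant has no zero on the
  connected set of nonzero octonions and equals 1 at the unit, hence it is positive
  throughout.\<close>

lemma det_mult_matrix:
  assumes "m \<noteq> 0"
  shows "det (mult_matrix s m) = (norm m) ^ 8"
proof -
  let ?d = "\<lambda>m. det (mult_matrix s m)"
  have ne: "?d m \<noteq> 0" if "m \<noteq> 0" for m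
    using det_mult_matrix_sq[of s m] that by auto
  have "0 < ?d m"
  proof (rule ccontr)
    assume "\<not> ?thesis"
    then have neg: "?d m \<le> 0" by simp
    have "connected (- {0 :: oct})" by (rule connected_punctured_universe) simp
    then have "connected (?d ` (- {0}))"
      by (rule connected_continuous_image[OF continuous_on_det_mult_matrix])
    moreover have "?d m \<in> ?d ` (- {0})" using assms by blast
    moreover have "oct_basis 0 \<noteq> 0" using oct_basis_inner[of 0 0] by auto
    then have "1 \<in> ?d ` (- {0})" using det_mult_matrix_one[of s] by (intro image_eqI[of _ _ "oct_basis 0"]) auto
    ultimately have "0 \<in> ?d ` (- {0})" using neg by (rule connectedD_interval) simp
    then obtain x where "0 = ?d x" "x \<in> - {0}" by (rule imageE)
    then show False using ne[of x] by simp
  qed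
  then show ?thesis by (intro power2_eq_imp_eq[OF det_mult_matrix_sq]) auto
qed

lemma det_scale_columns:
  "det (Matrix.mat n n (\<lambda>(i, j). w j * g i j :: 'a::comm_ring_1)) = (\<Prod>j<n. w j) * det (Matrix.mat n n (\<lambda>(i, j). g i j))"
proof -
  have "det (Matrix.mat n n (\<lambda>(i, j). w j * g i j)) =
      (\<Sum>p | p permutes {0..<n}. signof p * (\<Prod>i = 0..<n. w (p i) * g i (p i)))"
    by (rule det_mat_eq)
  also have "\<dots> = (\<Sum>p | p permutes {0..<n}. (\<Prod>j<n. w j) * (signof p * (\<Prod>i = 0..<n. g i (p i))))"
  proof (rule sum.cong[OF refl])
    fix p assume "p \<in> {p. p permutes {0..<n}}"
    then have "(\<Prod>i = 0..<n. w (p i)) = (\<Prod>j<n. w j)"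
      using prod.permute[of p "{0..<n}" w] by (simp add: o_def atLeast0LessThan)
    then show "signof p * (\<Prod>i = 0..<n. w (p i) * g i (p i)) = (\<Prod>j<n. w j) * (signof p * (\<Prod>i = 0..<n. g i (p i)))"
      by (simp add: prod.distrib ac_simps)
  qed
  also have "\<dots> = (\<Prod>j<n. w j) * det (Matrix.mat n n (\<lambda>(i, j). g i j))"
    unfolding det_mat_eq sum_distrib_left ..
  finally show ?thesis .
qed

lemma prod_primed: "(\<Prod>j<length xs. if xs ! j < 8 then 1 else r) = (r :: 'a::comm_monoid_mult) ^ primed xs"
  by (induction xs) (simp_all add: prod.lessThan_Suc_shift del: prod.lessThan_Suc)

lemma laplace_frame_dual:
  assumes xs: "length xs = 8" "set xs \<subseteq> {..<16}" and m: "m \<noteq> 0"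
  shows "(norm m) ^ 8 * laplace (\<lambda>x y. entry_value m (frame_entry s x y)) xs oct_idx =
    (norm m) ^ (2 * primed xs) * laplace (\<lambda>x y. entry_value m (dual_entry s x y)) xs oct_idx"
proof -
  let ?L = "mult_matrix s m"
  let ?F = "Matrix.mat 8 8 (\<lambda>(i, j). entry_value m (frame_entry s (xs ! j) (oct_idx ! i)))"
  let ?D = "Matrix.mat 8 8 (\<lambda>(i, j). entry_value m (dual_entry s (xs ! j) (oct_idx ! i)))"
  let ?w = "\<lambda>j. if xs ! j < 8 then 1 else (norm m)\<^sup>2"
  \<comment> \<open>An unprimed column of \<open>?F\<close> is a unit vector and selects a column of
    \<open>?L\<close>. A primed one is a row of \<open>?L\<close>, so orthogonality of the rows
    leaves |m|^2 times a unit vector.\<close>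
  have "?L * ?F = Matrix.mat 8 8 (\<lambda>(i, j). ?w j * entry_value m (dual_entry s (xs ! j) (oct_idx ! i)))"
  proof (rule eq_matI)
    fix b j assume "b < dim_row (Matrix.mat 8 8 (\<lambda>(i, j). ?w j * entry_value m (dual_entry s (xs ! j) (oct_idx ! i))))"
      "j < dim_col (Matrix.mat 8 8 (\<lambda>(i, j). ?w j * entry_value m (dual_entry s (xs ! j) (oct_idx ! i))))"
    then have bj: "b < 8" "j < 8" by auto
    then have "xs ! j \<in> set xs" using xs by simp
    then have x16: "xs ! j < 16" using xs by auto
    define x where "x = xs ! j"
    have "(?L * ?F) $$ (b, j) = (\<Sum>i<8. (side_mult s m (oct_basis i) \<bullet> oct_basis b) * entry_value m (frame_entry s x i))"
      using bj by (simp add: mult_matrix_def scalar_prod_def atLeast0LessThan oct_idx_nth x_def)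
    also have "\<dots> = ?w j * entry_value m (dual_entry s x b)"
    proof (cases "x < 8")
      case True
      then have "(\<Sum>i<8. (side_mult s m (oct_basis i) \<bullet> oct_basis b) * entry_value m (frame_entry s x i)) =
          (\<Sum>i<8. if i = x then side_mult s m (oct_basis i) \<bullet> oct_basis b else 0)"
        by (intro sum.cong refl) (auto simp: frame_entry_def entry_value_def monomial_def)
      also have "\<dots> = side_mult s m (oct_basis x) \<bullet> oct_basis b" using True by simp
      finally show ?thesis using True bj
        by (simp add: x_def side_mult_inner dual_entry_def entry_value_def monomial_def xor.commute)
    next
      case False
      then have "(\<Sum>i<8. (side_mult s m (oct_basis i) \<bullet> oct_basis b) * entry_value m (frame_entry s x i)) =
          (\<Sum>i<8. (side_mult s m (oct_basis i) \<bullet> oct_basis b) * (side_mult s m (oct_basis i) \<bullet> oct_basis (x - 8)))"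
        using x16 by (intro sum.cong refl) (auto simp: x_def frame_entry_def entry_value_def monomial_def side_mult_inner)
      also have "\<dots> = of_bool (b = x - 8) * (norm m)\<^sup>2"
        using False x16 bj by (intro mult_matrix_rows_orthogonal) (auto simp: x_def)
      finally show ?thesis using False by (auto simp: x_def dual_entry_def entry_value_def monomial_def)
    qed
    finally show "(?L * ?F) $$ (b, j) =
        Matrix.mat 8 8 (\<lambda>(i, j). ?w j * entry_value m (dual_entry s (xs ! j) (oct_idx ! i))) $$ (b, j)"
      using bj by (simp add: x_def oct_idx_nth)
  qed (simp_all add: mult_matrix_def)
  then have "det ?L * det ?F = (\<Prod>j<8. ?w j) * det ?D"
    using det_mult[OF mult_matrix_carrier[of s m], of ?F]
      det_scale_columns[of 8 ?w "\<lambda>i j. entry_value m (dual_entry s (xs ! j) (oct_idx ! i))"] by simp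
  moreover have "(\<Prod>j<8. ?w j) = (norm m) ^ (2 * primed xs)"
    using prod_primed[of xs "(norm m)\<^sup>2"] xs by (simp add: power_mult)
  moreover have "det ?F = laplace (\<lambda>x y. entry_value m (frame_entry s x y)) xs oct_idx"
    using det_eq_laplace[of oct_idx xs "\<lambda>x y. entry_value m (frame_entry s x y)"] xs by (simp add: length_oct_idx)
  moreover have "det ?D = laplace (\<lambda>x y. entry_value m (dual_entry s x y)) xs oct_idx"
    using det_eq_laplace[of oct_idx xs "\<lambda>x y. entry_value m (dual_entry s x y)"] xs by (simp add: length_oct_idx)
  ultimately show ?thesis by (simp add: det_mult_matrix[OF m])
qed

lemma dual_entry_props:
  assumes "x < 16" "y < 8" "dual_entry s x y = (c, vs)" "c \<noteq> 0"
  shows "set vs \<subseteq> {..<8}" "length vs = (if x < 8 then 1 else 0)"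
  using assms xor_add_8(3)[of y x] by (auto simp: dual_entry_def split: if_splits)

text \<open>The case k = 6 of the factor |m|^(2k-8). With u = 1 + |m|^2 it is (u - 1)^2, which
  expands into weights of exponents 10, 11 and 12.\<close>

lemma has_bochner_integral_monomial_6:
  assumes ms: "set ms \<subseteq> {..<8}" "length ms = 2"
  shows "has_bochner_integral lborel (\<lambda>m. monomial m ms * ((norm m) ^ 4 / (1 + (norm m)\<^sup>2) ^ 12))
    (pi ^ 4 * fact 6 / (fact 11 * 2) * of_int (wick ms))"
proof -
  define I where "I n = pi ^ 4 * fact (n - 5) / (fact n * 2) * of_int (wick ms)" for n :: nat
  have I: "has_bochner_integral lborel (\<lambda>m. monomial m ms / (1 + (norm m)\<^sup>2) ^ Suc n) (I n)" if "5 < n" for n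
    using has_bochner_integral_monomial[OF ms(1), of n] ms(2) that by (simp add: I_def)
  have u: "1 + (norm m)\<^sup>2 \<noteq> 0" for m :: oct by (rule less_imp_neq[THEN not_sym]) (simp add: add_pos_nonneg)
  have "x / u ^ Suc 9 - 2 * (x / u ^ Suc 10) + x / u ^ Suc 11 = x * ((u - 1)\<^sup>2 / u ^ 12)" if "u \<noteq> 0" for x u :: real
    using that by (simp add: field_simps power2_eq_square eval_nat_numeral)
  from this[OF u] have "monomial m ms / (1 + (norm m)\<^sup>2) ^ Suc 9 - 2 * (monomial m ms / (1 + (norm m)\<^sup>2) ^ Suc 10) +
      monomial m ms / (1 + (norm m)\<^sup>2) ^ Suc 11 = monomial m ms * ((norm m) ^ 4 / (1 + (norm m)\<^sup>2) ^ 12)" for m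
    by (simp flip: power_mult)
  moreover have "I 9 - 2 * I 10 + I 11 = pi ^ 4 * fact 6 / (fact 11 * 2) * of_int (wick ms)"
    by (simp add: I_def fact_numeral)
  ultimately show ?thesis
    using has_bochner_integral_add[OF has_bochner_integral_diff[OF I[of 9] has_bochner_integral_mult_right[OF I[of 10], of 2]] I[of 11]]
    by simp
qed

text \<open>The case k = 8, where no variable remains and |m|^8 = (u - 1)^4 is expanded
  binomially.\<close>

lemma has_bochner_integral_monomial_8:
  "has_bochner_integral lborel (\<lambda>m :: oct. (norm m) ^ 8 / (1 + (norm m)\<^sup>2) ^ 12) (pi ^ 4 * fact 7 / fact 11)"
proof -
  define I where "I n = pi ^ 4 * fact (n - 4) / fact n" for n :: nat
  have I: "has_bochner_integral lborel (\<lambda>m :: oct. 1 / (1 + (norm m)\<^sup>2) ^ Suc n) (I n)" if "4 < n" for n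
    using has_bochner_integral_monomial[of "[]" n] that by (simp add: I_def monomial_def)
  have u: "1 + (norm m)\<^sup>2 \<noteq> 0" for m :: oct by (rule less_imp_neq[THEN not_sym]) (simp add: add_pos_nonneg)
  have "1 / u ^ Suc 7 - 4 * (1 / u ^ Suc 8) + 6 * (1 / u ^ Suc 9) - 4 * (1 / u ^ Suc 10) + 1 / u ^ Suc 11 =
      (u - 1) ^ 4 / u ^ 12" if "u \<noteq> 0" for u :: real
    using that by (simp add: field_simps eval_nat_numeral)
  from this[OF u] have "1 / (1 + (norm m)\<^sup>2) ^ Suc 7 - 4 * (1 / (1 + (norm m)\<^sup>2) ^ Suc 8) +
      6 * (1 / (1 + (norm m)\<^sup>2) ^ Suc 9) - 4 * (1 / (1 + (norm m)\<^sup>2) ^ Suc 10) + 1 / (1 + (norm m)\<^sup>2) ^ Suc 11 =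
      (norm m) ^ 8 / (1 + (norm m)\<^sup>2) ^ 12" for m :: oct
    by (simp flip: power_mult)
  moreover have "I 7 - 4 * I 8 + 6 * I 9 - 4 * I 10 + I 11 = pi ^ 4 * fact 7 / fact 11"
    by (simp add: I_def fact_numeral)
  ultimately show ?thesis
    using has_bochner_integral_add[OF has_bochner_integral_diff[OF has_bochner_integral_add[OF has_bochner_integral_diff[OF
        I[of 7] has_bochner_integral_mult_right[OF I[of 8], of 4]] has_bochner_integral_mult_right[OF I[of 9], of 6]]
        has_bochner_integral_mult_right[OF I[of 10], of 4]] I[of 11]]
    by simp
qed

lemma has_bochner_integral_dual:
  assumes xs: "length xs = 8" "set xs \<subseteq> {..<16}" and k: "primed xs = 6 \<or> primed xs = 8"
  defines "j \<equiv> (8 - primed xs) div 2"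
  shows "has_bochner_integral lborel
    (\<lambda>m. laplace (\<lambda>x y. entry_value m (dual_entry s x y)) xs oct_idx * ((norm m) ^ (2 * primed xs - 8) / (1 + (norm m)\<^sup>2) ^ 12))
    (pi ^ 4 * fact (7 - j) / (fact 11 * 2 ^ j) * of_int (minor_moment (dual_entry s) xs oct_idx []))"
proof -
  have sum: "sum_list (map (\<lambda>x. if x < 8 then 1 else 0) xs) + primed xs = length xs"
    by (induction xs) auto
  have "has_bochner_integral lborel
    (\<lambda>m. monomial m [] * laplace (\<lambda>x y. entry_value m (dual_entry s x y)) xs oct_idx *
      ((norm m) ^ (2 * primed xs - 8) / (1 + (norm m)\<^sup>2) ^ 12))
    (pi ^ 4 * fact (7 - j) / (fact 11 * 2 ^ j) * of_int (minor_moment (dual_entry s) xs oct_idx []))"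
  proof (rule has_bochner_integral_laplace[where d = "\<lambda>x. if x < 8 then 1 else 0" and L = "8 - primed xs"])
    fix ms :: "nat list" assume ms: "set ms \<subseteq> {..<8}" "length ms = 8 - primed xs"
    show "has_bochner_integral lborel (\<lambda>m. monomial m ms * ((norm m) ^ (2 * primed xs - 8) / (1 + (norm m)\<^sup>2) ^ 12))
        (pi ^ 4 * fact (7 - j) / (fact 11 * 2 ^ j) * of_int (wick ms))"
      using k has_bochner_integral_monomial_6[OF ms(1)] has_bochner_integral_monomial_8 ms(2)
      by (auto simp: j_def monomial_def)
  next
    fix x y c vs assume "x \<in> set xs" "y \<in> set oct_idx" "dual_entry s x y = (c, vs)" "c \<noteq> 0"
    then show "set vs \<subseteq> {..<8} \<and> length vs = (if x < 8 then 1 else 0)"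
      using dual_entry_props[of x y s c vs] xs(2) by (auto simp: set_oct_idx)
  qed (use sum xs in auto)
  then show ?thesis by (simp add: monomial_def)
qed

text \<open>The highest of the four bits of a bitwise sum is the parity of the number of indices
  that are at least 8.\<close>

lemma even_primed:
  assumes "set xs \<subseteq> {..<16}" "xor_list xs = 0"
  shows "even (primed xs)"
proof -
  have xor: "8 \<le> xr x y \<longleftrightarrow> (8 \<le> x) \<noteq> (8 \<le> y)" if "x < 16" "y < 16" for x y :: nat
  proof -
    have "list_all (\<lambda>x. list_all (\<lambda>y. 8 \<le> xr x y \<longleftrightarrow> (8 \<le> x) \<noteq> (8 \<le> y)) idx) idx"
      by (simp add: idx_def)
    then show ?thesis using that by (simp add: list_all_iff idx_upt)
  qed
  have "set xs \<subseteq> {..<16} \<Longrightarrow> 8 \<le> xor_list xs \<longleftrightarrow> odd (primed xs)"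
    by (induction xs) (auto simp: xor xor_list_less_16)
  then show ?thesis using assms by simp
qed

text \<open>The 16 makes everything else an integer: 1 / 2^j = 2^(4-j) / 16, and
  \<open>moment_factor\<close> absorbs 2^(4-j), the factorial and the orientation.\<close>

lemma form_coeff_line_integral_form_octad:
  assumes xs: "sorted_wrt (<) xs" "length xs = 8" "set xs \<subseteq> {..<16}" and xor: "xor_list xs = 0"
  shows "form_coeff (line_integral_form s) (set xs) =
    pi ^ 4 / (fact 11 * 16) * of_int (moment_factor s (primed xs) * coord_moment s xs (primed xs))"
proof -
  define k where "k = primed xs"
  define j where "j = (if k < 5 then k else 8 - k) div 2"
  define v where "v = pi ^ 4 * fact (7 - j) / (fact 11 * 2 ^ j) * of_int (coord_moment s xs k)"
  have k: "k = 0 \<or> k = 2 \<or> k = 4 \<or> k = 6 \<or> k = 8"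
    using even_primed[OF xs(3) xor] primed_le_length[of xs] xs(2) unfolding k_def by presburger
  note frame = has_bochner_integral_frame[OF xs(2,3), of s]
  let ?f = "\<lambda>m. laplace (\<lambda>x y. entry_value m (frame_entry s x y)) xs oct_idx / (1 + (norm m)\<^sup>2) ^ 12"
  have "has_bochner_integral lborel ?f v"
  proof (cases "k < 5")
    case True
    then show ?thesis using frame by (simp add: v_def j_def k_def coord_moment_def oct_idx_def)
  next
    case False
    let ?g = "\<lambda>m. laplace (\<lambda>x y. entry_value m (dual_entry s x y)) xs oct_idx * ((norm m) ^ (2 * k - 8) / (1 + (norm m)\<^sup>2) ^ 12)"
    have k6: "k = 6 \<or> k = 8" using False k by auto
    then have dual: "has_bochner_integral lborel ?g v"
      using has_bochner_integral_dual[OF xs(2,3), of s] False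
      by (simp add: v_def j_def k_def coord_moment_def oct_idx_def)
    \<comment> \<open>Duality requires division by |m|^8, so the integrands agree only off the null
      set {0}.\<close>
    have eq: "?f m = ?g m" if "m \<noteq> 0" for m
    proof -
      have "2 * k = 8 + (2 * k - 8)" using k6 by auto
      then have "(norm m) ^ (2 * k) = (norm m) ^ 8 * (norm m) ^ (2 * k - 8)" by (metis power_add)
      then show ?thesis
        using laplace_frame_dual[OF xs(2,3) that, of s] that by (simp add: k_def)
    qed
    have "integral\<^sup>L lborel ?f = integral\<^sup>L lborel ?g"
      using frame dual AE_lborel_singleton[of 0]
      by (intro integral_cong_AE) (auto simp: has_bochner_integral_iff borel_measurable_integrable eq
          simp del: times_divide_eq_right)
    then show ?thesis using frame dual by (simp add: has_bochner_integral_iff)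
  qed
  from form_coeff_line_integral_form[OF xs this] show ?thesis
    using k by (cases s) (auto simp: v_def j_def k_def[symmetric] moment_factor_def fact_numeral)
qed

section \<open>Evaluation\<close>

text \<open>
  Tables are obtained by simplifying the right-hand side of \<open>map f xs = map f' xs\<close>, where the constants
  \<open>f\<close> and \<open>f'\<close> denote the same function but only \<open>f'\<close> has rewrite rules.  The simplifier evaluates both branches
  of a conditional here, so branching that must be lazy is expressed by matching on arguments.
\<close>

lemma xor_table: "map (\<lambda>x. map (xr x) idx) idx =
   [[0, 1, 2, 3, 4, 5, 6, 7, 8, 9, 10, 11, 12, 13, 14, 15],
    [1, 0, 3, 2, 5, 4, 7, 6, 9, 8, 11, 10, 13, 12, 15, 14],
    [2, 3, 0, 1, 6, 7, 4, 5, 10, 11, 8, 9, 14, 15, 12, 13],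
    [3, 2, 1, 0, 7, 6, 5, 4, 11, 10, 9, 8, 15, 14, 13, 12],
    [4, 5, 6, 7, 0, 1, 2, 3, 12, 13, 14, 15, 8, 9, 10, 11],
    [5, 4, 7, 6, 1, 0, 3, 2, 13, 12, 15, 14, 9, 8, 11, 10],
    [6, 7, 4, 5, 2, 3, 0, 1, 14, 15, 12, 13, 10, 11, 8, 9],
    [7, 6, 5, 4, 3, 2, 1, 0, 15, 14, 13, 12, 11, 10, 9, 8],
    [8, 9, 10, 11, 12, 13, 14, 15, 0, 1, 2, 3, 4, 5, 6, 7],
    [9, 8, 11, 10, 13, 12, 15, 14, 1, 0, 3, 2, 5, 4, 7, 6],
    [10, 11, 8, 9, 14, 15, 12, 13, 2, 3, 0, 1, 6, 7, 4, 5],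
    [11, 10, 9, 8, 15, 14, 13, 12, 3, 2, 1, 0, 7, 6, 5, 4],
    [12, 13, 14, 15, 8, 9, 10, 11, 4, 5, 6, 7, 0, 1, 2, 3],
    [13, 12, 15, 14, 9, 8, 11, 10, 5, 4, 7, 6, 1, 0, 3, 2],
    [14, 15, 12, 13, 10, 11, 8, 9, 6, 7, 4, 5, 2, 3, 0, 1],
    [15, 14, 13, 12, 11, 10, 9, 8, 7, 6, 5, 4, 3, 2, 1, 0]]"
  by (simp add: idx_def)
lemmas xor_tab = xor_table[unfolded idx_def, simplified list.map list.inject simp_thms]

lemmas arith = add_0_left add_0_right mult_zero_left mult_zero_right mult_1_left mult_1_right
  mult_minus1 mult_minus1_right minus_minus minus_zero diff_0 diff_0_right arith_simps
  diff_minus_eq_add one_add_one one_plus_numeral numeral_plus_one add_neg_numeral_special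
  diff_numeral_special minus_one_mult_self uminus_numeral_One add_uminus_conv_diff add_num_simps Num.inc.simps
lemmas cond = rel_simps simp_thms if_True if_False
lemma four: "4 = Suc (Suc (Suc (Suc 0)))" by simp
lemma eight: "8 = Suc (Suc (Suc (Suc (Suc (Suc (Suc (Suc 0)))))))" by simp

lemmas octads_eq =
  octads_def[unfolded eight, simplified idx_def sublists_xor.simps list.map append.simps xor_tab cond]

lemma planes_map: "map planes idx = map (\<lambda>t. sublists_xor (Suc (Suc (Suc (Suc 0)))) t idx) idx"
  unfolding planes_def[abs_def] four ..
lemmas planes_eq = planes_map[unfolded idx_def, simplified sublists_xor.simps list.map
  append.simps xor_tab cond list.inject]

lemma diff_8: "map (\<lambda>x. x - 8) [8,9,10,11,12,13,14,15] = [0,1,2,3,4,5,6,7::nat]" by simp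
lemmas diff_8_tab = diff_8[simplified list.map list.inject simp_thms]

lemma oct_sign_L: "map (\<lambda>i. map (oct_sign Left_mult i) [0,1,2,3,4,5,6,7]) [0,1,2,3,4,5,6,7] = oct_sign_table"
  by (simp add: oct_sign_table_def)
lemma oct_sign_R: "map (\<lambda>i. map (\<lambda>j. oct_sign Right_mult j i) [0,1,2,3,4,5,6,7]) [0,1,2,3,4,5,6,7] = oct_sign_table"
  by (simp add: oct_sign_table_def)
lemmas oct_sign_tab = oct_sign_L[unfolded oct_sign_table_def, simplified list.map list.inject simp_thms]
  oct_sign_R[unfolded oct_sign_table_def, simplified list.map list.inject simp_thms]

lemma inv_sign_map: "map (\<lambda>a. map (inv_sign s a) idx) idx = map (\<lambda>a. map (\<lambda>p.
    if a = 0 then (if p < 8 then 1 else -1) else if a = 8 then 1 else if a < 8 then 0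
     else if p < 8 then oct_sign s (a - 8) p else - oct_sign s (a - 8) (p - 8)) idx) idx"
  by (simp add: inv_sign_def)
lemmas inv_sign_tab = inv_sign_map[of Left_mult, unfolded idx_def, simplified list.map cond diff_8_tab oct_sign_tab minus_minus list.inject]
   inv_sign_map[of Right_mult, unfolded idx_def, simplified list.map cond diff_8_tab oct_sign_tab minus_minus list.inject]

text \<open>The product of two Kaehler coefficients at the forced middle index b = a + x + y. The
  condition on the first pair then holds automatically, so \<open>x\<close> no longer
  occurs.\<close>

definition psi_psi_value :: "side \<Rightarrow> nat \<Rightarrow> nat \<Rightarrow> nat \<Rightarrow> nat \<Rightarrow> nat \<Rightarrow> nat \<Rightarrow> int" where
  "psi_psi_value s a b c y z w = inv_sign s b y * inv_sign s a (xr y b) *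
     (if z = xr w (xr b c) then inv_sign s c w * inv_sign s b (xr w c) else 0)"

text \<open>The six splittings of four indices into pairs with their shuffle signs. All entries of
  \<open>planes\<close> have length 4, so the default value is never met.\<close>

fun psi2_value :: "side \<Rightarrow> nat \<Rightarrow> nat \<Rightarrow> nat list \<Rightarrow> int" where
  "psi2_value s a c [x, y, z, w] =
    psi_psi_value s a (xr a (xr x y)) c y z w - psi_psi_value s a (xr a (xr x z)) c z y w +
    psi_psi_value s a (xr a (xr x w)) c w y z + psi_psi_value s a (xr a (xr y z)) c z x w -
    psi_psi_value s a (xr a (xr y w)) c w x z + psi_psi_value s a (xr a (xr z w)) c w x y"
| "psi2_value s a c _ = undefined"

lemma psi2_coeff_eq_value:
  assumes "a < 16" "set xs \<subseteq> {..<16}" "length xs = 4"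
  shows "psi2_coeff s a c xs = psi2_value s a c xs"
proof -
  obtain x y z w where xs: "xs = [x, y, z, w]"
    using assms(3) by (auto simp: numeral_eq_Suc length_Suc_conv)
  have "(\<Sum>b<16. psi_coeff s a b [x, y] * psi_coeff s b c [z, w]) = psi_psi_value s a (xr a (xr x y)) c y z w"
    if "x < 16" "y < 16" for x y z w
  proof -
    have "xr y (xr a (xr a (xr x y))) = x"
      by (metis xor.assoc xor.commute xor.left_neutral xor_self_eq)
    then show ?thesis
      unfolding psi_psi_coeff[OF assms(1) that] by (simp add: psi_psi_value_def psi_coeff_def)
  qed
  then show ?thesis using assms(2) unfolding xs by (simp add: psi2_coeff_def shuffle_sum_2)
qed

lemma in_planesD: "xs \<in> set (planes t) \<Longrightarrow> length xs = 4 \<and> set xs \<subseteq> {..<16}"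
  by (auto simp: planes_def set_sublists_xor idx_upt dest!: subseq_imp_subset)

section \<open>Tables for psi^2 and for the trace of psi^4\<close>

definition inv_pairs :: "(nat \<times> nat) list" where
  "inv_pairs = List.product [0,8,9,10,11,12,13,14,15] [0,8,9,10,11,12,13,14,15]"

lemma psi2_map: "map (\<lambda>(a, c). map (psi2_coeff s a c) (planes (xr a c))) inv_pairs =
    map (\<lambda>(a, c). map (psi2_value s a c) (planes (xr a c))) inv_pairs"
proof (rule map_cong[OF refl])
  fix p assume "p \<in> set inv_pairs"
  then obtain a c where "p = (a, c)" "a < 16" by (cases p) (auto simp: inv_pairs_def)
  then show "(case p of (a, c) \<Rightarrow> map (psi2_coeff s a c) (planes (xr a c))) =
      (case p of (a, c) \<Rightarrow> map (psi2_value s a c) (planes (xr a c)))"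
    by (auto intro!: psi2_coeff_eq_value dest: in_planesD)
qed

lemmas psi2_rules = product.simps append.simps append_Nil2 list.map prod.case planes_eq xor_tab cond
  psi2_value.simps psi_psi_value_def inv_sign_tab arith list.inject
lemmas psi2_tab_L = psi2_map[of Left_mult, unfolded inv_pairs_def, simplified psi2_rules]
lemmas psi2_tab_R = psi2_map[of Right_mult, unfolded inv_pairs_def, simplified psi2_rules]

lemma psi2_coeff_0: "0 < a \<Longrightarrow> a < 8 \<Longrightarrow> psi2_coeff s a c xs = 0"
  "0 < c \<Longrightarrow> c < 8 \<Longrightarrow> psi2_coeff s a c xs = 0"
  by (simp_all add: psi2_coeff_def psi_coeff_def inv_sign_def shuffle_sum_zero cong: if_cong)

text \<open>Only the pairs \<open>(a, c)\<close> with bitwise sum \<open>t\<close> contribute to \<open>psi4_coeff\<close>.\<close>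

definition psi4_term :: "side \<Rightarrow> nat \<Rightarrow> nat list \<Rightarrow> nat list \<Rightarrow> int" where
  "psi4_term s t ys zs = (\<Sum>a\<leftarrow>idx. psi2_coeff s a (xr a t) ys * psi2_coeff s (xr a t) a zs)"

lemma psi4_term:
  assumes "length ys = 4" "set ys \<subseteq> {..<16}"
  shows "(\<Sum>a<16. \<Sum>c<16. psi2_coeff s a c ys * psi2_coeff s c a zs) = psi4_term s (xor_list ys) ys zs"
proof -
  let ?t = "xor_list ys"
  have t: "?t < 16" using assms(2) by (rule xor_list_less_16)
  have "(\<Sum>c<16. psi2_coeff s a c ys * psi2_coeff s c a zs) = psi2_coeff s a (xr a ?t) ys * psi2_coeff s (xr a ?t) a zs"
    if "a < 16" for a
  proof -
    have "psi2_coeff s a c ys = 0" if "c \<noteq> xr a ?t" for c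
      using that xor_eq_iff[of a c ?t] by (intro psi2_coeff_eq_0[OF assms(1)]) auto
    then have "(\<Sum>c<16. psi2_coeff s a c ys * psi2_coeff s c a zs) =
        (\<Sum>c<16. if c = xr a ?t then psi2_coeff s a c ys * psi2_coeff s c a zs else 0)"
      by (intro sum.cong) auto
    then show ?thesis using xor_less_16[OF that t] by simp
  qed
  then show ?thesis
    by (simp add: psi4_term_def idx_upt interv_sum_list_conv_sum_set_nat atLeast0LessThan)
qed

lemma psi4_term_map: "map (\<lambda>t. psi4_term s t ys zs) idx =
    map (\<lambda>t. \<Sum>a\<leftarrow>idx. psi2_coeff s a (xr a t) ys * psi2_coeff s (xr a t) a zs) idx"
  by (simp add: psi4_term_def)
lemma psi2_coeff_0_tab:
  "psi2_coeff s 1 c xs = 0" "psi2_coeff s c 1 xs = 0"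
  "psi2_coeff s 2 c xs = 0" "psi2_coeff s c 2 xs = 0"
  "psi2_coeff s 3 c xs = 0" "psi2_coeff s c 3 xs = 0"
  "psi2_coeff s 4 c xs = 0" "psi2_coeff s c 4 xs = 0"
  "psi2_coeff s 5 c xs = 0" "psi2_coeff s c 5 xs = 0"
  "psi2_coeff s 6 c xs = 0" "psi2_coeff s c 6 xs = 0"
  "psi2_coeff s 7 c xs = 0" "psi2_coeff s c 7 xs = 0"
  by (simp_all add: psi2_coeff_0)
lemmas psi4_term_tab = psi4_term_map[unfolded idx_def, simplified list.map sum_list.Cons sum_list.Nil xor_tab
  psi2_coeff_0_tab arith list.inject simp_thms]

definition psi4_value :: "side \<Rightarrow> nat list \<Rightarrow> int" where
  "psi4_value s xs = shuffle_sum 4 xs (\<lambda>ys zs. psi4_term s (xor_list ys) ys zs)"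

lemma psi4_coeff_eq_value: "set xs \<subseteq> {..<16} \<Longrightarrow> psi4_coeff s xs = psi4_value s xs"
  unfolding psi4_coeff_def psi4_value_def
  by (intro shuffle_sum_cong psi4_term) (auto simp: set_shuffles)

lemma in_octads: "xs \<in> set octads \<longleftrightarrow> subseq xs idx \<and> length xs = 8 \<and> xor_list xs = 0"
  by (simp add: octads_def set_sublists_xor)

lemma psi4_map: "map (psi4_coeff s) octads = map (psi4_value s) octads"
  by (intro map_cong refl psi4_coeff_eq_value) (auto simp: in_octads idx_upt dest!: subseq_imp_subset)

lemma xor_0: "xr a 0 = a" for a :: nat by simp

lemmas psi4_value_8 = psi4_value_def[of s "[x1,x2,x3,x4,x5,x6,x7,x8]" for s x1 x2 x3 x4 x5 x6 x7 x8,
  unfolded four, simplified shuffle_sum.simps power_Suc power_0 arith xor_list.simps xor_0]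

lemmas psi4_tab_L = psi4_map[of Left_mult, unfolded octads_eq, simplified list.map psi4_value_8
  xor_tab psi4_term_tab psi2_tab_L arith list.inject simp_thms]
lemmas psi4_tab_R = psi4_map[of Right_mult, unfolded octads_eq, simplified list.map psi4_value_8
  xor_tab psi4_term_tab psi2_tab_R arith list.inject simp_thms]

section \<open>Tables for the moments of the minors\<close>

definition coord_moment_value where "coord_moment_value = coord_moment"
text \<open>Octads contain an even number of primed indices, so these five cases suffice; they are
  in unary because that is how \<open>primed\<close> evaluates.\<close>

lemma coord_moment_value:
  "coord_moment_value s xs 0 = minor_moment (frame_entry s) xs [0,1,2,3,4,5,6,7] []"
  "coord_moment_value s xs (Suc (Suc 0)) = minor_moment (frame_entry s) xs [0,1,2,3,4,5,6,7] []"
  "coord_moment_value s xs (Suc (Suc (Suc (Suc 0)))) = minor_moment (frame_entry s) xs [0,1,2,3,4,5,6,7] []"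
  "coord_moment_value s xs (Suc (Suc (Suc (Suc (Suc (Suc 0)))))) = minor_moment (dual_entry s) xs [0,1,2,3,4,5,6,7] []"
  "coord_moment_value s xs (Suc (Suc (Suc (Suc (Suc (Suc (Suc (Suc 0)))))))) = minor_moment (dual_entry s) xs [0,1,2,3,4,5,6,7] []"
  by (simp_all add: coord_moment_value_def coord_moment_def)

primrec rev_append :: "'a list \<Rightarrow> 'a list \<Rightarrow> 'a list" where
  "rev_append [] ys = ys"
| "rev_append (x # xs) ys = rev_append xs (x # ys)"

text \<open>
  An evaluation of \<open>minor_moment\<close> that builds the list of remaining rows only for nonzero
  entries; \<open>pre\<close> is the reversed list of the rows above the current one.
\<close>

definition minor_moment_step ::
    "(nat \<Rightarrow> nat \<Rightarrow> int \<times> nat list) \<Rightarrow> nat list \<Rightarrow> nat list \<Rightarrow> nat list \<Rightarrow> nat list \<Rightarrow> int \<times> nat list \<Rightarrow> int" where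
  "minor_moment_step entry xs ms pre ys =
    (\<lambda>(c, vs). if c = 0 then 0 else c * minor_moment entry xs (rev_append pre ys) (vs @ ms))"

lemma minor_moment_step_simps:
  "minor_moment_step entry xs ms pre ys (0, vs) = 0"
  "minor_moment_step entry xs ms pre ys (1, vs) = minor_moment entry xs (rev_append pre ys) (vs @ ms)"
  "minor_moment_step entry xs ms pre ys (- 1, vs) = - minor_moment entry xs (rev_append pre ys) (vs @ ms)"
  by (simp_all add: minor_moment_step_def)

primrec minor_moment_rows ::
    "(nat \<Rightarrow> nat \<Rightarrow> int \<times> nat list) \<Rightarrow> nat \<Rightarrow> nat list \<Rightarrow> nat list \<Rightarrow> nat list \<Rightarrow> nat list \<Rightarrow> int" where
  "minor_moment_rows entry x xs ms pre [] = 0"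
| "minor_moment_rows entry x xs ms pre (y # ys) =
    minor_moment_step entry xs ms pre ys (entry x y) - minor_moment_rows entry x xs ms (y # pre) ys"

text \<open>Each step negates everything after it, which reproduces the alternating signs of
  \<open>picks\<close>, and the reversed prefix puts back the rows passed over.\<close>

lemma minor_moment_rows: "minor_moment_rows entry x xs ms pre ys =
    sum_list (map (\<lambda>(e, y, zs). e * minor_moment_step entry xs ms pre zs (entry x y)) (picks ys))"
proof (induction ys arbitrary: pre)
  case (Cons y ys)
  have "minor_moment_step entry xs ms (y # pre) zs = minor_moment_step entry xs ms pre (y # zs)" for zs
    by (rule ext) (simp add: minor_moment_step_def split: prod.split)
  then show ?case
    by (simp add: Cons.IH o_def split_def uminus_sum_list_map)
qed simp

lemma minor_moment_Cons:
  "minor_moment entry (x # xs) ys ms = minor_moment_rows entry x xs ms [] ys"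
  unfolding minor_moment_rows minor_moment.simps
  by (intro arg_cong[of _ _ sum_list] map_cong) (auto simp: minor_moment_step_def split: prod.split)

text \<open>With the count as a separate argument, a count of 0 is recognised before the remaining
  Wick number is expanded.\<close>

definition wick_step :: "int \<Rightarrow> nat \<Rightarrow> nat list \<Rightarrow> int" where
  "wick_step c x xs = c * wick (remove1 x xs)"
lemma wick_Cons: "wick (x # xs) = wick_step (int (count_list xs x)) x xs"
  by (simp add: wick_step_def)
lemma wick_step_simps: "wick_step 0 x xs = 0" "wick_step 1 x xs = wick (remove1 x xs)"
  "wick_step (numeral n) x xs = numeral n * wick (remove1 x xs)"
  by (simp_all add: wick_step_def)
lemma int_count_list: "int (count_list [] y) = 0"
  "int (count_list (x # xs) y) = (if x = y then 1 + int (count_list xs y) else int (count_list xs y))"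
  by simp_all

lemma entries_map: "map (\<lambda>x. map (frame_entry s x) [0,1,2,3,4,5,6,7]) idx =
    map (\<lambda>x. map (\<lambda>y. if x < 8 then (of_bool (x = y), []) else (oct_sign s (xr (x - 8) y) y, [xr (x - 8) y])) [0,1,2,3,4,5,6,7]) idx"
  "map (\<lambda>x. map (dual_entry s x) [0,1,2,3,4,5,6,7]) idx =
    map (\<lambda>x. map (\<lambda>y. if x < 8 then (oct_sign s (xr x y) x, [xr x y]) else (of_bool (x - 8 = y), [])) [0,1,2,3,4,5,6,7]) idx"
  unfolding frame_entry_def dual_entry_def by (rule refl)+
lemmas entries_rules = list.map xor_tab diff_8_tab oct_sign_tab cond of_bool_eq list.inject
lemmas entries_tab_L = entries_map[of Left_mult, unfolded idx_def, simplified entries_rules]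
lemmas entries_tab_R = entries_map[of Right_mult, unfolded idx_def, simplified entries_rules]

lemma coord_moment_map: "map (\<lambda>xs. coord_moment s xs (primed xs)) octads = map (\<lambda>xs. coord_moment_value s xs (primed xs)) octads"
  by (simp add: coord_moment_value_def)
lemmas moment_rules = list.map primed.simps coord_moment_value minor_moment_Cons minor_moment.simps(1)
  minor_moment_rows.simps minor_moment_step_simps rev_append.simps wick.simps(1) wick_Cons wick_step_simps cond append.simps arith int_count_list remove1.simps list.inject
lemmas coord_moment_tab_L = coord_moment_map[of Left_mult, unfolded octads_eq, simplified moment_rules entries_tab_L]
lemmas coord_moment_tab_R = coord_moment_map[of Right_mult, unfolded octads_eq, simplified moment_rules entries_tab_R]

section \<open>Comparison of the two forms\<close>

lemma psi2_trace_zero: "list_all (\<lambda>xs. (\<Sum>a\<leftarrow>idx. psi2_coeff s a a xs) = 0) (planes 0)"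
proof (cases s)
  case Left_mult
  show ?thesis unfolding Left_mult idx_def
    by (simp only: planes_eq list.pred_inject list.map sum_list.Cons sum_list.Nil psi2_coeff_0_tab psi2_tab_L arith cond)
next
  case Right_mult
  show ?thesis unfolding Right_mult idx_def
    by (simp only: planes_eq list.pred_inject list.map sum_list.Cons sum_list.Nil psi2_coeff_0_tab psi2_tab_R arith cond)
qed

lemma psi2_trace: "\<forall>xs\<in>set (planes 0). (\<Sum>a<16. psi2_coeff s a a xs) = 0"
  using psi2_trace_zero[of s]
  by (simp add: list_all_iff idx_upt interv_sum_list_conv_sum_set_nat atLeast0LessThan)

lemma moment_factor_values:
  "moment_factor Left_mult 0 = 80640" "moment_factor Left_mult (Suc (Suc 0)) = 5760"
  "moment_factor Left_mult (Suc (Suc (Suc (Suc 0)))) = 480"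
  "moment_factor Left_mult (Suc (Suc (Suc (Suc (Suc (Suc 0)))))) = 5760"
  "moment_factor Left_mult (Suc (Suc (Suc (Suc (Suc (Suc (Suc (Suc 0)))))))) = 80640"
  "moment_factor Right_mult 0 = -80640" "moment_factor Right_mult (Suc (Suc 0)) = -5760"
  "moment_factor Right_mult (Suc (Suc (Suc (Suc 0)))) = -480"
  "moment_factor Right_mult (Suc (Suc (Suc (Suc (Suc (Suc 0)))))) = -5760"
  "moment_factor Right_mult (Suc (Suc (Suc (Suc (Suc (Suc (Suc (Suc 0)))))))) = -80640"
  by (simp_all add: moment_factor_def fact_numeral)

text \<open>Since tau_4 is -1/4 of the trace, the right-hand side is 16 times a coefficient of
  tau_4, and the integral becomes pi^4 / 11! times tau_4. The listed values are 1440 times 0, +-1,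
  +-2 and +-14, which provides the common divisor.\<close>

definition octad_check :: "side \<Rightarrow> nat list \<Rightarrow> bool" where
  "octad_check s xs \<longleftrightarrow>
    moment_factor s (primed xs) * coord_moment s xs (primed xs) = -4 * psi4_coeff s xs \<and>
    (psi4_coeff s xs = 0 \<or> psi4_coeff s xs = 1440 \<or> psi4_coeff s xs = -1440 \<or>
     psi4_coeff s xs = 2880 \<or> psi4_coeff s xs = -2880 \<or> psi4_coeff s xs = 20160 \<or> psi4_coeff s xs = -20160)"

lemma octad_check: "list_all (octad_check s) octads"
proof (cases s)
  case Left_mult
  show ?thesis unfolding Left_mult
    by (simp only: octads_eq list.pred_inject octad_check_def primed.simps coord_moment_tab_L psi4_tab_L
        moment_factor_values arith cond)
next
  case Right_mult
  show ?thesis unfolding Right_mult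
    by (simp only: octads_eq list.pred_inject octad_check_def primed.simps coord_moment_tab_R psi4_tab_R
        moment_factor_values arith cond)
qed

primrec count_nonzero :: "int list \<Rightarrow> int" where
  "count_nonzero [] = 0"
| "count_nonzero (x # xs) = (if x = 0 then 0 else 1) + count_nonzero xs"

lemma count_nonzero: "count_nonzero (map f xs) = int (length (filter (\<lambda>x. f x \<noteq> 0) xs))"
  by (induction xs) auto

lemma count_nonzero_octads: "count_nonzero (map (psi4_coeff s) octads) = 702"
proof (cases s)
  case Left_mult
  show ?thesis unfolding Left_mult
    by (simp only: octads_eq list.map psi4_tab_L count_nonzero.simps arith cond)
next
  case Right_mult
  show ?thesis unfolding Right_mult
    by (simp only: octads_eq list.map psi4_tab_R count_nonzero.simps arith cond)
qed

lemma card_nonzero_octads: "card {xs \<in> set octads. psi4_coeff s xs \<noteq> 0} = 702"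
proof -
  have "{xs \<in> set octads. psi4_coeff s xs \<noteq> 0} = set (filter (\<lambda>xs. psi4_coeff s xs \<noteq> 0) octads)" by auto
  moreover have "distinct octads" unfolding octads_def by (rule distinct_sublists_xor) (simp add: idx_upt)
  ultimately have "card {xs \<in> set octads. psi4_coeff s xs \<noteq> 0} = length (filter (\<lambda>xs. psi4_coeff s xs \<noteq> 0) octads)"
    by (simp only: distinct_card distinct_filter)
  then show ?thesis using count_nonzero_octads[of s] unfolding count_nonzero by simp
qed

text \<open>A coefficient equal to the common divisor up to sign shows that no larger factor can be
  taken out.\<close>

lemma unit_octad: "\<exists>xs\<in>set octads. \<bar>psi4_coeff s xs\<bar> = 1440"
proof
  \<comment> \<open>The witness consists of 0, 1, 2, 4 and their translates by 8, so the bitwise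
    sums of the two halves cancel.\<close>
  show "[0,1,2,4,8,9,10,12] \<in> set octads"
  proof -
    have "xor_list [0,1,2,4,8,9,10,12] = 0"
      by (simp only: xor_list.simps xor_0 xor_tab)
    then show ?thesis unfolding in_octads idx_def by simp
  qed
  show "\<bar>psi4_coeff s [0,1,2,4,8,9,10,12]\<bar> = 1440"
  proof (cases s)
    case Left_mult
    show ?thesis unfolding Left_mult by (simp only: psi4_tab_L abs_neg_numeral abs_numeral)
  next
    case Right_mult
    show ?thesis unfolding Right_mult by (simp only: psi4_tab_R abs_neg_numeral abs_numeral)
  qed
qed

lemma sorted_wrt_subseq: "subseq ys xs \<Longrightarrow> sorted_wrt P xs \<Longrightarrow> sorted_wrt P ys"
  by (induction rule: list_emb.induct) (auto dest: subseq_imp_subset)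

lemma sorted_octad:
  assumes "xs \<in> set octads"
  shows "set xs \<subseteq> {..<16}" "card (set xs) = 8" "sorted_list_of_set (set xs) = xs"
proof -
  have sub: "subseq xs idx" and len: "length xs = 8" using assms by (auto simp: in_octads)
  then show "set xs \<subseteq> {..<16}" by (auto simp: idx_upt dest!: subseq_imp_subset)
  have "sorted_wrt (<) xs" using sub by (rule sorted_wrt_subseq) (simp add: idx_upt)
  then have "sorted xs" "distinct xs" by (simp_all add: strict_sorted_iff)
  then show "card (set xs) = 8" "sorted_list_of_set (set xs) = xs"
    using len by (auto simp: distinct_card sorted_list_of_set.idem_if_sorted_distinct)
qed

text \<open>The integer coefficients of the normalised form. The division is exact, because the
  numerator is a multiple of 1440 on octads and 0 on the other 8-subsets; the sign is that of tau_4
  = - tr (psi^4) / 4.\<close>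

definition spin9_coeff :: "side \<Rightarrow> nat set \<Rightarrow> int" where
  "spin9_coeff s S = (if S \<subseteq> {..<16} \<and> card S = 8 then - psi4_coeff s (sorted_list_of_set S) div 1440 else 0)"

lemma octad_list:
  assumes "S \<subseteq> {..<16}" "card S = 8"
  defines "xs \<equiv> sorted_list_of_set S"
  shows "sorted_wrt (<) xs" "length xs = 8" "set xs = S" "xor_list xs = 0 \<Longrightarrow> xs \<in> set octads"
proof -
  have "finite S" using assms(1) finite_subset by blast
  then show "sorted_wrt (<) xs" "length xs = 8" "set xs = S" using assms(2) by (auto simp: xs_def)
  then show "xor_list xs = 0 \<Longrightarrow> xs \<in> set octads"
    using sorted_list_of_set_subseq_idx[OF assms(1)] by (simp add: in_octads xs_def)
qed

lemma psi4_coeff_dvd: "xs \<in> set octads \<Longrightarrow> 1440 dvd psi4_coeff s xs"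
  using octad_check[of s] by (auto simp: list_all_iff octad_check_def)

lemma spin9_coeff_psi4:
  assumes "S \<subseteq> {..<16}" "card S = 8"
  shows "1440 * spin9_coeff s S = - psi4_coeff s (sorted_list_of_set S)"
proof (cases "xor_list (sorted_list_of_set S) = 0")
  case True
  then have "1440 dvd - psi4_coeff s (sorted_list_of_set S)"
    using octad_list(4)[OF assms] psi4_coeff_dvd by simp
  then show ?thesis using assms by (simp add: spin9_coeff_def del: dvd_minus_iff)
next
  case False
  then have "psi4_coeff s (sorted_list_of_set S) = 0"
    using octad_list(2)[OF assms] by (simp add: psi4_coeff_eq_0)
  then show ?thesis by (simp add: spin9_coeff_def)
qed

lemma form_coeff_tau_4_eq: "form_coeff (tau 4 (kahler_matrix s)) S = 360 * of_int (spin9_coeff s S)"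
proof (cases "S \<subseteq> {..<16} \<and> card S = 8")
  case True
  then have S: "S \<subseteq> {..<16}" "card S = 8" by auto
  have "form_coeff (tau 4 (kahler_matrix s)) S = - of_int (psi4_coeff s (sorted_list_of_set S)) / 4"
    using form_coeff_tau_4[OF psi2_trace octad_list(1,2)[OF S]] octad_list(3)[OF S] S by simp
  also have "\<dots> = of_int (1440 * spin9_coeff s S) / 4"
    unfolding spin9_coeff_psi4[OF S] by simp
  finally show ?thesis by simp
next
  case False
  then have "form_coeff (tau 4 (kahler_matrix s)) S = 0"
    using homogeneous_tau_4[OF psi2_trace, of s] form_coeff_support[of _ S] unfolding homogeneous_def by blast
  then show ?thesis using False by (auto simp: spin9_coeff_def)
qed

lemma form_coeff_line_integral_form_eq:
  "form_coeff (line_integral_form s) S = pi ^ 4 / 110880 * of_int (spin9_coeff s S)"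
proof (cases "S \<subseteq> {..<16} \<and> card S = 8")
  case True
  then have S: "S \<subseteq> {..<16}" "card S = 8" by auto
  define xs where "xs = sorted_list_of_set S"
  note xs = octad_list[OF S, folded xs_def]
  show ?thesis
  proof (cases "xor_list xs = 0")
    case xor: True
    have "form_coeff (line_integral_form s) S =
        pi ^ 4 / (fact 11 * 16) * of_int (moment_factor s (primed xs) * coord_moment s xs (primed xs))"
      using form_coeff_line_integral_form_octad[OF xs(1,2) _ xor] xs(3) S by simp
    also have "moment_factor s (primed xs) * coord_moment s xs (primed xs) = -4 * psi4_coeff s xs"
      using octad_check[of s] xs(4)[OF xor] by (simp add: list_all_iff octad_check_def)
    \<comment> \<open>5760 = 4 * 1440, and 11! * 16 / 5760 = 110880.\<close>
    also have "-4 * psi4_coeff s xs = 5760 * spin9_coeff s S"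
      using spin9_coeff_psi4[OF S, of s] by (simp add: xs_def)
    finally show ?thesis by (simp add: fact_numeral)
  next
    case False
    then have "minor_moment (frame_entry s) xs oct_idx [] = 0"
      using xs S by (intro minor_moment_frame_eq_0) auto
    then have "form_coeff (line_integral_form s) S = 0"
      using form_coeff_line_integral_form[OF xs(1,2) _ has_bochner_integral_frame[OF xs(2)], of s] xs(3) S by simp
    moreover have "spin9_coeff s S = 0"
      using spin9_coeff_psi4[OF S, of s] psi4_coeff_eq_0[OF xs(2) False, of s] by (simp add: xs_def)
    ultimately show ?thesis by simp
  qed
next
  case False
  then have "form_coeff (line_integral_form s) S = 0"
    by (auto simp: line_integral_form_def form_of.rep_eq)
  then show ?thesis using False by (auto simp: spin9_coeff_def)
qed

lemma card_spin9_coeff: "card {S. spin9_coeff s S \<noteq> 0} = 702"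
proof -
  have "{S. spin9_coeff s S \<noteq> 0} = set ` {xs \<in> set octads. psi4_coeff s xs \<noteq> 0}"
  proof (intro Set.equalityI subsetI)
    fix S assume "S \<in> {S. spin9_coeff s S \<noteq> 0}"
    then have ne: "spin9_coeff s S \<noteq> 0" by simp
    then have S: "S \<subseteq> {..<16}" "card S = 8" by (auto simp: spin9_coeff_def split: if_splits)
    then have ne': "psi4_coeff s (sorted_list_of_set S) \<noteq> 0"
      using spin9_coeff_psi4[OF S, of s] ne by auto
    then have "sorted_list_of_set S \<in> set octads"
      using octad_list(2,4)[OF S] psi4_coeff_eq_0 by blast
    then show "S \<in> set ` {xs \<in> set octads. psi4_coeff s xs \<noteq> 0}"
      using ne' octad_list(3)[OF S] by (intro image_eqI[of _ _ "sorted_list_of_set S"]) auto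
  next
    fix S assume "S \<in> set ` {xs \<in> set octads. psi4_coeff s xs \<noteq> 0}"
    then obtain xs where xs: "S = set xs" "xs \<in> set octads" "psi4_coeff s xs \<noteq> 0" by auto
    then have "S \<subseteq> {..<16}" "card S = 8" "sorted_list_of_set S = xs"
      using sorted_octad[OF xs(2)] by auto
    then show "S \<in> {S. spin9_coeff s S \<noteq> 0}" using spin9_coeff_psi4[of S s] xs(3) by auto
  qed
  moreover have "inj_on set {xs \<in> set octads. psi4_coeff s xs \<noteq> 0}"
    by (intro inj_onI) (metis (no_types, lifting) mem_Collect_eq sorted_octad(3))
  ultimately show ?thesis by (simp add: card_image card_nonzero_octads)
qed

lemma unit_spin9_coeff: "\<exists>S. \<bar>spin9_coeff s S\<bar> = 1"
proof -
  obtain xs where xs: "xs \<in> set octads" "\<bar>psi4_coeff s xs\<bar> = 1440" using unit_octad by blast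
  then have "\<bar>spin9_coeff s (set xs)\<bar> = 1"
    using spin9_coeff_psi4[of "set xs" s] sorted_octad[OF xs(1)] by auto
  then show ?thesis ..
qed

lemma Gcd_spin9_coeff: "Gcd (range (spin9_coeff s)) = 1"
proof -
  obtain S where "\<bar>spin9_coeff s S\<bar> = 1" using unit_spin9_coeff by blast
  moreover have "Gcd (range (spin9_coeff s)) dvd spin9_coeff s S" by (intro Gcd_dvd) auto
  ultimately have "is_unit (Gcd (range (spin9_coeff s)))"
    by (metis dvd_abs_iff)
  then show ?thesis by simp
qed

theorem mainTheorem1:
  fixes s :: side
  shows "(\<forall>c > 0. primitive_integral (c *\<^sub>R line_integral_form s) \<longleftrightarrow> c = 110880 / pi ^ 4) \<and>
    card {S. form_coeff ((110880 / pi ^ 4) *\<^sub>R line_integral_form s) S \<noteq> 0} = 702 \<and>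
    (110880 / pi ^ 4) *\<^sub>R line_integral_form s = (1 / 360) *\<^sub>R tau 4 (kahler_matrix s)"
proof (intro conjI allI impI)
  let ?a = "spin9_coeff s"
  have coeff: "form_coeff (c *\<^sub>R line_integral_form s) S = c * (pi ^ 4 / 110880) * of_int (?a S)" for c S
    by (simp add: scaleR_even_form.rep_eq form_coeff_line_integral_form_eq)
  fix c :: real assume c: "0 < c"
  show "primitive_integral (c *\<^sub>R line_integral_form s) \<longleftrightarrow> c = 110880 / pi ^ 4"
  proof
    assume "c = 110880 / pi ^ 4"
    then have "\<forall>S. form_coeff (c *\<^sub>R line_integral_form s) S = of_int (?a S)" by (simp add: coeff)
    then show "primitive_integral (c *\<^sub>R line_integral_form s)"
      unfolding primitive_integral_def using Gcd_spin9_coeff by blast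
  next
    assume "primitive_integral (c *\<^sub>R line_integral_form s)"
    then obtain b where b: "\<And>S. of_int (b S) = c * (pi ^ 4 / 110880) * of_int (?a S)" "Gcd (range b) = 1"
      unfolding primitive_integral_def coeff by metis
    \<comment> \<open>The ratio of the given integer form to the primitive one. At an octad with
      coefficient +-1 it equals \<open>\<bar>b S\<bar>\<close>, so it is an integer that divides
      every \<open>b T\<close>, and a greatest common divisor of 1 forces r = 1; positivity of c
      excludes r = -1.\<close>
    define r where "r = c * (pi ^ 4 / 110880)"
    have r: "0 < r" using c by (simp add: r_def)
    obtain S where S: "\<bar>?a S\<bar> = 1" using unit_spin9_coeff by blast
    have bT: "real_of_int (b T) = r * of_int (?a T)" for T using b(1)[of T] unfolding r_def .
    have "real_of_int \<bar>b S\<bar> = r * of_int \<bar>?a S\<bar>"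
      using r by (simp only: of_int_abs bT abs_mult abs_of_pos)
    then have n: "of_int \<bar>b S\<bar> = r" using S by simp
    have "\<bar>b S\<bar> dvd b T" for T
    proof -
      have "real_of_int (b T) = of_int (\<bar>b S\<bar> * ?a T)"
        by (simp only: bT of_int_mult n)
      then show ?thesis by (simp only: of_int_eq_iff dvd_triv_left)
    qed
    then have "\<bar>b S\<bar> dvd Gcd (range b)" by (intro Gcd_greatest) auto
    then have "\<bar>b S\<bar> = 1" using b(2) by simp
    then have "r = 1" using n by simp
    then show "c = 110880 / pi ^ 4" by (simp add: r_def field_simps)
  qed
next
  have coeff: "form_coeff ((110880 / pi ^ 4) *\<^sub>R line_integral_form s) S = of_int (spin9_coeff s S)" for S
    by (simp add: scaleR_even_form.rep_eq form_coeff_line_integral_form_eq)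
  then show "card {S. form_coeff ((110880 / pi ^ 4) *\<^sub>R line_integral_form s) S \<noteq> 0} = 702"
    using card_spin9_coeff[of s] by simp
  have "form_coeff ((110880 / pi ^ 4) *\<^sub>R line_integral_form s) = form_coeff ((1 / 360) *\<^sub>R tau 4 (kahler_matrix s))"
    by (rule ext) (simp only: coeff, simp add: scaleR_even_form.rep_eq form_coeff_tau_4_eq)
  then show "(110880 / pi ^ 4) *\<^sub>R line_integral_form s = (1 / 360) *\<^sub>R tau 4 (kahler_matrix s)"
    by (simp only: form_coeff_inject)
qed

end
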